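(* (a) For every isomorphism $f\colon G\to G'$ and $(H,\Phi)\in\mathcal{X}(G)$ one has $\mathrm{iso}_f(e_{(H,\Phi)}^G) = e_{(f(H),\Phi\circ (f|_H)^* )}^{G'}$. (b) For every $g\in G$, $H\le G$, and $(K,\Psi)\in\mathcal{X}(H)$ one has ${}^g\bigl(e_{(K,\Psi)}^H\bigr) = e_{({}^gK,{}^g\Psi)}^{{}^gH}$. (c) For every $(H,\Phi)\in\mathcal{X}(G)$ and $\alpha\in G^*$ one has $\mathrm{tw}_\alpha(e_{(H,\Phi)}^G) = \Phi(\alpha|_H)\, e_{(H,\Phi)}^G$ and $\Delta(e_{(H,\Phi)}^G)\cdot_G \mathrm{tw}_\alpha= \Phi(\alpha|_H)\, \Delta(e_{(H,\Phi)}^G)$.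
   Context: $A$ is a multiplicatively written abelian group; for a finite group $H$, $H^*:=\mathrm{Hom}(H,A)$ with pointwise multiplication; a homomorphism $f\colon H\to H'$ induces $f^*\colon H'^*\to H^*$, $\lambda\mapsto\lambda\circ f$. $G$ is a finite group such that $S^*$ is finite for all subquotients $S$ of $G$, and $\mathbb{K}$ is a field of characteristic $0$ which is a splitting field of $S^*$ for all subquotients $S$ of $G$. For a finite group $S$, $[U,\phi]_S$ denotes the $S$-conjugacy class of a pair $(U,\phi)$ with $U\le S$, $\phi\in U^*$, where ${}^g(U,\phi)=({}^gU,{}^g\phi)$, ${}^gU=gUg^{-1}$, $({}^g\phi)(x)=\phi(g^{-1}xg)$. $B^A_{\mathbb{K}}(S)$ is the $\mathbb{K}$-vector space with basis these classes and multiplication $[U,\phi]_S\cdot[V,\psi]_S=\sum_{g\in[U\backslash S/V]}[U\cap{}^gV,\phi|_{U\cap{}^gV}\cdot({}^g\psi)|_{U\cap{}^gV}]_S$. $\mathcal{X}(S)$ is the set of pairs $(H,\Phi)$ with $H\le S$, $\Phi\in\mathrm{Hom}(H^*,\mathbb{K}^\times)$, with $S$-action ${}^g(H,\Phi)=({}^gH,{}^g\Phi)$, ${}^g\Phi(\phi)=\Phi({}^{g^{-1}}\phi)$. $s^S_{(H,\Phi)}:=s^H_\Phi\circ\pi_H\circ\mathrm{res}^S_H\colon B^A_{\mathbb{K}}(S)\to\mathbb{K}$, where $\mathrm{res}^S_H([U,\phi]_S)=\sum_{g\in[H\backslash S/U]}[H\cap{}^gU,({}^g\phi)|_{H\cap{}^gU}]_H$,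 $\pi_H([U,\phi]_H)=\phi\in\mathbb{K}H^*$ if $U=H$ and $0$ otherwise, $s^H_\Phi\colon\mathbb{K}H^*\to\mathbb{K}$ the linear extension of $\Phi$. $e^S_{(H,\Phi)}\in B^A_{\mathbb{K}}(S)$ is the unique (primitive) idempotent with $s^S_{(K,\Psi)}(e^S_{(H,\Phi)})=1$ if $(K,\Psi)$ is $S$-conjugate to $(H,\Phi)$ and $0$ otherwise. For an isomorphism $f\colon G\to G'$, $\mathrm{iso}_f\colon B^A_{\mathbb{K}}(G)\to B^A_{\mathbb{K}}(G')$, $[U,\phi]_G\mapsto[f(U),\phi\circ f^{-1}|_{f(U)}]_{G'}$; $f|_H$ is viewed as an isomorphism $H\to f(H)$. For $g\in G$, $H\le G$ and $x\in B^A_{\mathbb{K}}(H)$, ${}^gx:=\mathrm{iso}_{c_g}(x)\in B^A_{\mathbb{K}}({}^gH)$ with $c_g\colon H\to gHg^{-1}$ conjugation, so ${}^g[U,\phi]_H=[{}^gU,{}^g\phi]_{{}^gH}$. For $\alpha\in G^*$, $\mathrm{tw}_\alpha([U,\phi]_G)=[U,\alpha|_U\cdot\phi]_G$ (extended linearly); as an element of $B^A_{\mathbb{K}}(G,G)$, $\mathrm{tw}_\alpha:=\Delta([G,\alpha]_G)$. Here $B^A_{\mathbb{K}}(G,G):=B^A_{\mathbb{K}}(G\times G)$ with basis elements written $\left[\frac{G\times G}{U,\phi}\right]$, and $\Delta\colon B^A_{\mathbb{K}}(G)\to B^A_{\mathbb{K}}(G,G)$ is the linear map $[U,\phi]_G\mapsto\left[\frac{G\times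 G}{\Delta(U),\Delta(\phi)}\right]$, $\Delta(U)=\{(u,u)\mid u\in U\}$, $\Delta(\phi)(u,u)=\phi(u)$. The product $\cdot_G$ on $B^A_{\mathbb{K}}(G,G)$ is $$\left[\tfrac{G\times G}{U,\phi}\right]\cdot_G\left[\tfrac{G\times G}{V,\psi}\right]=\sum_t\left[\tfrac{G\times G}{U*{}^{(t,1)}V,\ \phi*{}^{(t,1)}\psi}\right],$$ the sum over $t\in[p_2(U)\backslash G/p_1(V)]$ with $\phi_2|_{G_t}={}^t\psi_1|_{G_t}$, $G_t=k_2(U)\cap{}^tk_1(V)$. Here $p_1,p_2$ are the projections, $k_1(U)=\{g\mid(g,1)\in U\}$, $k_2(U)=\{g\mid(1,g)\in U\}$, $\phi|_{k_1(U)\times k_2(U)}=\phi_1\times\phi_2^{-1}$, $U*V=\{(g,k)\mid\exists h:(g,h)\in U,(h,k)\in V\}$, and $(\phi*\psi)(g,k)=\phi(g,h)\psi(h,k)$ for any such $h$. *)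

theory Defs
  imports
    "HOL-Algebra.Algebra"
    "HOL-Library.Poly_Mapping"
    "Jordan_Normal_Form.VS_Connect"
begin

hide_const (open) Multiset.mult

abbreviation restr_group :: "'g monoid \<Rightarrow> 'g set \<Rightarrow> 'g monoid" (infixl \<open>\<restriction>\<close> 90) where
  "G \<restriction> H \<equiv> G\<lparr>carrier := H\<rparr>"


section \<open>Dual groups and splitting fields\<close>

text \<open>Functions on a group are taken extensional (\<open>undefined\<close> off the carrier), so that equality
  of functions is equality on the carrier and \<open>Hom(H, A)\<close> has the right cardinality.\<close>

definition dual :: "'g monoid \<Rightarrow> 'a monoid \<Rightarrow> ('g \<Rightarrow> 'a) monoid" where
  "dual H A = \<lparr>carrier = hom H A \<inter> extensional (carrier H),
               mult = (\<lambda>\<phi> \<psi>. \<lambda>x\<in>carrier H. \<phi> x \<otimes>\<^bsub>A\<^esub> \<psi> x),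
               one = (\<lambda>x\<in>carrier H. \<one>\<^bsub>A\<^esub>)\<rparr>"

definition dual_map :: "'g monoid \<Rightarrow> ('g \<Rightarrow> 'h) \<Rightarrow> ('h \<Rightarrow> 'a) \<Rightarrow> ('g \<Rightarrow> 'a)" where
  "dual_map H f \<mu> = compose (carrier H) \<mu> f"

definition field_units :: "'k::field monoid" where
  "field_units = \<lparr>carrier = UNIV - {0}, mult = (*), one = 1\<rparr>"

definition matrix_rep :: "'g monoid \<Rightarrow> nat \<Rightarrow> ('g \<Rightarrow> 'k::field mat) \<Rightarrow> bool" where
  "matrix_rep H n \<rho> \<longleftrightarrow>
     (\<forall>g\<in>carrier H. \<rho> g \<in> carrier_mat n n) \<and>
     \<rho> \<one>\<^bsub>H\<^esub> = 1\<^sub>m n \<and>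
     (\<forall>g\<in>carrier H. \<forall>h\<in>carrier H. \<rho> (g \<otimes>\<^bsub>H\<^esub> h) = \<rho> g * \<rho> h)"

definition irreducible_rep :: "'g monoid \<Rightarrow> nat \<Rightarrow> ('g \<Rightarrow> 'k::field mat) \<Rightarrow> bool" where
  "irreducible_rep H n \<rho> \<longleftrightarrow> matrix_rep H n \<rho> \<and> n > 0 \<and>
     (\<forall>W. VectorSpace.subspace class_ring W (module_vec TYPE('k) n) \<longrightarrow>
          (\<forall>g\<in>carrier H. \<forall>w\<in>W. \<rho> g *\<^sub>v w \<in> W) \<longrightarrow>
          W = {0\<^sub>v n} \<or> W = carrier_vec n)"

text \<open>\<open>'k\<close> is a splitting field of the finite group \<open>H\<close> if \<open>End\<^bsub>'k H\<^esub>(V) = 'k\<close> for every simple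
  \<open>'k H\<close>-module \<open>V\<close>.\<close>

definition splitting_field :: "'k::field itself \<Rightarrow> 'g monoid \<Rightarrow> bool" where
  "splitting_field (_ :: 'k itself) H \<longleftrightarrow>
     (\<forall>n (\<rho> :: 'g \<Rightarrow> 'k mat). irreducible_rep H n \<rho> \<longrightarrow>
        (\<forall>T\<in>carrier_mat n n. (\<forall>g\<in>carrier H. T * \<rho> g = \<rho> g * T) \<longrightarrow>
           (\<exists>c. T = c \<cdot>\<^sub>m 1\<^sub>m n)))"


section \<open>Conjugation and double cosets\<close>

definition conj_map :: "'g monoid \<Rightarrow> 'g \<Rightarrow> 'g \<Rightarrow> 'g" where
  "conj_map G g x = g \<otimes>\<^bsub>G\<^esub> x \<otimes>\<^bsub>G\<^esub> inv\<^bsub>G\<^esub> g"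

definition conj_set :: "'g monoid \<Rightarrow> 'g \<Rightarrow> 'g set \<Rightarrow> 'g set" where
  "conj_set G g U = conj_map G g ` U"

text \<open>\<open>conj_fun G g U \<phi>\<close> is the conjugate by \<open>g\<close> of a function \<open>\<phi>\<close> with domain \<open>U\<close>; its domain is
  \<open>conj_set G g U\<close>.\<close>

definition conj_fun :: "'g monoid \<Rightarrow> 'g \<Rightarrow> 'g set \<Rightarrow> ('g \<Rightarrow> 'a) \<Rightarrow> ('g \<Rightarrow> 'a)" where
  "conj_fun G g U \<phi> = (\<lambda>x\<in>conj_set G g U. \<phi> (inv\<^bsub>G\<^esub> g \<otimes>\<^bsub>G\<^esub> x \<otimes>\<^bsub>G\<^esub> g))"

definition double_cosets :: "'g monoid \<Rightarrow> 'g set \<Rightarrow> 'g set \<Rightarrow> 'g set set" where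
  "double_cosets G U V = {(U #>\<^bsub>G\<^esub> g) <#>\<^bsub>G\<^esub> V | g. g \<in> carrier G}"

definition dc_reps :: "'g monoid \<Rightarrow> 'g set \<Rightarrow> 'g set \<Rightarrow> 'g set" where
  "dc_reps G U V = (\<lambda>D. SOME g. g \<in> D) ` double_cosets G U V"


section \<open>The vector space \<open>B\<^sup>A\<^sub>K(S)\<close> and its product\<close>

type_synonym ('g, 'a) pair_class = "('g set \<times> ('g \<Rightarrow> 'a)) set"

type_synonym ('g, 'a, 'k) fburn = "('g, 'a) pair_class \<Rightarrow>\<^sub>0 'k"

abbreviation scal :: "'k::field \<Rightarrow> ('c \<Rightarrow>\<^sub>0 'k) \<Rightarrow> ('c \<Rightarrow>\<^sub>0 'k)" (infixr \<open>*\<^sub>K\<close> 75) where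
  "c *\<^sub>K x \<equiv> Poly_Mapping.map ((*) c) x"

definition pair_class :: "'g monoid \<Rightarrow> 'g set \<Rightarrow> ('g \<Rightarrow> 'a) \<Rightarrow> ('g, 'a) pair_class" where
  "pair_class S U \<phi> = {(conj_set S g U, conj_fun S g U \<phi>) | g. g \<in> carrier S}"

definition basis :: "'g monoid \<Rightarrow> 'g set \<Rightarrow> ('g \<Rightarrow> 'a) \<Rightarrow> ('g, 'a, 'k::field) fburn" where
  "basis S U \<phi> = Poly_Mapping.single (pair_class S U \<phi>) 1"

definition fburn_carrier :: "'g monoid \<Rightarrow> 'a monoid \<Rightarrow> ('g, 'a, 'k::field) fburn set" where
  "fburn_carrier S A =
     {x. Poly_Mapping.keys x \<subseteq>
         {pair_class S U \<phi> | U \<phi>. subgroup U S \<and> \<phi> \<in> carrier (dual (S \<restriction> U) A)}}"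

text \<open>\<open>lin_ext F\<close> is the linear map sending the class of \<open>(U, \<phi>)\<close> to \<open>F U \<phi>\<close>. It evaluates \<open>F\<close> at a
  chosen representative of the class, and is only used for \<open>F\<close> constant on classes.\<close>

definition lin_ext ::
  "('g set \<Rightarrow> ('g \<Rightarrow> 'a) \<Rightarrow> ('c \<Rightarrow>\<^sub>0 'k)) \<Rightarrow> ('g, 'a, 'k::field) fburn \<Rightarrow> ('c \<Rightarrow>\<^sub>0 'k)" where
  "lin_ext F x = (\<Sum>c\<in>Poly_Mapping.keys x.
     Poly_Mapping.lookup x c *\<^sub>K (case (SOME p. p \<in> c) of (U, \<phi>) \<Rightarrow> F U \<phi>))"

definition fburn_mult ::
  "'g monoid \<Rightarrow> 'a monoid \<Rightarrow> ('g, 'a, 'k::field) fburn \<Rightarrow> ('g, 'a, 'k) fburn \<Rightarrow> ('g, 'a, 'k) fburn"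
  where
  "fburn_mult S A x y =
     lin_ext (\<lambda>U \<phi>. lin_ext (\<lambda>V \<psi>.
       \<Sum>g\<in>dc_reps S U V.
         let W = U \<inter> conj_set S g V in
           basis S W (restrict \<phi> W \<otimes>\<^bsub>dual (S \<restriction> W) A\<^esub> restrict (conj_fun S g V \<psi>) W)) y) x"


section \<open>Marks and primitive idempotents\<close>

definition XX :: "'g monoid \<Rightarrow> 'a monoid \<Rightarrow> ('g set \<times> (('g \<Rightarrow> 'a) \<Rightarrow> 'k::field)) set" where
  "XX S A = {(H, \<Phi>). subgroup H S \<and>
     \<Phi> \<in> hom (dual (S \<restriction> H) A) field_units \<inter> extensional (carrier (dual (S \<restriction> H) A))}"

definition conj_char ::
  "'g monoid \<Rightarrow> 'a monoid \<Rightarrow> 'g \<Rightarrow> 'g set \<Rightarrow> (('g \<Rightarrow> 'a) \<Rightarrow> 'k) \<Rightarrow> (('g \<Rightarrow> 'a) \<Rightarrow> 'k)" where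
  "conj_char S A g H \<Phi> =
     (\<lambda>\<phi>\<in>carrier (dual (S \<restriction> conj_set S g H) A). \<Phi> (conj_fun S (inv\<^bsub>S\<^esub> g) (conj_set S g H) \<phi>))"

definition fburn_res ::
  "'g monoid \<Rightarrow> 'g set \<Rightarrow> ('g, 'a, 'k::field) fburn \<Rightarrow> ('g, 'a, 'k) fburn" where
  "fburn_res S H = lin_ext (\<lambda>U \<phi>. \<Sum>g\<in>dc_reps S H U.
     let W = H \<inter> conj_set S g U in basis (S \<restriction> H) W (restrict (conj_fun S g U \<phi>) W))"

text \<open>The group algebra \<open>K H\<^sup>*\<close> is modelled by finitely supported functions on \<open>H\<^sup>*\<close>; its product is
  not needed.\<close>

definition fburn_pi :: "'g set \<Rightarrow> ('g, 'a, 'k::field) fburn \<Rightarrow> (('g \<Rightarrow> 'a) \<Rightarrow>\<^sub>0 'k)" where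
  "fburn_pi H = lin_ext (\<lambda>U \<phi>. if U = H then Poly_Mapping.single \<phi> 1 else 0)"

definition char_ext :: "(('g \<Rightarrow> 'a) \<Rightarrow> 'k) \<Rightarrow> (('g \<Rightarrow> 'a) \<Rightarrow>\<^sub>0 'k::field) \<Rightarrow> 'k" where
  "char_ext \<Phi> x = (\<Sum>\<phi>\<in>Poly_Mapping.keys x. Poly_Mapping.lookup x \<phi> * \<Phi> \<phi>)"

definition fburn_mark ::
  "'g monoid \<Rightarrow> 'g set \<Rightarrow> (('g \<Rightarrow> 'a) \<Rightarrow> 'k) \<Rightarrow> ('g, 'a, 'k::field) fburn \<Rightarrow> 'k" where
  "fburn_mark S H \<Phi> x = char_ext \<Phi> (fburn_pi H (fburn_res S H x))"

definition fburn_idem ::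
  "'g monoid \<Rightarrow> 'a monoid \<Rightarrow> 'g set \<Rightarrow> (('g \<Rightarrow> 'a) \<Rightarrow> 'k) \<Rightarrow> ('g, 'a, 'k::field) fburn" where
  "fburn_idem S A H \<Phi> = (THE e. e \<in> fburn_carrier S A \<and> fburn_mult S A e e = e \<and>
     (\<forall>(K, \<Psi>)\<in>XX S A. fburn_mark S K \<Psi> e =
        (if \<exists>g\<in>carrier S. (K, \<Psi>) = (conj_set S g H, conj_char S A g H \<Phi>) then 1 else 0)))"


section \<open>Isomorphisms, twists and the algebra \<open>B\<^sup>A\<^sub>K(G, G)\<close>\<close>

definition fburn_iso ::
  "'g monoid \<Rightarrow> 'h monoid \<Rightarrow> ('g \<Rightarrow> 'h) \<Rightarrow> ('g, 'a, 'k::field) fburn \<Rightarrow> ('h, 'a, 'k) fburn" where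
  "fburn_iso G G' f = lin_ext (\<lambda>U \<phi>.
     basis G' (f ` U) (\<lambda>y\<in>f ` U. \<phi> (inv_into (carrier G) f y)))"

definition fburn_conj ::
  "'g monoid \<Rightarrow> 'g \<Rightarrow> 'g set \<Rightarrow> ('g, 'a, 'k::field) fburn \<Rightarrow> ('g, 'a, 'k) fburn" where
  "fburn_conj G g H = fburn_iso (G \<restriction> H) (G \<restriction> conj_set G g H) (conj_map G g)"

definition fburn_tw ::
  "'g monoid \<Rightarrow> 'a monoid \<Rightarrow> ('g \<Rightarrow> 'a) \<Rightarrow> ('g, 'a, 'k::field) fburn \<Rightarrow> ('g, 'a, 'k) fburn" where
  "fburn_tw G A \<alpha> = lin_ext (\<lambda>U \<phi>. basis G U (restrict \<alpha> U \<otimes>\<^bsub>dual (G \<restriction> U) A\<^esub> \<phi>))"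

definition fburn_Delta ::
  "'g monoid \<Rightarrow> ('g, 'a, 'k::field) fburn \<Rightarrow> ('g \<times> 'g, 'a, 'k) fburn" where
  "fburn_Delta G = lin_ext (\<lambda>U \<phi>. basis (G \<times>\<times> G) (Id_on U) (\<lambda>(u, v)\<in>Id_on U. \<phi> u))"

definition tw_elem :: "'g monoid \<Rightarrow> ('g \<Rightarrow> 'a) \<Rightarrow> ('g \<times> 'g, 'a, 'k::field) fburn" where
  "tw_elem G \<alpha> = fburn_Delta G (basis G (carrier G) \<alpha>)"

definition k1 :: "'g monoid \<Rightarrow> ('g \<times> 'g) set \<Rightarrow> 'g set" where
  "k1 G U = {g. (g, \<one>\<^bsub>G\<^esub>) \<in> U}"

definition k2 :: "'g monoid \<Rightarrow> ('g \<times> 'g) set \<Rightarrow> 'g set" where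
  "k2 G U = {g. (\<one>\<^bsub>G\<^esub>, g) \<in> U}"

text \<open>The defining equation \<open>\<phi>(g, h) = \<phi>\<^sub>1(g) \<phi>\<^sub>2(h)\<^sup>-\<^sup>1\<close> on \<open>k\<^sub>1(U) \<times> k\<^sub>2(U)\<close> introduces the inverse
  in \<open>\<phi>\<^sub>2\<close>.\<close>

definition fun1 :: "'g monoid \<Rightarrow> ('g \<times> 'g) set \<Rightarrow> ('g \<times> 'g \<Rightarrow> 'a) \<Rightarrow> ('g \<Rightarrow> 'a)" where
  "fun1 G U \<phi> = (\<lambda>g\<in>k1 G U. \<phi> (g, \<one>\<^bsub>G\<^esub>))"

definition fun2 :: "'g monoid \<Rightarrow> 'a monoid \<Rightarrow> ('g \<times> 'g) set \<Rightarrow> ('g \<times> 'g \<Rightarrow> 'a) \<Rightarrow> ('g \<Rightarrow> 'a)" where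
  "fun2 G A U \<phi> = (\<lambda>g\<in>k2 G U. inv\<^bsub>A\<^esub> \<phi> (\<one>\<^bsub>G\<^esub>, g))"

text \<open>\<open>U * V\<close> is relation composition \<open>U O V\<close>.\<close>

definition star_fun ::
  "'a monoid \<Rightarrow> ('g \<times> 'g) set \<Rightarrow> ('g \<times> 'g) set \<Rightarrow> ('g \<times> 'g \<Rightarrow> 'a) \<Rightarrow> ('g \<times> 'g \<Rightarrow> 'a)
    \<Rightarrow> ('g \<times> 'g \<Rightarrow> 'a)" where
  "star_fun A U V \<phi> \<psi> = (\<lambda>(g, k)\<in>U O V.
     let h = (SOME h. (g, h) \<in> U \<and> (h, k) \<in> V) in \<phi> (g, h) \<otimes>\<^bsub>A\<^esub> \<psi> (h, k))"

definition bimult ::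
  "'g monoid \<Rightarrow> 'a monoid \<Rightarrow> ('g \<times> 'g, 'a, 'k::field) fburn \<Rightarrow> ('g \<times> 'g, 'a, 'k) fburn
    \<Rightarrow> ('g \<times> 'g, 'a, 'k) fburn" where
  "bimult G A x y =
     lin_ext (\<lambda>U \<phi>. lin_ext (\<lambda>V \<psi>.
       \<Sum>t\<in>{t\<in>dc_reps G (snd ` U) (fst ` V).
            let Gt = k2 G U \<inter> conj_set G t (k1 G V) in
              restrict (fun2 G A U \<phi>) Gt = restrict (conj_fun G t (k1 G V) (fun1 G V \<psi>)) Gt}.
         let V' = conj_set (G \<times>\<times> G) (t, \<one>\<^bsub>G\<^esub>) V;
             \<psi>' = conj_fun (G \<times>\<times> G) (t, \<one>\<^bsub>G\<^esub>) V \<psi>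
         in basis (G \<times>\<times> G) (U O V') (star_fun A U V' \<phi> \<psi>')) y) x"

end

theory Submission
  imports Defs "HOL-Library.Function_Algebras"
begin

text \<open>
  Apart from the identity about \<open>\<Delta>\<close>, every claim compares two elements of a space \<open>B\<close> that are
  characterised by their marks, so the proof rests on the fact that \<open>fburn_idem S A H \<Phi>\<close> is exactly the element of \<open>B\<close> whose mark at
  \<open>(K, \<Psi>)\<close> is \<open>1\<close> or \<open>0\<close> according to whether \<open>(K, \<Psi>)\<close> is \<open>S\<close>-conjugate to \<open>(H, \<Phi>)\<close>
  (\<open>fburn_idem_eqI\<close>, \<open>fburn_idem_props\<close>).

  Marks are computed through the formula \<open>mark_basis\<close>: the mark of \<open>[U, \<phi>]\<close> at \<open>(H, \<Phi>)\<close> is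
  \<open>1 / |U|\<close> times the sum of \<open>\<Phi> ((\<^sup>a\<phi>)|\<^sub>H)\<close> over all \<open>a\<close> in the group with \<open>H \<le> \<^sup>aU\<close>. A sum over
  double coset representatives turns into a sum over the whole group by \<open>sum_dc_reps\<close>, and after that
  independence of chosen representatives, invariance under conjugation (\<open>mark_conjugate\<close>) and
  multiplicativity (\<open>mark_mult\<close>) are translations of the summation variable.

  An element with all marks zero is zero (\<open>marks_injective\<close>). If \<open>U\<close> has maximal order among the
  classes \<open>[U, \<phi>]\<close> occurring in \<open>x\<close>, then the functional \<open>\<Phi> \<mapsto> mark of x at (U, \<Phi>)\<close> recovers the
  coefficient of \<open>[U, \<phi>]\<close>, up to a nonzero factor, when \<open>\<Phi>\<close> is the delta function at \<open>\<phi>\<close>; and by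
  \<open>characters_separate\<close> vanishing on all characters forces vanishing on all functions, delta functions included. This is the
  place where the splitting hypothesis enters: a nonzero function orthogonal to all characters of a
  finite abelian group \<open>D\<close> would generate a representation of \<open>D\<close>, an irreducible constituent of which
  is scalar by Schur's lemma in the splitting form, and a scalar constituent is itself a character.

  Elements with prescribed marks exist (\<open>idem_exists\<close>) because the Fourier element
  \<open>\<Sum>\<phi>. \<Phi>(\<phi>)\<^sup>-\<^sup>1 [H, \<phi>]\<close> has, up to a scalar, the right marks at all subgroups of order at least
  \<open>|H|\<close>, and the marks at smaller subgroups are corrected by induction. Multiplicativity and
  injectivity make such an element idempotent and unique.

  With this characterisation, an isomorphism carries marks to marks (\<open>mark_iso\<close>), which gives the first
  claim, and conjugation is an instance of it. Twisting multiplies the mark at \<open>(K, \<Psi>)\<close> by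
  \<open>\<Psi>(\<alpha>|\<^sub>K)\<close> (\<open>mark_tw\<close>), a factor constant on conjugacy classes. Finally
  \<open>\<Delta>(x) \<cdot> tw\<^sub>\<alpha> = \<Delta>(tw\<^sub>\<alpha> x)\<close> for every \<open>x\<close> (\<open>bimult_Delta_tw\<close>), since composing two twisted diagonals
  gives a twisted diagonal.
\<close>

section \<open>Characters of finite abelian groups over a splitting field\<close>

lemma mat_unit_vec_col:
  assumes "(M :: 'a::comm_semiring_1 mat) \<in> carrier_mat m n" "j < n"
  shows "M *\<^sub>v unit_vec n j = col M j"
  using assms by (intro eq_vecI) (auto simp: scalar_prod_right_unit)

text \<open>A nonzero invariant subspace with a spanning set of least cardinality is irreducible. Written in
  coordinates it is an irreducible matrix representation of the abelian group \<open>D\<close>; each representing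
  matrix commutes with all the others, so the splitting hypothesis makes it scalar, and every nonzero
  vector of that subspace is a common eigenvector.\<close>

lemma (in vector_space) simultaneous_eigenvector:
  fixes D :: "'d monoid" and act :: "'d \<Rightarrow> 'b \<Rightarrow> 'b"
  assumes D: "comm_group D" and split: "splitting_field TYPE('a) D"
    and lin: "\<And>h. h \<in> carrier D \<Longrightarrow> Vector_Spaces.linear scale scale (act h)"
    and one: "\<And>v. v \<in> W \<Longrightarrow> act \<one>\<^bsub>D\<^esub> v = v"
    and mult: "\<And>g h v. \<lbrakk>g \<in> carrier D; h \<in> carrier D; v \<in> W\<rbrakk> \<Longrightarrow> act (g \<otimes>\<^bsub>D\<^esub> h) v = act g (act h v)"
    and W: "subspace W" "W \<noteq> {0}" "finite T" "W \<subseteq> span T"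
    and inv: "\<And>h v. \<lbrakk>h \<in> carrier D; v \<in> W\<rbrakk> \<Longrightarrow> act h v \<in> W"
  shows "\<exists>w\<in>W. w \<noteq> 0 \<and> (\<forall>h\<in>carrier D. \<exists>c. act h w = c *s w)"
proof -
  interpret D: comm_group D by fact
  define good where "good B \<longleftrightarrow> finite B \<and> span B \<subseteq> W \<and> span B \<noteq> {0} \<and>
     (\<forall>h\<in>carrier D. \<forall>v\<in>span B. act h v \<in> span B)" for B
  obtain B0 where B0: "B0 \<subseteq> W" "independent B0" "W \<subseteq> span B0"
    using maximal_independent_subset by blast
  have "finite B0" using independent_span_bound[of T B0] B0 W by blast
  moreover have "span B0 = W" using B0 W(1) span_minimal by blast
  ultimately have "good B0" using W inv by (auto simp: good_def)
  then obtain B where B: "good B" and min: "\<And>B'. good B' \<Longrightarrow> card B \<le> card B'"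
    using ex_has_least_nat[of good B0 card] by blast
  from B have finB: "finite B" and BW: "span B \<subseteq> W" and Bnz: "span B \<noteq> {0}"
    and Binv: "\<And>h v. \<lbrakk>h \<in> carrier D; v \<in> span B\<rbrakk> \<Longrightarrow> act h v \<in> span B"
    by (auto simp: good_def)
  have indB: "independent B"
  proof
    assume "dependent B"
    then obtain b where b: "b \<in> B" "b \<in> span (B - {b})" unfolding dependent_def by blast
    have "span (B - {b}) = span B" using b by (metis insert_Diff span_redundant)
    then have "good (B - {b})" using B by (auto simp: good_def)
    from min[OF this] b finB show False by (metis card_Diff1_less not_less)
  qed
  \<comment> \<open>Irreducibility of \<open>span B\<close>: a basis of a nonzero invariant subspace has \<open>card B\<close> elements by
    minimality, so no element of \<open>B\<close> can be independent of it.\<close>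
  have minsub: "span B \<subseteq> Y" if Y: "subspace Y" "Y \<subseteq> span B" "Y \<noteq> {0}"
      "\<And>h v. \<lbrakk>h \<in> carrier D; v \<in> Y\<rbrakk> \<Longrightarrow> act h v \<in> Y" for Y
  proof -
    obtain C where C: "C \<subseteq> Y" "independent C" "Y \<subseteq> span C"
      using maximal_independent_subset by blast
    have spC: "span C = Y" using C Y(1) span_minimal by blast
    have finC: "finite C" and "card C \<le> card B"
      using independent_span_bound[of B C] finB C Y by blast+
    moreover have "good C" using finC spC Y BW by (auto simp: good_def)
    ultimately have card: "card C = card B" using min by force
    have "C \<subseteq> span B" using C Y by blast
    have "b \<in> span C" if "b \<in> B" for b
    proof (rule ccontr)
      assume nb: "b \<notin> span C"
      then have ind: "independent (insert b C)" using C(2) independent_insert span_base by auto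
      have sub: "insert b C \<subseteq> span B" using that C Y span_base by blast
      have "card (insert b C) \<le> card B" using independent_span_bound[OF finB ind sub] by blast
      moreover have "b \<notin> C" using nb span_base by blast
      ultimately show False using card finC by simp
    qed
    then have "span B \<subseteq> span C" using span_minimal subspace_span by blast
    then show ?thesis using spC by simp
  qed
  define n where "n = card B"
  obtain \<beta> where \<beta>: "bij_betw \<beta> {0..<n} B" using finB ex_bij_betw_nat_finite n_def by blast
  have \<beta>B: "\<beta> i \<in> B" if "i < n" for i using \<beta> that by (auto simp: bij_betw_def)
  have \<beta>i: "\<beta> i = \<beta> j \<longleftrightarrow> i = j" if "i < n" "j < n" for i j
    using \<beta> that by (auto simp: bij_betw_def inj_on_def)
  have n0: "n > 0"
  proof (rule ccontr)
    assume "\<not> n > 0" then have "B = {}" using finB n_def by auto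
    then show False using Bnz by simp
  qed
  define coord where "coord v i = representation B v (\<beta> i)" for v i
  have expand: "v = (\<Sum>i<n. coord v i *s \<beta> i)" if "v \<in> span B" for v
  proof -
    have "v = (\<Sum>b\<in>B. representation B v b *s b)"
      using sum_representation_eq[OF indB that finB subset_refl] by simp
    also have "\<dots> = (\<Sum>i<n. coord v i *s \<beta> i)" unfolding coord_def
      using sum.reindex_bij_betw[OF \<beta>, of "\<lambda>b. representation B v b *s b"]
      by (simp add: lessThan_atLeast0)
    finally show ?thesis .
  qed
  have coord\<beta>: "coord (\<beta> j) i = (if i = j then 1 else 0)" if "i < n" "j < n" for i j
    using representation_basis[OF indB \<beta>B[OF that(2)]] \<beta>i that by (auto simp: coord_def)
  \<comment> \<open>The coordinate isomorphism from column vectors to \<open>span B\<close>, along which the action becomes \<open>\<rho>\<close>.\<close>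
  define emb where "emb w = (\<Sum>i<n. w $ i *s \<beta> i)" for w
  have emb_span: "emb w \<in> span B" for w unfolding emb_def
    by (intro span_sum span_scale span_base \<beta>B) auto
  have coord_emb: "coord (emb w) i = w $ i" if "i < n" for w i
  proof -
    have "coord (emb w) i = (\<Sum>j<n. w $ j * coord (\<beta> j) i)"
      unfolding emb_def coord_def
      using representation_sum[OF indB, of "{..<n}" "\<lambda>i. w $ i *s \<beta> i"]
      by (simp add: representation_scale[OF indB] span_base \<beta>B span_scale)
    also have "\<dots> = (\<Sum>j<n. if i = j then w $ j else 0)"
      by (rule sum.cong) (auto simp: coord\<beta> that)
    also have "\<dots> = w $ i" using that by (simp add: sum.delta')
    finally show ?thesis .
  qed
  have emb_add: "emb (v + w) = emb v + emb w" if "v \<in> carrier_vec n" "w \<in> carrier_vec n" for v w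
    using that by (simp add: emb_def scale_left_distrib sum.distrib)
  have emb_smult: "emb (c \<cdot>\<^sub>v v) = c *s emb v" if "v \<in> carrier_vec n" for v c
    using that by (simp add: emb_def scale_sum_right)
  define \<rho> where "\<rho> g = mat n n (\<lambda>(i, j). coord (act g (\<beta> j)) i)" for g
  have emb_act: "emb (\<rho> g *\<^sub>v w) = act g (emb w)" if g: "g \<in> carrier D" and w: "w \<in> carrier_vec n" for g w
  proof -
    interpret L: Vector_Spaces.linear scale scale "act g" by (rule lin) fact
    have "act g (emb w) = (\<Sum>j<n. w $ j *s act g (\<beta> j))"
      unfolding emb_def by (simp add: L.sum L.scale)
    also have "\<dots> = (\<Sum>j<n. w $ j *s (\<Sum>i<n. coord (act g (\<beta> j)) i *s \<beta> i))"
      by (intro sum.cong arg_cong2[of _ _ _ _ scale] refl expand Binv g span_base \<beta>B) simp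
    also have "\<dots> = (\<Sum>i<n. (\<Sum>j<n. coord (act g (\<beta> j)) i * w $ j) *s \<beta> i)"
      by (simp add: scale_sum_right scale_sum_left mult.commute) (rule sum.swap)
    also have "\<dots> = emb (\<rho> g *\<^sub>v w)" unfolding emb_def
      using w by (intro sum.cong) (auto simp: \<rho>_def scalar_prod_def lessThan_atLeast0)
    finally show ?thesis by simp
  qed
  have emb_inj: "v = w" if "emb v = emb w" "v \<in> carrier_vec n" "w \<in> carrier_vec n" for v w
    using that coord_emb by (intro eq_vecI) (auto, metis)
  have mat_ext: "M = N" if "M \<in> carrier_mat n n" "N \<in> carrier_mat n n"
      "\<And>w. w \<in> carrier_vec n \<Longrightarrow> emb (M *\<^sub>v w) = emb (N *\<^sub>v w)" for M N
  proof -
    have "M *\<^sub>v unit_vec n j = N *\<^sub>v unit_vec n j" for j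
      using that by (intro emb_inj) auto
    then have "col M j = col N j" if "j < n" for j
      using that \<open>M \<in> _\<close> \<open>N \<in> _\<close> by (metis mat_unit_vec_col)
    then show ?thesis using that(1,2) by (intro mat_col_eqI) auto
  qed
  have \<rho>c[simp]: "\<rho> g \<in> carrier_mat n n" for g by (simp add: \<rho>_def)
  have spW: "v \<in> span B \<Longrightarrow> v \<in> W" for v using BW by blast
  have \<rho>1: "\<rho> \<one>\<^bsub>D\<^esub> = 1\<^sub>m n"
    by (rule mat_ext) (auto simp: emb_act one spW emb_span)
  have \<rho>m: "\<rho> (g \<otimes>\<^bsub>D\<^esub> h) = \<rho> g * \<rho> h" if "g \<in> carrier D" "h \<in> carrier D" for g h
  proof (rule mat_ext)
    fix w :: "'a vec" assume w: "w \<in> carrier_vec n"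
    then have c: "\<rho> h *\<^sub>v w \<in> carrier_vec n" by (meson \<rho>c mult_mat_vec_carrier)
    have "(\<rho> g * \<rho> h) *\<^sub>v w = \<rho> g *\<^sub>v (\<rho> h *\<^sub>v w)"
      by (rule assoc_mult_mat_vec[OF \<rho>c \<rho>c w])
    then show "emb (\<rho> (g \<otimes>\<^bsub>D\<^esub> h) *\<^sub>v w) = emb ((\<rho> g * \<rho> h) *\<^sub>v w)"
      using that w c by (simp add: emb_act mult spW emb_span)
  qed (auto intro: mult_carrier_mat[OF \<rho>c \<rho>c])
  have irr: "irreducible_rep D n \<rho>" unfolding irreducible_rep_def matrix_rep_def
  proof (intro conjI allI impI ballI)
    fix Y assume Ys: "VectorSpace.subspace class_ring Y (module_vec TYPE('a) n)"
      and Yi: "\<forall>g\<in>carrier D. \<forall>w\<in>Y. \<rho> g *\<^sub>v w \<in> Y"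
    from Ys interpret Y: LinearCombinations.submodule class_ring Y "module_vec TYPE('a) n"
      by (simp add: VectorSpace.subspace_def)
    have Yc: "Y \<subseteq> carrier_vec n" using Y.subset by (simp add: module_vec_def)
    have Y0: "0\<^sub>v n \<in> Y" using Y.zero_closed by (simp add: module_vec_def)
    have Ya: "v + w \<in> Y" if "v \<in> Y" "w \<in> Y" for v w
      using Y.m_closed[OF that] by (simp add: module_vec_def)
    have Ysm: "c \<cdot>\<^sub>v v \<in> Y" if "v \<in> Y" for v c
      using Y.smult_closed[OF _ that, of c] by (simp add: module_vec_def)
    have emb0: "emb (0\<^sub>v n) = 0" by (simp add: emb_def)
    show "Y = {0\<^sub>v n} \<or> Y = carrier_vec n"
    proof (cases "Y = {0\<^sub>v n}")
      case False
      then obtain y where y: "y \<in> Y" "y \<noteq> 0\<^sub>v n" using Y0 by blast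
      have "emb y \<noteq> 0" using emb_inj[of y "0\<^sub>v n"] y Yc emb0 by auto
      moreover have "subspace (emb ` Y)"
      proof (rule subspaceI)
        show "0 \<in> emb ` Y" using emb0 Y0 by (metis imageI)
        fix x z assume "x \<in> emb ` Y" "z \<in> emb ` Y"
        then obtain v w where "v \<in> Y" "w \<in> Y" "x = emb v" "z = emb w" by blast
        moreover from this have "v \<in> carrier_vec n" "w \<in> carrier_vec n" using Yc by blast+
        ultimately have "x + z = emb (v + w)" "v + w \<in> Y" using Ya emb_add[of v w] by simp_all
        then show "x + z \<in> emb ` Y" by blast
      next
        fix c x assume "x \<in> emb ` Y"
        then obtain v where "v \<in> Y" "x = emb v" by blast
        moreover from this have "v \<in> carrier_vec n" using Yc by blast
        ultimately have "c *s x = emb (c \<cdot>\<^sub>v v)" "c \<cdot>\<^sub>v v \<in> Y"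
          using Ysm emb_smult[of v c] by simp_all
        then show "c *s x \<in> emb ` Y" by blast
      qed
      moreover have "act h v \<in> emb ` Y" if h: "h \<in> carrier D" and v: "v \<in> emb ` Y" for h v
      proof -
        from v obtain w where w: "w \<in> Y" "v = emb w" by blast
        then have "act h v = emb (\<rho> h *\<^sub>v w)" using emb_act[OF h, of w] Yc by auto
        then show ?thesis using Yi h w(1) by simp
      qed
      ultimately have "span B \<subseteq> emb ` Y"
        using y(1) emb_span by (intro minsub) blast+
      then have "w \<in> Y" if "w \<in> carrier_vec n" for w
      proof -
        have "emb w \<in> emb ` Y" using \<open>span B \<subseteq> emb ` Y\<close> emb_span by blast
        then obtain v where "v \<in> Y" "emb w = emb v" by blast
        then show ?thesis using emb_inj[of w v] that Yc by blast
      qed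
      then show ?thesis using Yc by blast
    qed simp
  qed (use n0 \<rho>1 \<rho>m in auto)
  have "\<exists>c. \<rho> h = c \<cdot>\<^sub>m 1\<^sub>m n" if h: "h \<in> carrier D" for h
  proof -
    have "\<forall>g\<in>carrier D. \<rho> h * \<rho> g = \<rho> g * \<rho> h"
      using h by (metis \<rho>m D.m_comm)
    then show ?thesis using split irr \<rho>c unfolding splitting_field_def by blast
  qed
  then have "\<exists>c. act h (\<beta> 0) = c *s \<beta> 0" if h: "h \<in> carrier D" for h
  proof -
    from \<open>\<And>h. h \<in> carrier D \<Longrightarrow> \<exists>c. \<rho> h = c \<cdot>\<^sub>m 1\<^sub>m n\<close>[OF h] obtain c where c: "\<rho> h = c \<cdot>\<^sub>m 1\<^sub>m n" by blast
    have u: "unit_vec n 0 \<in> carrier_vec n" for n :: nat by simp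
    have e: "emb (unit_vec n 0) = \<beta> 0"
    proof -
      have "emb (unit_vec n 0) = (\<Sum>i<n. if i = 0 then \<beta> i else 0)"
        unfolding emb_def by (rule sum.cong) auto
      then show ?thesis using n0 by (simp add: sum.delta)
    qed
    have "act h (\<beta> 0) = emb (\<rho> h *\<^sub>v unit_vec n 0)" using emb_act[OF h u[of n]] e by simp
    also have "\<rho> h *\<^sub>v unit_vec n 0 = c \<cdot>\<^sub>v unit_vec n 0"
      unfolding c by (rule eq_vecI) auto
    also have "emb (c \<cdot>\<^sub>v unit_vec n 0) = c *s \<beta> 0" using emb_smult[OF u] e by simp
    finally show ?thesis by blast
  qed
  moreover have "\<beta> 0 \<in> W" using \<beta>B[OF n0] BW span_base by blast
  moreover have "\<beta> 0 \<noteq> 0" using \<beta>B[OF n0] indB dependent_zero by metis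
  ultimately show ?thesis by blast
qed

abbreviation characters :: "'d monoid \<Rightarrow> ('d \<Rightarrow> 'k::field) set" where
  "characters D \<equiv> hom D field_units \<inter> extensional (carrier D)"

lemma character_mult:
  assumes "\<Phi> \<in> characters D" "x \<in> carrier D" "y \<in> carrier D"
  shows "\<Phi> (x \<otimes>\<^bsub>D\<^esub> y) = \<Phi> x * \<Phi> y"
  using assms by (auto simp: hom_def field_units_def)

lemma character_nonzero:
  assumes "\<Phi> \<in> characters D" "x \<in> carrier D"
  shows "\<Phi> x \<noteq> 0"
  using assms by (auto simp: hom_def field_units_def Pi_iff)

lemma sum_translate:
  assumes "group D" "h \<in> carrier D"
  shows "(\<Sum>g\<in>carrier D. f (h \<otimes>\<^bsub>D\<^esub> g)) = (\<Sum>g\<in>carrier D. f g)"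
proof -
  interpret group D by fact
  show ?thesis
    using assms(2) by (intro sum.reindex_bij_witness[of _ "\<lambda>g. inv\<^bsub>D\<^esub> h \<otimes>\<^bsub>D\<^esub> g" "\<lambda>g. h \<otimes>\<^bsub>D\<^esub> g"])
      (auto simp: m_assoc[symmetric])
qed

text \<open>The functions orthogonal to all characters form a translation invariant subspace. A common
  eigenvector \<open>w\<close> of the translations in it satisfies \<open>w(h) = c(h) w(1)\<close> for a homomorphism \<open>c\<close>, and
  pairing \<open>w\<close> with the character \<open>c\<^sup>-\<^sup>1\<close> gives \<open>|D| w(1)\<close>, which is nonzero in characteristic \<open>0\<close>.\<close>

theorem characters_separate:
  fixes D :: "'d monoid" and b :: "'d \<Rightarrow> 'k::field_char_0"
  assumes D: "comm_group D" and fin: "finite (carrier D)" and split: "splitting_field TYPE('k) D"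
    and orth: "\<And>\<Phi>. \<Phi> \<in> characters D \<Longrightarrow> (\<Sum>d\<in>carrier D. b d * \<Phi> d) = 0"
    and d: "d \<in> carrier D"
  shows "b d = 0"
proof (rule ccontr)
  assume bd: "b d \<noteq> 0"
  interpret D: comm_group D by fact
  define sc :: "'k \<Rightarrow> ('d \<Rightarrow> 'k) \<Rightarrow> ('d \<Rightarrow> 'k)" where "sc c f = (\<lambda>x. c * f x)" for c f
  interpret vs: vector_space sc
    by unfold_locales (auto simp: sc_def fun_eq_iff algebra_simps)
  define act :: "'d \<Rightarrow> ('d \<Rightarrow> 'k) \<Rightarrow> ('d \<Rightarrow> 'k)"
    where "act h f = (\<lambda>g. if g \<in> carrier D then f (h \<otimes>\<^bsub>D\<^esub> g) else 0)" for h f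
  define W :: "('d \<Rightarrow> 'k) set" where
    "W = {f. (\<forall>g. g \<notin> carrier D \<longrightarrow> f g = 0) \<and>
             (\<forall>\<Phi>\<in>characters D. (\<Sum>g\<in>carrier D. f g * \<Phi> g) = 0)}"
  define \<delta> :: "'d \<Rightarrow> 'd \<Rightarrow> 'k" where "\<delta> g = (\<lambda>x. if x = g then 1 else 0)" for g
  have Wsub: "vs.subspace W"
    by (rule vs.subspaceI)
      (auto simp: W_def sc_def distrib_right sum.distrib mult.assoc simp flip: sum_distrib_left)
  have Wspan: "W \<subseteq> vs.span (\<delta> ` carrier D)"
  proof
    fix f assume f: "f \<in> W"
    have sumapply: "(\<Sum>g\<in>B. F g) y = (\<Sum>g\<in>B. F g y)" for B :: "'d set" and F :: "'d \<Rightarrow> 'd \<Rightarrow> 'k" and y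
      by (induction B rule: infinite_finite_induct) auto
    have "f = (\<Sum>g\<in>carrier D. sc (f g) (\<delta> g))"
    proof
      fix y
      have "(\<Sum>g\<in>carrier D. sc (f g) (\<delta> g)) y = (\<Sum>g\<in>carrier D. if y = g then f g else 0)"
        unfolding sumapply by (rule sum.cong) (auto simp: sc_def \<delta>_def)
      also have "\<dots> = f y" using f fin by (simp add: W_def)
      finally show "f y = (\<Sum>g\<in>carrier D. sc (f g) (\<delta> g)) y" by simp
    qed
    also have "\<dots> \<in> vs.span (\<delta> ` carrier D)"
      by (intro vs.span_sum vs.span_scale vs.span_base) auto
    finally show "f \<in> vs.span (\<delta> ` carrier D)" .
  qed
  have Winv: "act h f \<in> W" if h: "h \<in> carrier D" and f: "f \<in> W" for h f
  proof -
    have "(\<Sum>g\<in>carrier D. act h f g * \<Phi> g) = 0" if \<Phi>: "\<Phi> \<in> characters D" for \<Phi>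
    proof -
      have "\<Phi> h * (\<Sum>g\<in>carrier D. act h f g * \<Phi> g)
          = (\<Sum>g\<in>carrier D. f (h \<otimes>\<^bsub>D\<^esub> g) * \<Phi> (h \<otimes>\<^bsub>D\<^esub> g))"
        by (auto simp: sum_distrib_left act_def character_mult[OF \<Phi> h] intro!: sum.cong)
      also have "\<dots> = (\<Sum>g\<in>carrier D. f g * \<Phi> g)"
        by (rule sum_translate[OF D.is_group h, of "\<lambda>g. f g * \<Phi> g"])
      also have "\<dots> = 0" using f \<Phi> by (simp add: W_def)
      finally show ?thesis using character_nonzero[OF \<Phi> h] by simp
    qed
    then show ?thesis by (auto simp: W_def act_def)
  qed
  define b' where "b' = (\<lambda>g. if g \<in> carrier D then b g else 0)"
  have "b' \<in> W" using orth by (simp add: W_def b'_def)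
  moreover have "b' \<noteq> 0" using bd d by (auto simp: b'_def fun_eq_iff)
  ultimately have Wnz: "W \<noteq> {0}" by blast
  have "\<exists>w\<in>W. w \<noteq> 0 \<and> (\<forall>h\<in>carrier D. \<exists>c. act h w = sc c w)"
  proof (rule vs.simultaneous_eigenvector[OF D split _ _ _ Wsub Wnz _ Wspan Winv])
    show "Vector_Spaces.linear sc sc (act h)" for h
      by unfold_locales (auto simp: act_def sc_def fun_eq_iff)
    show "act \<one>\<^bsub>D\<^esub> v = v" if "v \<in> W" for v
      using that by (auto simp: act_def W_def fun_eq_iff)
    show "act (g \<otimes>\<^bsub>D\<^esub> h) v = act g (act h v)" if "g \<in> carrier D" "h \<in> carrier D" for g h v
      using that by (auto simp: act_def fun_eq_iff D.m_ac)
  qed (use fin in auto)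
  then obtain w c where w: "w \<in> W" "w \<noteq> 0" and c: "\<And>h. h \<in> carrier D \<Longrightarrow> act h w = sc (c h) w"
    by metis
  have wh: "w (h \<otimes>\<^bsub>D\<^esub> g) = c h * w g" if "h \<in> carrier D" "g \<in> carrier D" for h g
    using fun_cong[OF c[OF that(1)], of g] that by (simp add: act_def sc_def)
  have w1: "w \<one>\<^bsub>D\<^esub> \<noteq> 0"
  proof
    assume "w \<one>\<^bsub>D\<^esub> = 0"
    then have "w g = 0" if "g \<in> carrier D" for g using wh[OF that D.one_closed] that by simp
    then have "w = 0" using w(1) by (auto simp: W_def fun_eq_iff)
    then show False using w(2) by blast
  qed
  have c0: "c h \<noteq> 0" if "h \<in> carrier D" for h
    using wh[of h "inv\<^bsub>D\<^esub> h"] that w1 by auto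
  have cm: "c (h \<otimes>\<^bsub>D\<^esub> g) = c h * c g" if "h \<in> carrier D" "g \<in> carrier D" for h g
    using wh[of "h \<otimes>\<^bsub>D\<^esub> g" "\<one>\<^bsub>D\<^esub>"] wh[of h g] wh[of g "\<one>\<^bsub>D\<^esub>"] that w1 by simp
  define \<Phi> where "\<Phi> = (\<lambda>h\<in>carrier D. inverse (c h))"
  have "\<Phi> \<in> characters D"
    using c0 by (auto simp: \<Phi>_def hom_def field_units_def cm)
  then have "(\<Sum>g\<in>carrier D. w g * \<Phi> g) = 0" using w(1) by (auto simp: W_def)
  moreover have "w g * \<Phi> g = w \<one>\<^bsub>D\<^esub>" if "g \<in> carrier D" for g
    using wh[of g "\<one>\<^bsub>D\<^esub>"] that c0[OF that] by (simp add: \<Phi>_def)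
  ultimately have "of_nat (card (carrier D)) * w \<one>\<^bsub>D\<^esub> = 0" by simp
  moreover have "card (carrier D) \<noteq> 0" using fin d by auto
  ultimately show False using w1 by simp
qed

theorem character_orthogonality:
  fixes \<Phi> \<Psi> :: "'d \<Rightarrow> 'k::field"
  assumes D: "group D" and "\<Phi> \<in> characters D" "\<Psi> \<in> characters D"
  shows "(\<Sum>d\<in>carrier D. inverse (\<Phi> d) * \<Psi> d) = (if \<Phi> = \<Psi> then of_nat (card (carrier D)) else 0)"
proof (cases "\<Phi> = \<Psi>")
  case True
  then have "(\<Sum>d\<in>carrier D. inverse (\<Phi> d) * \<Psi> d) = (\<Sum>d\<in>carrier D. 1)"
    using character_nonzero[OF assms(2)] by (intro sum.cong) auto
  then show ?thesis using True by simp
next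
  case False
  then obtain h where h: "h \<in> carrier D" "\<Phi> h \<noteq> \<Psi> h"
    using assms by (metis IntD2 extensionalityI)
  let ?s = "\<Sum>d\<in>carrier D. inverse (\<Phi> d) * \<Psi> d"
  have "?s = (\<Sum>d\<in>carrier D. inverse (\<Phi> (h \<otimes>\<^bsub>D\<^esub> d)) * \<Psi> (h \<otimes>\<^bsub>D\<^esub> d))"
    using sum_translate[OF D h(1), of "\<lambda>d. inverse (\<Phi> d) * \<Psi> d"] by simp
  also have "\<dots> = inverse (\<Phi> h) * \<Psi> h * ?s"
    by (simp add: sum_distrib_left character_mult[OF assms(2) h(1)]
        character_mult[OF assms(3) h(1)] mult_ac)
  finally have "(1 - inverse (\<Phi> h) * \<Psi> h) * ?s = 0" by (simp add: algebra_simps)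
  moreover have "inverse (\<Phi> h) * \<Psi> h \<noteq> 1"
    using h(2) character_nonzero[OF assms(2) h(1)] by (simp add: field_simps)
  ultimately show ?thesis using False by simp
qed

text \<open>The values of a character are roots of \<open>X\<^sup>n - 1\<close> with \<open>n\<close> the order of the group.\<close>

lemma finite_characters:
  assumes D: "group D" and fin: "finite (carrier D)"
  shows "finite (characters D :: ('d \<Rightarrow> 'k::field) set)"
proof -
  interpret D: group D by fact
  let ?n = "card (carrier D)"
  let ?P = "Polynomial.monom 1 ?n - 1 :: 'k poly"
  have n: "?n > 0" using fin D.one_closed by (metis card_gt_0_iff empty_iff)
  have z: "(0::'k) ^ ?n = 0" using n by (rule zero_power)
  have "poly ?P 0 \<noteq> 0" unfolding poly_diff poly_monom z by simp
  then have "?P \<noteq> 0" by (metis poly_0)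
  then have roots: "finite {z. poly ?P z = 0}" by (rule poly_roots_finite)
  have "characters D \<subseteq> carrier D \<rightarrow>\<^sub>E {z. poly ?P z = 0}"
  proof
    fix \<Phi> :: "'d \<Rightarrow> 'k" assume \<Phi>: "\<Phi> \<in> characters D"
    have one: "\<Phi> \<one>\<^bsub>D\<^esub> = 1"
      using character_mult[OF \<Phi> D.one_closed D.one_closed] character_nonzero[OF \<Phi> D.one_closed] by simp
    have "\<Phi> (d [^]\<^bsub>D\<^esub> m) = \<Phi> d ^ m" if d: "d \<in> carrier D" for d and m :: nat
      by (induction m) (simp_all add: one character_mult[OF \<Phi>] d mult.commute)
    then have "\<Phi> d ^ ?n = 1" if "d \<in> carrier D" for d
      using D.pow_order_eq_1[OF that] one that by (metis Coset.order_def)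
    then show "\<Phi> \<in> carrier D \<rightarrow>\<^sub>E {z. poly ?P z = 0}"
      using \<Phi> by (auto simp: poly_monom PiE_def)
  qed
  then show ?thesis using finite_PiE[OF fin roots] finite_subset by blast
qed

text \<open>Representations are pulled back along the inverse isomorphism, which preserves both the invariant
  subspaces and the commuting matrices.\<close>

lemma splitting_field_iso:
  assumes f: "f \<in> iso D E" and D: "group D" and E: "group E" and split: "splitting_field TYPE('k::field) E"
  shows "splitting_field TYPE('k) D"
  unfolding splitting_field_def
proof (intro allI impI ballI)
  interpret group_hom D E f using assms by (auto simp: group_hom_def group_hom_axioms_def iso_def)
  fix n and \<rho> :: "_ \<Rightarrow> 'k mat" and T
  assume irr: "irreducible_rep D n \<rho>" and T: "T \<in> carrier_mat n n"
    and comm: "\<forall>g\<in>carrier D. T * \<rho> g = \<rho> g * T"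
  define g where "g = inv_into (carrier D) f"
  have fimg: "f ` carrier D = carrier E" and finj: "inj_on f (carrier D)"
    using f by (auto simp: iso_def bij_betw_def)
  have gf[simp]: "g (f x) = x" if "x \<in> carrier D" for x using that finj by (simp add: g_def)
  have fg: "f (g y) = y" "g y \<in> carrier D" if "y \<in> carrier E" for y
    using that fimg by (auto simp: g_def f_inv_into_f inv_into_into)
  have gm: "g (x \<otimes>\<^bsub>E\<^esub> y) = g x \<otimes>\<^bsub>D\<^esub> g y" if "x \<in> carrier E" "y \<in> carrier E" for x y
    using gf[of "g x \<otimes>\<^bsub>D\<^esub> g y"] that fg by simp
  have g1: "g \<one>\<^bsub>E\<^esub> = \<one>\<^bsub>D\<^esub>" using gf[OF G.one_closed] by simp
  have "irreducible_rep E n (\<rho> \<circ> g)"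
    using irr unfolding irreducible_rep_def matrix_rep_def fimg[symmetric]
    by (auto simp: gm g1 simp flip: hom_mult hom_one)
  moreover have "\<forall>y\<in>carrier E. T * (\<rho> \<circ> g) y = (\<rho> \<circ> g) y * T"
    using comm fg by simp
  ultimately show "\<exists>c. T = c \<cdot>\<^sub>m 1\<^sub>m n"
    using split T unfolding splitting_field_def by blast
qed

section \<open>Linear maps on the fibered Burnside space\<close>

lemma lookup_scal: "Poly_Mapping.lookup (c *\<^sub>K x) k = c * Poly_Mapping.lookup x k"
  by (transfer) (auto simp: when_def)

lemma scal_distribs:
  "(c + d) *\<^sub>K x = c *\<^sub>K x + d *\<^sub>K x" "c *\<^sub>K (x + y) = c *\<^sub>K x + c *\<^sub>K y"
  "c *\<^sub>K d *\<^sub>K x = (c * d) *\<^sub>K x" "0 *\<^sub>K x = 0" "1 *\<^sub>K x = x" "c *\<^sub>K 0 = 0"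
  by (auto intro!: poly_mapping_eqI simp: lookup_scal lookup_add algebra_simps)

lemma scal_sum: "c *\<^sub>K (\<Sum>i\<in>I. f i) = (\<Sum>i\<in>I. c *\<^sub>K f i)"
  by (induction I rule: infinite_finite_induct) (auto simp: scal_distribs)

text \<open>Linear maps for the scalar action on finitely supported functions; additivity and homogeneity are
  all that the expansion over the class basis uses.\<close>

definition linmap :: "(('c \<Rightarrow>\<^sub>0 'k::field) \<Rightarrow> ('d \<Rightarrow>\<^sub>0 'k)) \<Rightarrow> bool" where
  "linmap T \<longleftrightarrow> (\<forall>x y. T (x + y) = T x + T y) \<and> (\<forall>c x. T (c *\<^sub>K x) = c *\<^sub>K T x)"

definition linform :: "(('c \<Rightarrow>\<^sub>0 'k::field) \<Rightarrow> 'k) \<Rightarrow> bool" where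
  "linform T \<longleftrightarrow> (\<forall>x y. T (x + y) = T x + T y) \<and> (\<forall>c x. T (c *\<^sub>K x) = c * T x)"

lemma linmapI:
  "(\<And>x y. T (x + y) = T x + T y) \<Longrightarrow> (\<And>c x. T (c *\<^sub>K x) = c *\<^sub>K T x) \<Longrightarrow> linmap T"
  by (simp add: linmap_def)

lemma linformI:
  "(\<And>x y. T (x + y) = T x + T y) \<Longrightarrow> (\<And>c x. T (c *\<^sub>K x) = c * T x) \<Longrightarrow> linform T"
  by (simp add: linform_def)

lemma linmap_add: "linmap T \<Longrightarrow> T (x + y) = T x + T y"
  and linmap_scal: "linmap T \<Longrightarrow> T (c *\<^sub>K x) = c *\<^sub>K T x"
  by (simp_all add: linmap_def)

lemma linform_add: "linform T \<Longrightarrow> T (x + y) = T x + T y"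
  and linform_scal: "linform T \<Longrightarrow> T (c *\<^sub>K x) = c * T x"
  by (simp_all add: linform_def)

lemma linmap_sum: "linmap T \<Longrightarrow> T (\<Sum>i\<in>I. f i) = (\<Sum>i\<in>I. T (f i))"
  using linmap_scal[of T 0]
  by (induction I rule: infinite_finite_induct) (auto simp: linmap_add scal_distribs)

lemma linform_sum: "linform T \<Longrightarrow> T (\<Sum>i\<in>I. f i) = (\<Sum>i\<in>I. T (f i))"
  using linform_scal[of T 0]
  by (induction I rule: infinite_finite_induct) (auto simp: linform_add scal_distribs)

lemma linform_diff: "linform T \<Longrightarrow> T (x - y) = T x - T y"
  using linform_add[of T "x - y" y] by simp

text \<open>Summing over a common finite superset of the supports is what makes additivity visible.\<close>

lemma lin_ext_superset:
  assumes "finite C" "Poly_Mapping.keys x \<subseteq> C"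
  shows "lin_ext F x = (\<Sum>c\<in>C. Poly_Mapping.lookup x c *\<^sub>K (case (SOME p. p \<in> c) of (U, \<phi>) \<Rightarrow> F U \<phi>))"
  unfolding lin_ext_def using assms
  by (intro sum.mono_neutral_left) (auto simp: in_keys_iff scal_distribs)

lemma linear_lin_ext:
  fixes F :: "'g set \<Rightarrow> ('g \<Rightarrow> 'a) \<Rightarrow> ('c \<Rightarrow>\<^sub>0 'k::field)"
  shows "linmap (lin_ext F)"
proof (rule linmapI)
  fix x y :: "('g, 'a, 'k) fburn"
  let ?C = "Poly_Mapping.keys x \<union> Poly_Mapping.keys y"
  show "lin_ext F (x + y) = lin_ext F x + lin_ext F y"
    using Poly_Mapping.keys_add[of x y]
    by (simp add: lin_ext_superset[of ?C] lookup_add scal_distribs sum.distrib)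
next
  fix c :: 'k and x :: "('g, 'a, 'k) fburn"
  have "Poly_Mapping.keys (c *\<^sub>K x) \<subseteq> Poly_Mapping.keys x" by (auto simp: in_keys_iff lookup_scal)
  then show "lin_ext F (c *\<^sub>K x) = c *\<^sub>K lin_ext F x"
    by (simp add: lin_ext_superset[of "Poly_Mapping.keys x"] lookup_scal scal_distribs scal_sum)
qed

lemma linear_lin_ext_parameter:
  assumes "\<And>U \<phi>. linmap (\<lambda>y. F y U \<phi>)"
  shows "linmap (\<lambda>y. lin_ext (F y) x)"
  unfolding lin_ext_def
  by (rule linmapI)
    (simp_all add: case_prod_beta linmap_add[OF assms] linmap_scal[OF assms] scal_distribs
      sum.distrib scal_sum mult.commute)

lemma lin_ext_single:
  "lin_ext F (Poly_Mapping.single c 1) = (case (SOME p. p \<in> c) of (U, \<phi>) \<Rightarrow> F U \<phi>)"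
  by (simp add: lin_ext_def scal_distribs)

lemma linear_char_ext:
  fixes \<Phi> :: "('g \<Rightarrow> 'a) \<Rightarrow> 'k::field"
  shows "linform (char_ext \<Phi>)"
proof -
  have sup: "char_ext \<Phi> x = (\<Sum>\<phi>\<in>C. Poly_Mapping.lookup x \<phi> * \<Phi> \<phi>)"
    if "finite C" "Poly_Mapping.keys x \<subseteq> C" for C and x :: "('g \<Rightarrow> 'a) \<Rightarrow>\<^sub>0 'k"
    unfolding char_ext_def using that by (intro sum.mono_neutral_left) (auto simp: in_keys_iff)
  show ?thesis
  proof (rule linformI)
    fix x y :: "('g \<Rightarrow> 'a) \<Rightarrow>\<^sub>0 'k"
    show "char_ext \<Phi> (x + y) = char_ext \<Phi> x + char_ext \<Phi> y"
      using Poly_Mapping.keys_add[of x y]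
      by (simp add: sup[of "Poly_Mapping.keys x \<union> Poly_Mapping.keys y"] lookup_add algebra_simps sum.distrib)
  next
    fix c and x :: "('g \<Rightarrow> 'a) \<Rightarrow>\<^sub>0 'k"
    have "Poly_Mapping.keys (c *\<^sub>K x) \<subseteq> Poly_Mapping.keys x" by (auto simp: in_keys_iff lookup_scal)
    then show "char_ext \<Phi> (c *\<^sub>K x) = c * char_ext \<Phi> x"
      by (simp add: sup[of "Poly_Mapping.keys x"] lookup_scal sum_distrib_left mult_ac)
  qed
qed

lemma linear_mark: "linform (fburn_mark S H \<Phi>)"
  unfolding fburn_mark_def fburn_pi_def fburn_res_def
  by (rule linformI) (simp_all add: linform_add[OF linear_char_ext] linform_scal[OF linear_char_ext]
      linmap_add[OF linear_lin_ext] linmap_scal[OF linear_lin_ext])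

lemmas mark_linear =
  linform_add[OF linear_mark] linform_scal[OF linear_mark]

section \<open>Conjugation and sums over double cosets\<close>

locale finite_group = group G for G :: "'g monoid" (structure) +
  assumes fin: "finite (carrier G)"
begin

lemma inv_cancel_left [simp]:
  "\<lbrakk>x \<in> carrier G; y \<in> carrier G\<rbrakk> \<Longrightarrow> x \<otimes> (inv x \<otimes> y) = y"
  "\<lbrakk>x \<in> carrier G; y \<in> carrier G\<rbrakk> \<Longrightarrow> inv x \<otimes> (x \<otimes> y) = y"
  by (simp_all flip: m_assoc)

lemma conj_map_closed [simp]: "g \<in> carrier G \<Longrightarrow> x \<in> carrier G \<Longrightarrow> conj_map G g x \<in> carrier G"
  by (simp add: conj_map_def)

lemma conj_map_conj_map:
  "\<lbrakk>g \<in> carrier G; h \<in> carrier G; x \<in> carrier G\<rbrakk> \<Longrightarrow> conj_map G g (conj_map G h x) = conj_map G (g \<otimes> h) x"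
  by (simp add: conj_map_def inv_mult_group m_assoc)

lemma conj_map_one [simp]: "x \<in> carrier G \<Longrightarrow> conj_map G \<one> x = x"
  by (simp add: conj_map_def)

lemma conj_map_mult:
  "\<lbrakk>g \<in> carrier G; x \<in> carrier G; y \<in> carrier G\<rbrakk>
    \<Longrightarrow> conj_map G g (x \<otimes> y) = conj_map G g x \<otimes> conj_map G g y"
  by (simp add: conj_map_def m_assoc)

lemma conj_map_inv_cancel [simp]:
  "\<lbrakk>g \<in> carrier G; x \<in> carrier G\<rbrakk> \<Longrightarrow> conj_map G (inv g) (conj_map G g x) = x"
  "\<lbrakk>g \<in> carrier G; x \<in> carrier G\<rbrakk> \<Longrightarrow> conj_map G g (conj_map G (inv g) x) = x"
  by (simp_all add: conj_map_conj_map)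

lemma inj_on_conj_map: "g \<in> carrier G \<Longrightarrow> inj_on (conj_map G g) (carrier G)"
  by (metis conj_map_inv_cancel(1) inj_onI)

lemma conj_set_conj_set:
  "\<lbrakk>g \<in> carrier G; h \<in> carrier G; U \<subseteq> carrier G\<rbrakk>
    \<Longrightarrow> conj_set G g (conj_set G h U) = conj_set G (g \<otimes> h) U"
  by (auto simp: conj_set_def image_image conj_map_conj_map subset_iff intro!: image_cong)

lemma conj_set_one [simp]: "U \<subseteq> carrier G \<Longrightarrow> conj_set G \<one> U = U"
  by (force simp: conj_set_def subset_iff)

lemma conj_set_closed: "\<lbrakk>g \<in> carrier G; U \<subseteq> carrier G\<rbrakk> \<Longrightarrow> conj_set G g U \<subseteq> carrier G"
  by (auto simp: conj_set_def)

lemma conj_set_subgroup: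
  assumes "subgroup U G" "g \<in> carrier G"
  shows "subgroup (conj_set G g U) G"
proof -
  interpret group_hom G G "conj_map G g"
    using assms(2) by unfold_locales (auto simp: hom_def conj_map_mult)
  show ?thesis unfolding conj_set_def by (rule subgroup_img_is_subgroup) fact
qed

lemma card_conj_set:
  assumes "g \<in> carrier G" "U \<subseteq> carrier G"
  shows "card (conj_set G g U) = card U"
  unfolding conj_set_def using assms inj_on_conj_map by (metis card_image inj_on_subset)

lemma conj_set_self:
  assumes "subgroup U G" "u \<in> U"
  shows "conj_set G u U = U"
proof -
  interpret U: subgroup U G by fact
  have sub: "conj_set G v U \<subseteq> U" if "v \<in> U" for v
    using that by (auto simp: conj_set_def conj_map_def)
  have "x \<in> conj_set G u U" if x: "x \<in> U" for x
  proof -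
    have "conj_map G (inv u) x \<in> U" using x assms(2) by (auto simp: conj_map_def)
    then have "conj_map G u (conj_map G (inv u) x) \<in> conj_set G u U" unfolding conj_set_def by blast
    then show ?thesis using x assms(2) by simp
  qed
  then show ?thesis using sub[OF assms(2)] by blast
qed

lemma mem_conj_set:
  assumes "g \<in> carrier G" "U \<subseteq> carrier G" "x \<in> carrier G"
  shows "x \<in> conj_set G g U \<longleftrightarrow> conj_map G (inv g) x \<in> U"
proof
  assume "x \<in> conj_set G g U"
  then show "conj_map G (inv g) x \<in> U" using assms by (auto simp: conj_set_def subset_iff)
next
  assume "conj_map G (inv g) x \<in> U"
  then have "conj_map G g (conj_map G (inv g) x) \<in> conj_set G g U" unfolding conj_set_def by blast
  then show "x \<in> conj_set G g U" using assms by simp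
qed

lemma conj_set_Int:
  assumes "g \<in> carrier G" "U \<subseteq> carrier G" "V \<subseteq> carrier G"
  shows "conj_set G g (U \<inter> V) = conj_set G g U \<inter> conj_set G g V"
  unfolding conj_set_def using assms by (intro inj_on_image_Int[OF inj_on_conj_map]) auto

lemma conj_fun_apply:
  assumes "g \<in> carrier G" "U \<subseteq> carrier G" "x \<in> carrier G" "x \<in> conj_set G g U"
  shows "conj_fun G g U \<phi> x = \<phi> (conj_map G (inv g) x)"
  using assms by (simp add: conj_fun_def conj_map_def)

lemma conj_fun_conj_map [simp]:
  assumes "g \<in> carrier G" "U \<subseteq> carrier G" "x \<in> U"
  shows "conj_fun G g U \<phi> (conj_map G g x) = \<phi> x"
  using assms by (subst conj_fun_apply) (auto simp: conj_set_def subset_iff)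

lemma conj_fun_extensional [simp]: "conj_fun G g U \<phi> \<in> extensional (conj_set G g U)"
  by (simp add: conj_fun_def)

lemma conj_fun_eqI:
  assumes "g \<in> carrier G" "U \<subseteq> carrier G" "\<psi> \<in> extensional (conj_set G g U)"
    and "\<And>x. x \<in> U \<Longrightarrow> \<psi> (conj_map G g x) = \<phi> x"
  shows "conj_fun G g U \<phi> = \<psi>"
proof (rule extensionalityI[OF conj_fun_extensional assms(3)])
  fix y assume "y \<in> conj_set G g U"
  then obtain x where "x \<in> U" "y = conj_map G g x" by (auto simp: conj_set_def)
  then show "conj_fun G g U \<phi> y = \<psi> y" using assms by simp
qed

lemma conj_fun_conj_fun:
  assumes "g \<in> carrier G" "h \<in> carrier G" "U \<subseteq> carrier G"
  shows "conj_fun G g (conj_set G h U) (conj_fun G h U \<phi>) = conj_fun G (g \<otimes> h) U \<phi>"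
proof (rule conj_fun_eqI)
  show "conj_set G h U \<subseteq> carrier G" by (rule conj_set_closed) fact+
  show "conj_fun G (g \<otimes> h) U \<phi> \<in> extensional (conj_set G g (conj_set G h U))"
    by (simp add: conj_set_conj_set assms)
  fix x assume "x \<in> conj_set G h U"
  then obtain y where y: "y \<in> U" "x = conj_map G h y" by (auto simp: conj_set_def)
  then have "conj_map G g x = conj_map G (g \<otimes> h) y" using assms by (simp add: conj_map_conj_map subset_iff)
  then show "conj_fun G (g \<otimes> h) U \<phi> (conj_map G g x) = conj_fun G h U \<phi> x"
    using y assms by simp
qed fact

lemma conj_fun_one: "\<phi> \<in> extensional U \<Longrightarrow> U \<subseteq> carrier G \<Longrightarrow> conj_fun G \<one> U \<phi> = \<phi>"
  by (rule conj_fun_eqI) (auto simp: subset_iff)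

lemma conj_fun_dual:
  assumes "subgroup U G" "g \<in> carrier G" "\<phi> \<in> carrier (dual (G \<restriction> U) A)"
  shows "conj_fun G g U \<phi> \<in> carrier (dual (G \<restriction> conj_set G g U) A)"
proof -
  have U: "U \<subseteq> carrier G" using assms(1) by (rule subgroup.subset)
  have "conj_fun G g U \<phi> (x \<otimes> y) = conj_fun G g U \<phi> x \<otimes>\<^bsub>A\<^esub> conj_fun G g U \<phi> y
      \<and> conj_fun G g U \<phi> x \<in> carrier A"
    if "x \<in> conj_set G g U" "y \<in> conj_set G g U" for x y
  proof -
    from that obtain a b where ab: "a \<in> U" "b \<in> U" "x = conj_map G g a" "y = conj_map G g b"
      unfolding conj_set_def by blast
    moreover from this have "x \<otimes> y = conj_map G g (a \<otimes> b)"
      using U assms(2) by (simp add: conj_map_mult subset_iff)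
    moreover have "a \<otimes> b \<in> U" using ab assms(1) by (simp add: subgroup.m_closed)
    ultimately show ?thesis using assms U by (auto simp: dual_def hom_def)
  qed
  then show ?thesis by (auto simp: dual_def hom_def)
qed

text \<open>Since \<open>A\<close> is abelian, a homomorphism into \<open>A\<close> is constant on conjugacy classes.\<close>

lemma conj_fun_self:
  assumes "subgroup U G" "u \<in> U" "\<phi> \<in> carrier (dual (G \<restriction> U) A)" and A: "comm_group A"
  shows "conj_fun G u U \<phi> = \<phi>"
proof -
  interpret A: comm_group A by fact
  interpret U: subgroup U G by fact
  have hom: "\<phi> \<in> hom (G \<restriction> U) A" using assms by (simp add: dual_def)
  interpret group_hom "G \<restriction> U" A \<phi>
    using hom U.subgroup_is_group[OF is_group] by (simp add: group_hom_def group_hom_axioms_def)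
  have "\<phi> (conj_map G u x) = \<phi> x" if x: "x \<in> U" for x
  proof -
    have m: "\<phi> (a \<otimes> b) = \<phi> a \<otimes>\<^bsub>A\<^esub> \<phi> b" if "a \<in> U" "b \<in> U" for a b
      using hom that by (simp add: hom_def)
    have c: "\<phi> a \<in> carrier A" if "a \<in> U" for a using hom that by (auto simp: hom_def)
    have "\<phi> (conj_map G u x) = \<phi> u \<otimes>\<^bsub>A\<^esub> \<phi> x \<otimes>\<^bsub>A\<^esub> \<phi> (inv u)"
      using x assms(2) by (simp add: conj_map_def m)
    also have "\<dots> = \<phi> x \<otimes>\<^bsub>A\<^esub> (\<phi> u \<otimes>\<^bsub>A\<^esub> \<phi> (inv u))"
      using x assms(2) c by (simp add: A.m_ac)
    also have "\<phi> u \<otimes>\<^bsub>A\<^esub> \<phi> (inv u) = \<phi> \<one>" using m[of u "inv u"] assms(2) by simp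
    also have "\<phi> \<one> = \<one>\<^bsub>A\<^esub>" using hom_one by simp
    finally show ?thesis using c[OF x] by simp
  qed
  moreover have "\<phi> \<in> extensional (conj_set G u U)" using assms conj_set_self by (simp add: dual_def)
  ultimately show ?thesis using assms(2) U.subset by (intro conj_fun_eqI) auto
qed

lemma double_coset_mem:
  "x \<in> (U #> g) <#> V \<longleftrightarrow> (\<exists>u\<in>U. \<exists>v\<in>V. x = u \<otimes> g \<otimes> v)"
  by (auto simp: set_mult_def r_coset_def)

text \<open>The fibre of \<open>(u, v) \<mapsto> u r v\<close> over \<open>g = u\<^sub>0 r v\<^sub>0\<close> is a torsor under \<open>U \<inter> \<^sup>gV\<close>: an element \<open>w\<close> of
  this group sends the base point to \<open>(w u\<^sub>0, v)\<close>, with \<open>v\<close> determined by \<open>w u\<^sub>0 r v = g\<close>.\<close>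

lemma card_double_coset_fibre:
  assumes U: "subgroup U G" and V: "subgroup V G" and r: "r \<in> carrier G" and u0: "u0 \<in> U" and v0: "v0 \<in> V"
  shows "card {(u, v). u \<in> U \<and> v \<in> V \<and> u \<otimes> r \<otimes> v = u0 \<otimes> r \<otimes> v0}
       = card (U \<inter> conj_set G (u0 \<otimes> r \<otimes> v0) V)" (is "card ?L = card (U \<inter> conj_set G ?g V)")
proof -
  interpret U: subgroup U G by fact
  interpret V: subgroup V G by fact
  note [simp] = U.mem_carrier V.mem_carrier
  have g: "?g \<in> carrier G" using assms by simp
  \<comment> \<open>The second component solves \<open>w u\<^sub>0 r v = g\<close> for \<open>v\<close>.\<close>
  let ?f = "\<lambda>w. (w \<otimes> u0, inv r \<otimes> inv u0 \<otimes> inv w \<otimes> ?g)"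
  have "bij_betw ?f (U \<inter> conj_set G ?g V) ?L"
  proof (rule bij_betw_byWitness[where f' = "\<lambda>(u, v). u \<otimes> inv u0"])
    show "\<forall>w\<in>U \<inter> conj_set G ?g V. (\<lambda>(u, v). u \<otimes> inv u0) (?f w) = w"
      using u0 by (simp add: m_assoc)
    show "\<forall>p\<in>?L. ?f ((\<lambda>(u, v). u \<otimes> inv u0) p) = p"
    proof
      fix p assume "p \<in> ?L"
      then obtain u v where p: "p = (u, v)" and uv: "u \<in> U" "v \<in> V" "u \<otimes> r \<otimes> v = ?g" by blast
      have "inv r \<otimes> inv u0 \<otimes> inv (u \<otimes> inv u0) \<otimes> (u \<otimes> r \<otimes> v) = v"
        using uv(1,2) u0 r by (simp add: inv_mult_group m_assoc)
      then have "inv r \<otimes> inv u0 \<otimes> inv (u \<otimes> inv u0) \<otimes> ?g = v" using uv(3) by simp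
      moreover have "u \<otimes> inv u0 \<otimes> u0 = u" using uv u0 by (simp add: m_assoc)
      ultimately show "?f ((\<lambda>(u, v). u \<otimes> inv u0) p) = p" unfolding p by simp
    qed
    show "?f ` (U \<inter> conj_set G ?g V) \<subseteq> ?L"
    proof clarify
      fix w assume w: "w \<in> U" "w \<in> conj_set G ?g V"
      then have "conj_map G (inv ?g) w \<in> V" using g V.subset by (simp add: mem_conj_set)
      then have "inv (conj_map G (inv ?g) w) \<in> V" by blast
      moreover have "inv (conj_map G (inv ?g) w) = inv ?g \<otimes> inv w \<otimes> ?g"
        using w g by (simp add: conj_map_def inv_mult_group m_assoc)
      ultimately have "v0 \<otimes> (inv ?g \<otimes> inv w \<otimes> ?g) \<in> V" using v0 by auto
      also have "v0 \<otimes> (inv ?g \<otimes> inv w \<otimes> ?g) = inv r \<otimes> inv u0 \<otimes> inv w \<otimes> ?g"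
        using w v0 u0 r by (simp add: inv_mult_group m_assoc)
      finally have "inv r \<otimes> inv u0 \<otimes> inv w \<otimes> ?g \<in> V" .
      moreover have "w \<otimes> u0 \<otimes> r \<otimes> (inv r \<otimes> inv u0 \<otimes> inv w \<otimes> ?g) = ?g"
        using w v0 u0 r by (simp add: inv_mult_group m_assoc)
      ultimately show "w \<otimes> u0 \<in> U \<and> inv r \<otimes> inv u0 \<otimes> inv w \<otimes> ?g \<in> V
          \<and> w \<otimes> u0 \<otimes> r \<otimes> (inv r \<otimes> inv u0 \<otimes> inv w \<otimes> ?g) = ?g"
        using w u0 by simp
    qed
    show "(\<lambda>(u, v). u \<otimes> inv u0) ` ?L \<subseteq> U \<inter> conj_set G ?g V"
    proof clarify
      fix u v assume uv: "u \<in> U" "v \<in> V" "u \<otimes> r \<otimes> v = ?g"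
      have "conj_map G (inv ?g) (u \<otimes> inv u0) = inv v0 \<otimes> inv r \<otimes> inv u0 \<otimes> u \<otimes> inv u0 \<otimes> ?g"
        using uv u0 v0 r by (simp add: conj_map_def inv_mult_group m_assoc)
      also have "\<dots> = inv v0 \<otimes> (inv r \<otimes> inv u0 \<otimes> u \<otimes> r \<otimes> v0)"
        using uv u0 v0 r by (simp add: inv_mult_group m_assoc)
      also have "inv r \<otimes> inv u0 \<otimes> u \<otimes> r \<otimes> v0 = inv r \<otimes> inv u0 \<otimes> (u \<otimes> r \<otimes> v) \<otimes> inv v \<otimes> v0"
        using uv(1,2) u0 v0 r by (simp add: m_assoc)
      also have "\<dots> = v0 \<otimes> inv v \<otimes> v0"
        unfolding uv(3) using uv(1,2) u0 v0 r by (simp add: m_assoc)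
      also have "inv v0 \<otimes> (v0 \<otimes> inv v \<otimes> v0) = inv v \<otimes> v0"
        using uv(2) v0 by (simp add: m_assoc)
      also have "\<dots> \<in> V" using uv v0 by simp
      finally have "conj_map G (inv ?g) (u \<otimes> inv u0) \<in> V" .
      then show "u \<otimes> inv u0 \<in> U \<inter> conj_set G ?g V" using uv u0 g V.subset by (simp add: mem_conj_set)
    qed
  qed
  from bij_betw_same_card[OF this] show ?thesis by (rule sym)
qed

lemma double_coset_disjoint:
  assumes "subgroup U G" "subgroup V G" "g \<in> carrier G" "x \<in> (U #> g) <#> V"
  shows "(U #> x) <#> V = (U #> g) <#> V"
proof -
  interpret U: subgroup U G by fact
  interpret V: subgroup V G by fact
  note [simp] = U.mem_carrier V.mem_carrier
  obtain u v where uv: "u \<in> U" "v \<in> V" and x: "x = u \<otimes> g \<otimes> v" using assms(4) by (auto simp: double_coset_mem)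
  have "y \<in> (U #> g) <#> V" if y: "y \<in> (U #> x) <#> V" for y
  proof -
    obtain a b where ab: "a \<in> U" "b \<in> V" and "y = a \<otimes> x \<otimes> b" using y by (auto simp: double_coset_mem)
    then have "y = (a \<otimes> u) \<otimes> g \<otimes> (v \<otimes> b)" using x uv assms(3) by (simp add: m_assoc)
    then show ?thesis using ab uv unfolding double_coset_mem by blast
  qed
  moreover have "y \<in> (U #> x) <#> V" if y: "y \<in> (U #> g) <#> V" for y
  proof -
    obtain a b where ab: "a \<in> U" "b \<in> V" and "y = a \<otimes> g \<otimes> b" using y by (auto simp: double_coset_mem)
    then have "y = (a \<otimes> inv u) \<otimes> x \<otimes> (inv v \<otimes> b)" using x uv assms(3)
      by (simp add: m_assoc)
    then show ?thesis using ab uv unfolding double_coset_mem by blast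
  qed
  ultimately show ?thesis by blast
qed

lemma dc_reps_carrier:
  assumes "subgroup U G" "subgroup V G" "r \<in> dc_reps G U V"
  shows "r \<in> carrier G"
proof -
  interpret U: subgroup U G by fact
  interpret V: subgroup V G by fact
  obtain g where g: "g \<in> carrier G" "r = (SOME x. x \<in> (U #> g) <#> V)"
    using assms(3) by (auto simp: dc_reps_def double_cosets_def)
  have "\<one> \<otimes> g \<otimes> \<one> \<in> (U #> g) <#> V" unfolding double_coset_mem using U.one_closed V.one_closed by blast
  then have "r \<in> (U #> g) <#> V" using g(2) by (metis someI)
  then show ?thesis using g(1) by (auto simp: double_coset_mem U.mem_carrier V.mem_carrier)
qed

text \<open>Orbit counting: \<open>U \<times> V\<close> maps onto the double coset of \<open>g\<close> with fibres of cardinality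
  \<open>|U \<inter> \<^sup>gV|\<close>, so weighting the elements of \<open>G\<close> by \<open>|U \<inter> \<^sup>gV| / (|U| |V|)\<close> gives each double coset
  total weight \<open>1\<close>. Choices of representatives disappear from all later computations.\<close>

theorem sum_dc_reps:
  fixes f :: "'g \<Rightarrow> 'k::field_char_0"
  assumes U: "subgroup U G" and V: "subgroup V G"
    and f: "\<And>u g v. \<lbrakk>u \<in> U; g \<in> carrier G; v \<in> V\<rbrakk> \<Longrightarrow> f (u \<otimes> g \<otimes> v) = f g"
  shows "(\<Sum>g\<in>dc_reps G U V. f g)
    = (\<Sum>g\<in>carrier G. f g * of_nat (card (U \<inter> conj_set G g V))) / (of_nat (card U) * of_nat (card V))"
proof -
  interpret U: subgroup U G by fact
  interpret V: subgroup V G by fact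
  note [simp] = U.mem_carrier V.mem_carrier
  have finU: "finite U" and finV: "finite V" using fin U.subset V.subset finite_subset by blast+
  have cU: "card U \<noteq> 0" and cV: "card V \<noteq> 0"
    using finU finV U.one_closed V.one_closed by (metis card_0_eq empty_iff)+
  let ?D = "double_cosets G U V"
  let ?r = "\<lambda>D. SOME g. g \<in> D"
  let ?c = "\<lambda>g. of_nat (card (U \<inter> conj_set G g V)) :: 'k"
  have rD: "?r D \<in> D" "D \<subseteq> carrier G" "D = (U #> ?r D) <#> V" if "D \<in> ?D" for D
  proof -
    from that obtain g where g: "g \<in> carrier G" "D = (U #> g) <#> V" by (auto simp: double_cosets_def)
    have "\<one> \<otimes> g \<otimes> \<one> \<in> D" unfolding g(2) double_coset_mem using U.one_closed V.one_closed by blast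
    then show 1: "?r D \<in> D" by (rule someI)
    show "D \<subseteq> carrier G" using g by (auto simp: double_coset_mem)
    show "D = (U #> ?r D) <#> V" using double_coset_disjoint[OF U V g(1)] 1 g(2) by simp
  qed
  have disj: "D = E" if "D \<in> ?D" "E \<in> ?D" "x \<in> D" "x \<in> E" for D E x
    using that double_coset_disjoint[OF U V] unfolding double_cosets_def by blast
  have finD: "finite ?D"
    using fin by (simp add: double_cosets_def)
  have un: "\<Union>?D = carrier G"
  proof
    show "\<Union>?D \<subseteq> carrier G" using rD(2) by blast
    show "carrier G \<subseteq> \<Union>?D"
    proof
      fix g assume g: "g \<in> carrier G"
      then have "\<one> \<otimes> g \<otimes> \<one> \<in> (U #> g) <#> V" unfolding double_coset_mem using U.one_closed V.one_closed by blast
      then show "g \<in> \<Union>?D" using g by (auto simp: double_cosets_def)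
    qed
  qed
  have D: "(\<Sum>g\<in>D. f g * ?c g) = f (?r D) * (of_nat (card U) * of_nat (card V))" if "D \<in> ?D" for D
  proof -
    define r where "r = ?r D"
    have r: "r \<in> carrier G" and Dr: "D = (U #> r) <#> V" using rD[OF that] by (auto simp: r_def)
    have finDD: "finite D" using rD(2)[OF that] fin finite_subset by blast
    let ?m = "\<lambda>(u, v). u \<otimes> r \<otimes> v"
    have im: "?m ` (U \<times> V) = D" unfolding Dr by (auto simp: double_coset_mem) blast
    have "card (U \<times> V) = (\<Sum>g\<in>D. card {p \<in> U \<times> V. ?m p = g})"
      using sum.image_gen[of "U \<times> V" "\<lambda>_. 1::nat" ?m] finU finV im by simp
    also have "\<dots> = (\<Sum>g\<in>D. card (U \<inter> conj_set G g V))"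
    proof (rule sum.cong[OF refl])
      fix g assume "g \<in> D"
      then obtain u0 v0 where uv: "u0 \<in> U" "v0 \<in> V" "g = u0 \<otimes> r \<otimes> v0" unfolding Dr double_coset_mem by blast
      have "{p \<in> U \<times> V. ?m p = g} = {(u, v). u \<in> U \<and> v \<in> V \<and> u \<otimes> r \<otimes> v = u0 \<otimes> r \<otimes> v0}"
        using uv by auto
      then show "card {p \<in> U \<times> V. ?m p = g} = card (U \<inter> conj_set G g V)"
        using card_double_coset_fibre[OF U V r uv(1,2)] uv(3) by simp
    qed
    finally have cnt: "(\<Sum>g\<in>D. ?c g) = of_nat (card U) * of_nat (card V)"
      by (simp add: card_cartesian_product flip: of_nat_sum of_nat_mult)
    have "f g = f r" if "g \<in> D" for g
      using that f[OF _ r] unfolding Dr double_coset_mem by blast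
    then have "(\<Sum>g\<in>D. f g * ?c g) = f r * (\<Sum>g\<in>D. ?c g)" by (simp add: sum_distrib_left)
    then show ?thesis using cnt r_def by simp
  qed
  have "(\<Sum>g\<in>carrier G. f g * ?c g) = (\<Sum>D\<in>?D. \<Sum>g\<in>D. f g * ?c g)"
    unfolding un[symmetric]
  proof (subst sum.Union_disjoint)
    show "\<forall>D\<in>?D. finite D" using rD(2) fin finite_subset by blast
    show "\<forall>D\<in>?D. \<forall>E\<in>?D. D \<noteq> E \<longrightarrow> D \<inter> E = {}" using disj by blast
  qed simp
  also have "\<dots> = (\<Sum>D\<in>?D. f (?r D)) * (of_nat (card U) * of_nat (card V))"
    by (simp add: D sum_distrib_right)
  also have "(\<Sum>D\<in>?D. f (?r D)) = (\<Sum>g\<in>dc_reps G U V. f g)"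
    unfolding dc_reps_def
  proof (subst sum.reindex)
    show "inj_on ?r ?D" using rD(1) disj by (intro inj_onI) metis
  qed (simp add: comp_def)
  finally show ?thesis using cU cV by simp
qed

end

section \<open>Marks of basis elements\<close>

text \<open>Up to the factor \<open>1 / |U|\<close>, the contribution of a single group element \<open>a\<close> to the mark of
  \<open>[U, \<phi>]\<close> at \<open>(H, \<Phi>)\<close>.\<close>

definition point_mark ::
  "'g monoid \<Rightarrow> 'g set \<Rightarrow> (('g \<Rightarrow> 'a) \<Rightarrow> 'k) \<Rightarrow> 'g set \<Rightarrow> ('g \<Rightarrow> 'a) \<Rightarrow> 'g \<Rightarrow> 'k::field" where
  "point_mark G H \<Phi> U \<phi> a =
     (if H \<subseteq> conj_set G a U then \<Phi> (restrict (conj_fun G a U \<phi>) H) else 0)"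

definition pairs :: "'g monoid \<Rightarrow> 'a monoid \<Rightarrow> ('g set \<times> ('g \<Rightarrow> 'a)) set" where
  "pairs G A = {(U, \<phi>). subgroup U G \<and> \<phi> \<in> carrier (dual (G \<restriction> U) A)}"

lemma pairsD:
  assumes "(U, \<phi>) \<in> pairs G A"
  shows "subgroup U G" "\<phi> \<in> carrier (dual (G \<restriction> U) A)" "U \<subseteq> carrier G" "\<phi> \<in> extensional U"
  using assms subgroup.subset by (auto simp: pairs_def dual_def)

lemma dual_group:
  assumes "comm_group A" "group D"
  shows "comm_group (dual D A)"
proof -
  interpret A: comm_group A by fact
  interpret D: group D by fact
  show ?thesis
  proof (rule comm_groupI)
    fix \<phi> \<psi> \<chi> assume "\<phi> \<in> carrier (dual D A)" "\<psi> \<in> carrier (dual D A)" "\<chi> \<in> carrier (dual D A)"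
    then show "\<phi> \<otimes>\<^bsub>dual D A\<^esub> \<psi> \<otimes>\<^bsub>dual D A\<^esub> \<chi> = \<phi> \<otimes>\<^bsub>dual D A\<^esub> (\<psi> \<otimes>\<^bsub>dual D A\<^esub> \<chi>)"
      by (auto simp: dual_def hom_def Pi_iff A.m_assoc)
  next
    fix \<phi> assume \<phi>: "\<phi> \<in> carrier (dual D A)"
    let ?\<psi> = "\<lambda>x\<in>carrier D. inv\<^bsub>A\<^esub> \<phi> x"
    have "?\<psi> \<in> carrier (dual D A)" using \<phi> by (auto simp: dual_def hom_def Pi_iff A.inv_mult)
    moreover have "?\<psi> \<otimes>\<^bsub>dual D A\<^esub> \<phi> = \<one>\<^bsub>dual D A\<^esub>"
      using \<phi> by (auto simp: dual_def hom_def Pi_iff)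
    ultimately show "\<exists>\<psi>\<in>carrier (dual D A). \<psi> \<otimes>\<^bsub>dual D A\<^esub> \<phi> = \<one>\<^bsub>dual D A\<^esub>" by blast
  next
    fix \<phi> assume \<phi>: "\<phi> \<in> carrier (dual D A)"
    then show "\<one>\<^bsub>dual D A\<^esub> \<otimes>\<^bsub>dual D A\<^esub> \<phi> = \<phi>"
      by (auto simp: dual_def hom_def Pi_iff intro!: extensionalityI[of _ "carrier D"])
  next
    fix \<phi> \<psi> assume "\<phi> \<in> carrier (dual D A)" "\<psi> \<in> carrier (dual D A)"
    then show "\<phi> \<otimes>\<^bsub>dual D A\<^esub> \<psi> = \<psi> \<otimes>\<^bsub>dual D A\<^esub> \<phi>"
      by (auto simp: dual_def hom_def Pi_iff A.m_comm intro!: restrict_ext)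
    show "\<phi> \<otimes>\<^bsub>dual D A\<^esub> \<psi> \<in> carrier (dual D A)"
      using \<open>\<phi> \<in> _\<close> \<open>\<psi> \<in> _\<close> by (auto simp: dual_def hom_def Pi_iff A.m_ac)
  qed (auto simp: dual_def hom_def)
qed

lemma restrict_dual:
  assumes "\<phi> \<in> carrier (dual (G \<restriction> U) A)" "W \<subseteq> U" "subgroup W G"
  shows "restrict \<phi> W \<in> carrier (dual (G \<restriction> W) A)"
  using assms subgroup.m_closed[OF assms(3)] by (auto simp: dual_def hom_def Pi_iff subset_iff)

lemma dual_mult_apply:
  "x \<in> U \<Longrightarrow> (\<phi> \<otimes>\<^bsub>dual (G \<restriction> U) A\<^esub> \<psi>) x = \<phi> x \<otimes>\<^bsub>A\<^esub> \<psi> x"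
  by (simp add: dual_def)

lemma dual_mult_closed:
  assumes "comm_group A" "group G" "subgroup U G"
    "\<phi> \<in> carrier (dual (G \<restriction> U) A)" "\<psi> \<in> carrier (dual (G \<restriction> U) A)"
  shows "\<phi> \<otimes>\<^bsub>dual (G \<restriction> U) A\<^esub> \<psi> \<in> carrier (dual (G \<restriction> U) A)"
proof -
  interpret comm_group "dual (G \<restriction> U) A"
    using assms by (intro dual_group subgroup.subgroup_is_group)
  show ?thesis using assms by simp
qed

lemma fburn_carrier_add: "x \<in> fburn_carrier S A \<Longrightarrow> y \<in> fburn_carrier S A \<Longrightarrow> x + y \<in> fburn_carrier S A"
  unfolding fburn_carrier_def using Poly_Mapping.keys_add[of x y] by blast

lemma fburn_carrier_scal: "x \<in> fburn_carrier S A \<Longrightarrow> c *\<^sub>K x \<in> fburn_carrier S A"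
  unfolding fburn_carrier_def by (auto simp: in_keys_iff lookup_scal subset_iff)

lemma fburn_carrier_diff: "x \<in> fburn_carrier S A \<Longrightarrow> y \<in> fburn_carrier S A \<Longrightarrow> x - y \<in> fburn_carrier S A"
proof -
  assume "x \<in> fburn_carrier S A" "y \<in> fburn_carrier S A"
  then have "x + (-1) *\<^sub>K y \<in> fburn_carrier S A" by (intro fburn_carrier_add fburn_carrier_scal)
  also have "x + (-1) *\<^sub>K y = x - y" by (rule poly_mapping_eqI) (simp add: lookup_add lookup_minus lookup_scal)
  finally show ?thesis .
qed

lemma fburn_carrier_sum:
  "(\<And>i. i \<in> I \<Longrightarrow> f i \<in> fburn_carrier S A) \<Longrightarrow> (\<Sum>i\<in>I. f i) \<in> fburn_carrier S A"
  by (induction I rule: infinite_finite_induct) (auto simp: fburn_carrier_add, auto simp: fburn_carrier_def)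

lemma basis_carrier: "(U, \<phi>) \<in> pairs S A \<Longrightarrow> basis S U \<phi> \<in> fburn_carrier S A"
  by (auto simp: fburn_carrier_def basis_def pairs_def)

lemma fburn_expand:
  fixes x :: "'c \<Rightarrow>\<^sub>0 'k::field"
  shows "x = (\<Sum>c\<in>Poly_Mapping.keys x. Poly_Mapping.lookup x c *\<^sub>K Poly_Mapping.single c 1)"
proof (rule poly_mapping_eqI)
  fix d
  have "Poly_Mapping.lookup (\<Sum>c\<in>Poly_Mapping.keys x. Poly_Mapping.lookup x c *\<^sub>K Poly_Mapping.single c 1) d
     = (\<Sum>c\<in>Poly_Mapping.keys x. if c = d then Poly_Mapping.lookup x c else 0)"
    by (auto simp: lookup_sum lookup_scal lookup_single when_def intro!: sum.cong)
  also have "\<dots> = Poly_Mapping.lookup x d" by (auto simp: in_keys_iff)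
  finally show "Poly_Mapping.lookup x d = Poly_Mapping.lookup
     (\<Sum>c\<in>Poly_Mapping.keys x. Poly_Mapping.lookup x c *\<^sub>K Poly_Mapping.single c 1) d" by simp
qed

lemma fburn_key_basis:
  assumes "x \<in> fburn_carrier S A" "c \<in> Poly_Mapping.keys x"
  obtains U \<phi> where "(U, \<phi>) \<in> pairs S A" "c = pair_class S U \<phi>" "Poly_Mapping.single c 1 = basis S U \<phi>"
proof -
  from assms have "c \<in> {pair_class S U \<phi> | U \<phi>. subgroup U S \<and> \<phi> \<in> carrier (dual (S \<restriction> U) A)}"
    unfolding fburn_carrier_def by blast
  then show ?thesis using that by (auto simp: pairs_def basis_def)
qed

lemma linmap_expand:
  "linmap T \<Longrightarrow> T x = (\<Sum>c\<in>Poly_Mapping.keys x. Poly_Mapping.lookup x c *\<^sub>K T (Poly_Mapping.single c 1))"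
  using arg_cong[OF fburn_expand[of x], of T] by (simp only: linmap_sum linmap_scal)

lemma linform_expand:
  "linform T \<Longrightarrow> T x = (\<Sum>c\<in>Poly_Mapping.keys x. Poly_Mapping.lookup x c * T (Poly_Mapping.single c 1))"
  using arg_cong[OF fburn_expand[of x], of T] by (simp only: linform_sum linform_scal)

lemma linmap_eq_on_carrier:
  assumes "linmap T" "linmap T'" "x \<in> fburn_carrier S A"
    and "\<And>U \<phi>. (U, \<phi>) \<in> pairs S A \<Longrightarrow> T (basis S U \<phi>) = T' (basis S U \<phi>)"
  shows "T x = T' x"
  unfolding linmap_expand[OF assms(1), of x] linmap_expand[OF assms(2), of x]
  using assms(3,4) by (intro sum.cong refl) (metis fburn_key_basis)

lemma linform_eq_on_carrier:
  assumes "linform T" "linform T'" "x \<in> fburn_carrier S A"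
    and "\<And>U \<phi>. (U, \<phi>) \<in> pairs S A \<Longrightarrow> T (basis S U \<phi>) = T' (basis S U \<phi>)"
  shows "T x = T' x"
  unfolding linform_expand[OF assms(1), of x] linform_expand[OF assms(2), of x]
  using assms(3,4) by (intro sum.cong refl) (metis fburn_key_basis)

lemma linmap_carrier:
  assumes "linmap T" "x \<in> fburn_carrier S A"
    and "\<And>U \<phi>. (U, \<phi>) \<in> pairs S A \<Longrightarrow> T (basis S U \<phi>) \<in> fburn_carrier S' A'"
  shows "T x \<in> fburn_carrier S' A'"
  unfolding linmap_expand[OF assms(1), of x]
  using assms(2,3) by (intro fburn_carrier_sum fburn_carrier_scal) (metis fburn_key_basis)

locale fibered_group = finite_group G + A: comm_group A
  for G :: "'g monoid" (structure) and A :: "'a monoid"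
begin

lemma finite_subgroup: "subgroup U G \<Longrightarrow> finite U"
  using fin subgroup.subset finite_subset by blast

lemma card_subgroup: "subgroup U G \<Longrightarrow> card U \<noteq> 0"
  using finite_subgroup subgroup.one_closed by (metis card_0_eq empty_iff)

lemma subgroup_fibered: 
  assumes "subgroup H G" shows "fibered_group (G \<restriction> H) A"
proof -
  interpret H: group "G \<restriction> H" using assms subgroup.subgroup_is_group is_group by blast
  show ?thesis using finite_subgroup[OF assms] by unfold_locales simp
qed

lemma subgroup_restr_iff:
  assumes "subgroup H G"
  shows "subgroup U (G \<restriction> H) \<longleftrightarrow> subgroup U G \<and> U \<subseteq> H"
proof
  assume U: "subgroup U (G \<restriction> H)"
  show "subgroup U G \<and> U \<subseteq> H" using incl_subgroup[OF assms U] subgroup.subset[OF U] by simp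
qed (use subgroup_incl[OF _ assms] in blast)

lemma conj_restr:
  assumes "subgroup H G" "h \<in> H"
  shows "conj_map (G \<restriction> H) h = conj_map G h" "conj_set (G \<restriction> H) h U = conj_set G h U"
    "conj_fun (G \<restriction> H) h U \<phi> = conj_fun G h U \<phi>"
proof -
  have "inv\<^bsub>G \<restriction> H\<^esub> h = inv h" using assms by (simp add: m_inv_consistent)
  then show 1: "conj_map (G \<restriction> H) h = conj_map G h" by (simp add: conj_map_def fun_eq_iff)
  then show 2: "conj_set (G \<restriction> H) h U = conj_set G h U" by (simp add: conj_set_def)
  show "conj_fun (G \<restriction> H) h U \<phi> = conj_fun G h U \<phi>"
    using \<open>inv\<^bsub>G \<restriction> H\<^esub> h = inv h\<close> by (simp add: conj_fun_def 2)
qed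

lemma pairs_conj:
  assumes "(U, \<phi>) \<in> pairs G A" "g \<in> carrier G"
  shows "(conj_set G g U, conj_fun G g U \<phi>) \<in> pairs G A"
  using assms conj_set_subgroup conj_fun_dual by (auto simp: pairs_def)

lemma pair_class_image:
  "pair_class G U \<phi> = (\<lambda>g. (conj_set G g U, conj_fun G g U \<phi>)) ` carrier G"
  unfolding pair_class_def by (rule Setcompr_eq_image)

lemma pair_class_conj:
  assumes "(U, \<phi>) \<in> pairs G A" "g \<in> carrier G"
  shows "pair_class G (conj_set G g U) (conj_fun G g U \<phi>) = pair_class G U \<phi>"
proof -
  note U = pairsD[OF assms(1)]
  have "(conj_set G h (conj_set G g U), conj_fun G h (conj_set G g U) (conj_fun G g U \<phi>))
      = (conj_set G (h \<otimes> g) U, conj_fun G (h \<otimes> g) U \<phi>)" if "h \<in> carrier G" for h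
    using U assms that by (simp add: conj_set_conj_set conj_fun_conj_fun)
  moreover define f where "f = (\<lambda>h. (conj_set G h U, conj_fun G h U \<phi>))"
  ultimately have "pair_class G (conj_set G g U) (conj_fun G g U \<phi>) = (\<lambda>h. f (h \<otimes> g)) ` carrier G"
    unfolding pair_class_image by (intro image_cong refl) simp
  also have "\<dots> = f ` ((\<lambda>h. h \<otimes> g) ` carrier G)" by (simp add: image_image)
  also have "(\<lambda>h. h \<otimes> g) ` carrier G = carrier G" using assms(2)
  proof (intro equalityI subsetI)
    fix k assume "k \<in> carrier G"
    then show "k \<in> (\<lambda>h. h \<otimes> g) ` carrier G"
      using assms(2) by (intro image_eqI[of _ _ "k \<otimes> inv g"]) (simp_all add: m_assoc)
  qed auto
  finally show ?thesis by (simp add: f_def pair_class_image)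
qed

lemma pair_class_rep:
  "\<exists>g\<in>carrier G. (SOME p. p \<in> pair_class G U \<phi>) = (conj_set G g U, conj_fun G g U \<phi>)"
proof -
  have "\<exists>p. p \<in> pair_class G U \<phi>" unfolding pair_class_def using one_closed by blast
  then have "(SOME p. p \<in> pair_class G U \<phi>) \<in> pair_class G U \<phi>" by (rule someI_ex)
  then show ?thesis by (auto simp: pair_class_def)
qed

lemma lin_ext_basis:
  assumes "\<And>g. g \<in> carrier G \<Longrightarrow> F (conj_set G g U) (conj_fun G g U \<phi>) = F U \<phi>"
  shows "lin_ext F (basis G U \<phi>) = F U \<phi>"
  unfolding basis_def lin_ext_single using pair_class_rep[of U \<phi>] assms by auto

text \<open>Replaces the representative chosen inside a linear extension by some pair of the same class; the
  function to be extended may then be evaluated before it is known to be constant on classes.\<close>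

lemma lin_ext_basis_rep:
  assumes "(U, \<phi>) \<in> pairs G A"
  obtains U' \<phi>' where "(U', \<phi>') \<in> pairs G A" "pair_class G U' \<phi>' = pair_class G U \<phi>"
    "basis G U' \<phi>' = basis G U \<phi>" "\<And>F. lin_ext F (basis G U \<phi>) = F U' \<phi>'"
proof -
  obtain g where g: "g \<in> carrier G" "(SOME p. p \<in> pair_class G U \<phi>) = (conj_set G g U, conj_fun G g U \<phi>)"
    using pair_class_rep by blast
  show ?thesis
  proof (rule that)
    show "(conj_set G g U, conj_fun G g U \<phi>) \<in> pairs G A" using pairs_conj assms g by blast
    show eq: "pair_class G (conj_set G g U) (conj_fun G g U \<phi>) = pair_class G U \<phi>"
      using pair_class_conj assms g by blast
    then show "basis G (conj_set G g U) (conj_fun G g U \<phi>) = basis G U \<phi>" by (simp add: basis_def)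
    show "lin_ext F (basis G U \<phi>) = F (conj_set G g U) (conj_fun G g U \<phi>)" for F
      unfolding basis_def lin_ext_single g(2) by simp
  qed
qed

lemma point_mark_conj:
  assumes "U \<subseteq> carrier G" "a \<in> carrier G" "g \<in> carrier G"
  shows "point_mark G H \<Phi> (conj_set G g U) (conj_fun G g U \<phi>) a = point_mark G H \<Phi> U \<phi> (a \<otimes> g)"
  using assms by (simp add: point_mark_def conj_set_conj_set conj_fun_conj_fun)

lemma point_mark_right:
  assumes "(U, \<phi>) \<in> pairs G A" "a \<in> carrier G" "u \<in> U"
  shows "point_mark G H \<Phi> U \<phi> (a \<otimes> u) = point_mark G H \<Phi> U \<phi> a"
proof -
  note U = pairsD[OF assms(1)]
  have "u \<in> carrier G" using U assms(3) by blast
  then have "point_mark G H \<Phi> U \<phi> (a \<otimes> u) = point_mark G H \<Phi> (conj_set G u U) (conj_fun G u U \<phi>) a"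
    using point_mark_conj[OF U(3) assms(2), of u, symmetric] by blast
  also have "\<dots> = point_mark G H \<Phi> U \<phi> a"
    using U assms(3) by (simp add: conj_set_self conj_fun_self[OF U(1) assms(3) U(2) A.comm_group_axioms])
  finally show ?thesis .
qed

lemma restrict_conj_dual:
  assumes "(U, \<phi>) \<in> pairs G A" "a \<in> carrier G" "subgroup H G" "H \<subseteq> conj_set G a U"
  shows "restrict (conj_fun G a U \<phi>) H \<in> carrier (dual (G \<restriction> H) A)"
  using pairsD[OF assms(1)] conj_fun_dual assms by (blast intro: restrict_dual)

lemma point_mark_left:
  assumes "(U, \<phi>) \<in> pairs G A" "a \<in> carrier G" and H: "subgroup H G" and h: "h \<in> H"
  shows "point_mark G H \<Phi> U \<phi> (h \<otimes> a) = point_mark G H \<Phi> U \<phi> a"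
proof -
  note U = pairsD[OF assms(1)]
  interpret H: subgroup H G by fact
  have hG: "h \<in> carrier G" using h by simp
  have cc: "conj_set G a U \<subseteq> carrier G" using U assms conj_set_closed by blast
  have hh: "H \<subseteq> conj_set G h V \<longleftrightarrow> H \<subseteq> V" if "V \<subseteq> carrier G" for V
  proof
    show "H \<subseteq> conj_set G h V" if "H \<subseteq> V"
      using conj_set_self[OF H h] that unfolding conj_set_def by blast
    assume "H \<subseteq> conj_set G h V"
    then have "conj_set G (inv h) H \<subseteq> conj_set G (inv h) (conj_set G h V)" unfolding conj_set_def by blast
    then show "H \<subseteq> V" using conj_set_self[OF H, of "inv h"] h hG that by (simp add: conj_set_conj_set)
  qed
  show ?thesis
  proof (cases "H \<subseteq> conj_set G a U")
    case True
    let ?\<chi> = "restrict (conj_fun G a U \<phi>) H"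
    have \<chi>: "?\<chi> \<in> carrier (dual (G \<restriction> H) A)" using restrict_conj_dual True assms by blast
    have "?\<chi> = conj_fun G h H ?\<chi>" using conj_fun_self[OF H h \<chi> A.comm_group_axioms] by simp
    also have "\<dots> = restrict (conj_fun G (h \<otimes> a) U \<phi>) H"
    proof (rule conj_fun_eqI[OF hG H.subset])
      fix x assume x: "x \<in> H"
      have hx: "conj_map G h x \<in> H" using conj_set_self[OF H h] x unfolding conj_set_def by blast
      have "conj_fun G (h \<otimes> a) U \<phi> = conj_fun G h (conj_set G a U) (conj_fun G a U \<phi>)"
        by (rule conj_fun_conj_fun[OF hG assms(2) U(3), symmetric])
      then show "restrict (conj_fun G (h \<otimes> a) U \<phi>) H (conj_map G h x) = ?\<chi> x"
        using hx x hG cc True by (simp add: subset_iff)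
    qed (simp add: conj_set_self[OF H h])
    finally show ?thesis using True hh[OF cc] U hG assms(2)
      by (simp add: point_mark_def flip: conj_set_conj_set)
  next
    case False
    then show ?thesis using hh[OF cc] U hG assms(2)
      by (simp add: point_mark_def flip: conj_set_conj_set)
  qed
qed

lemma sum_translate_right:
  "g \<in> carrier G \<Longrightarrow> (\<Sum>a\<in>carrier G. f (a \<otimes> g)) = (\<Sum>a\<in>carrier G. f a)"
  by (rule sum.reindex_bij_witness[of _ "\<lambda>a. a \<otimes> inv g" "\<lambda>a. a \<otimes> g"]) (auto simp: m_assoc)

text \<open>A class over \<open>H\<close> whose first component is \<open>H\<close> is a singleton, so the chosen representative returns
  the original homomorphism.\<close>

lemma fburn_pi_basis:
  assumes H: "subgroup H G" and W: "subgroup W G" "W \<subseteq> H" and \<chi>: "\<chi> \<in> carrier (dual (G \<restriction> W) A)"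
  shows "fburn_pi H (basis (G \<restriction> H) W \<chi>) = (if W = H then Poly_Mapping.single \<chi> 1 else 0)"
proof -
  interpret H: fibered_group "G \<restriction> H" A by (rule subgroup_fibered) fact
  have "conj_set G g W = H \<longleftrightarrow> W = H" if g: "g \<in> H" for g
  proof
    assume c: "conj_set G g W = H"
    have "g \<in> carrier G" using g H subgroup.mem_carrier by metis
    then have "card W = card H" using card_conj_set[of g W] subgroup.subset[OF W(1)] c by simp
    then show "W = H" using W(2) finite_subgroup[OF H] by (simp add: card_subset_eq)
  qed (use conj_set_self[OF H g] in simp)
  moreover have "conj_fun G g W \<chi> = \<chi>" if "g \<in> H" "W = H" for g
    using conj_fun_self[OF W(1) _ \<chi> A.comm_group_axioms] that by simp
  ultimately show ?thesis unfolding fburn_pi_def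
    by (intro H.lin_ext_basis) (auto simp: conj_restr[OF H])
qed

text \<open>A double coset \<open>H g U\<close> contributes to the mark only if \<open>H \<le> \<^sup>gU\<close>, in which case its weight in
  \<open>sum_dc_reps\<close> is \<open>|H \<inter> \<^sup>gU| / (|H| |U|) = 1 / |U|\<close>. The function \<open>\<Phi>\<close> is arbitrary here because
  the formula is used for delta functions as well as for characters.\<close>

theorem mark_basis:
  fixes \<Phi> :: "('g \<Rightarrow> 'a) \<Rightarrow> 'k::field_char_0"
  assumes p: "(U, \<phi>) \<in> pairs G A" and H: "subgroup H G"
  shows "fburn_mark G H \<Phi> (basis G U \<phi>) = (\<Sum>a\<in>carrier G. point_mark G H \<Phi> U \<phi> a) / of_nat (card U)"
proof -
  obtain x where x: "x \<in> carrier G" and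
    rep: "(SOME p. p \<in> pair_class G U \<phi>) = (conj_set G x U, conj_fun G x U \<phi>)"
    using pair_class_rep by blast
  define V where "V = conj_set G x U"
  define \<psi> where "\<psi> = conj_fun G x U \<phi>"
  have q: "(V, \<psi>) \<in> pairs G A" unfolding V_def \<psi>_def by (rule pairs_conj) fact+
  note V = pairsD[OF q] and U = pairsD[OF p]
  let ?W = "\<lambda>g. H \<inter> conj_set G g V"
  let ?\<chi> = "\<lambda>g. restrict (conj_fun G g V \<psi>) (?W g)"
  have "fburn_pi H (basis (G \<restriction> H) (?W g) (?\<chi> g)) = (if ?W g = H then Poly_Mapping.single (?\<chi> g) (1::'k) else 0)"
    if "g \<in> dc_reps G H V" for g
  proof -
    have g: "g \<in> carrier G" using dc_reps_carrier[OF H V(1) that] .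
    have W: "subgroup (?W g) G" using H conj_set_subgroup[OF V(1) g] by (rule subgroups_Inter_pair)
    show ?thesis
      by (rule fburn_pi_basis[OF H W _ restrict_conj_dual[OF q g W]]) auto
  qed
  then have "fburn_mark G H \<Phi> (basis G U \<phi>)
      = (\<Sum>g\<in>dc_reps G H V. char_ext \<Phi> (if ?W g = H then Poly_Mapping.single (?\<chi> g) 1 else 0))"
    unfolding fburn_mark_def fburn_res_def basis_def[of G] lin_ext_single rep
    by (simp add: Let_def V_def[symmetric] \<psi>_def[symmetric] fburn_pi_def linmap_sum[OF linear_lin_ext]
        linform_sum[OF linear_char_ext])
  also have "\<dots> = (\<Sum>g\<in>dc_reps G H V. point_mark G H \<Phi> V \<psi> g)"
  proof (rule sum.cong[OF refl])
    fix g
    have "char_ext \<Phi> (0 :: ('g \<Rightarrow> 'a) \<Rightarrow>\<^sub>0 'k) = 0" by (simp add: char_ext_def)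
    moreover have "?W g = H \<longleftrightarrow> H \<subseteq> conj_set G g V" by blast
    ultimately show "char_ext \<Phi> (if ?W g = H then Poly_Mapping.single (?\<chi> g) 1 else 0) = point_mark G H \<Phi> V \<psi> g"
      by (simp add: point_mark_def char_ext_def Int_absorb2)
  qed
  also have "\<dots> = (\<Sum>g\<in>carrier G. point_mark G H \<Phi> V \<psi> g * of_nat (card (?W g)))
       / (of_nat (card H) * of_nat (card V))"
  proof (rule sum_dc_reps[OF H V(1)])
    fix h g v assume h: "h \<in> H" and g: "g \<in> carrier G" and v: "v \<in> V"
    have "h \<otimes> g \<in> carrier G" using h g subgroup.mem_carrier[OF H] by simp
    then show "point_mark G H \<Phi> V \<psi> (h \<otimes> g \<otimes> v) = point_mark G H \<Phi> V \<psi> g"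
      using point_mark_left[OF q g H h] point_mark_right[OF q _ v] by metis
  qed
  also have "(\<Sum>g\<in>carrier G. point_mark G H \<Phi> V \<psi> g * of_nat (card (?W g)))
      = (\<Sum>g\<in>carrier G. point_mark G H \<Phi> V \<psi> g) * of_nat (card H)"
    unfolding sum_distrib_right
  proof (rule sum.cong[OF refl])
    fix g show "point_mark G H \<Phi> V \<psi> g * of_nat (card (?W g)) = point_mark G H \<Phi> V \<psi> g * of_nat (card H)"
      by (cases "H \<subseteq> conj_set G g V") (auto simp: point_mark_def Int_absorb2)
  qed
  also have "(\<Sum>g\<in>carrier G. point_mark G H \<Phi> V \<psi> g) = (\<Sum>g\<in>carrier G. point_mark G H \<Phi> U \<phi> (g \<otimes> x))"
    using U x by (intro sum.cong) (auto simp: V_def \<psi>_def point_mark_conj)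
  also have "\<dots> = (\<Sum>g\<in>carrier G. point_mark G H \<Phi> U \<phi> g)" by (rule sum_translate_right) fact
  also have "card V = card U" unfolding V_def by (rule card_conj_set) fact+
  finally show ?thesis using card_subgroup[OF H] by simp
qed

end

section \<open>Conjugation and multiplicativity of marks\<close>

definition conjugate_pairs ::
  "'g monoid \<Rightarrow> 'a monoid \<Rightarrow> 'g set \<Rightarrow> (('g \<Rightarrow> 'a) \<Rightarrow> 'k) \<Rightarrow> 'g set \<Rightarrow> (('g \<Rightarrow> 'a) \<Rightarrow> 'k) \<Rightarrow> bool" where
  "conjugate_pairs G A H \<Phi> K \<Psi> \<longleftrightarrow>
     (\<exists>g\<in>carrier G. K = conj_set G g H \<and> \<Psi> = conj_char G A g H \<Phi>)"

lemma XX_iff: "(H, \<Phi>) \<in> XX G A \<longleftrightarrow> subgroup H G \<and> \<Phi> \<in> characters (dual (G \<restriction> H) A)"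
  by (simp add: XX_def)

context fibered_group
begin

lemma dual_restr_group: "subgroup H G \<Longrightarrow> comm_group (dual (G \<restriction> H) A)"
  using dual_group[OF A.comm_group_axioms] subgroup.subgroup_is_group is_group by blast

lemma conj_char_conj_fun:
  assumes "subgroup H G" "g \<in> carrier G" "\<phi> \<in> carrier (dual (G \<restriction> H) A)"
  shows "conj_char G A g H \<Phi> (conj_fun G g H \<phi>) = \<Phi> \<phi>"
proof -
  have H: "H \<subseteq> carrier G" using assms(1) by (rule subgroup.subset)
  have "\<phi> \<in> extensional H" using assms(3) by (simp add: dual_def)
  then have "conj_fun G (inv g) (conj_set G g H) (conj_fun G g H \<phi>) = \<phi>"
    using H assms(2) by (simp add: conj_fun_conj_fun conj_fun_one)
  then show ?thesis using conj_fun_dual[OF assms] by (simp add: conj_char_def)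
qed

text \<open>Conjugation by \<open>g\<close> is a bijection between the dual groups of \<open>H\<close> and \<open>\<^sup>gH\<close>, so it suffices to
  compare values on conjugates.\<close>

lemma conj_char_eqI:
  assumes "subgroup H G" "g \<in> carrier G" "\<Psi> \<in> extensional (carrier (dual (G \<restriction> conj_set G g H) A))"
    and "\<And>\<phi>. \<phi> \<in> carrier (dual (G \<restriction> H) A) \<Longrightarrow> \<Psi> (conj_fun G g H \<phi>) = \<Phi> \<phi>"
  shows "conj_char G A g H \<Phi> = \<Psi>"
proof (rule extensionalityI[OF _ assms(3)])
  fix \<psi> assume \<psi>: "\<psi> \<in> carrier (dual (G \<restriction> conj_set G g H) A)"
  have H: "H \<subseteq> carrier G" using assms(1) by (rule subgroup.subset)
  let ?\<phi> = "conj_fun G (inv g) (conj_set G g H) \<psi>"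
  have "?\<phi> \<in> carrier (dual (G \<restriction> conj_set G (inv g) (conj_set G g H)) A)"
    using assms(2) \<psi> conj_set_subgroup[OF assms(1,2)] by (intro conj_fun_dual) auto
  then have \<phi>: "?\<phi> \<in> carrier (dual (G \<restriction> H) A)" using H assms(2) by (simp add: conj_set_conj_set)
  have "\<psi> \<in> extensional (conj_set G g H)" using \<psi> by (simp add: dual_def)
  then have "conj_fun G g (conj_set G (inv g) (conj_set G g H)) ?\<phi> = \<psi>"
    using H assms(2) conj_set_closed[OF assms(2) H] by (subst conj_fun_conj_fun) (auto simp: conj_fun_one)
  then have "conj_fun G g H ?\<phi> = \<psi>" using H assms(2) by (simp add: conj_set_conj_set)
  then show "conj_char G A g H \<Phi> \<psi> = \<Psi> \<psi>"
    using assms(4)[OF \<phi>] conj_char_conj_fun[OF assms(1,2) \<phi>, of \<Phi>] by simp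
qed (simp add: conj_char_def)

lemma XX_conj:
  assumes "(H, \<Phi>) \<in> XX G A" "g \<in> carrier G"
  shows "(conj_set G g H, conj_char G A g H \<Phi>) \<in> XX G A"
proof -
  have H: "subgroup H G" and \<Phi>: "\<Phi> \<in> characters (dual (G \<restriction> H) A)" using assms by (auto simp: XX_iff)
  have Hs: "H \<subseteq> carrier G" using H by (rule subgroup.subset)
  let ?K = "conj_set G g H"
  have K: "subgroup ?K G" and Ks: "?K \<subseteq> carrier G"
    using conj_set_subgroup H assms(2) conj_set_closed Hs by auto
  have inv: "conj_set G (inv g) ?K = H" using Hs assms(2) by (simp add: conj_set_conj_set)
  have d: "conj_fun G (inv g) ?K \<phi> \<in> carrier (dual (G \<restriction> H) A)" if "\<phi> \<in> carrier (dual (G \<restriction> ?K) A)" for \<phi>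
    using conj_fun_dual[OF K inv_closed[OF assms(2)] that] inv by simp
  interpret DK: comm_group "dual (G \<restriction> ?K) A" by (rule dual_restr_group[OF K])
  have m: "conj_fun G (inv g) ?K (\<phi> \<otimes>\<^bsub>dual (G \<restriction> ?K) A\<^esub> \<psi>)
      = conj_fun G (inv g) ?K \<phi> \<otimes>\<^bsub>dual (G \<restriction> H) A\<^esub> conj_fun G (inv g) ?K \<psi>"
    if "\<phi> \<in> carrier (dual (G \<restriction> ?K) A)" "\<psi> \<in> carrier (dual (G \<restriction> ?K) A)" for \<phi> \<psi>
  proof (rule conj_fun_eqI)
    fix x assume x: "x \<in> ?K"
    then have "conj_map G (inv g) x \<in> H" using inv unfolding conj_set_def by blast
    then show "(conj_fun G (inv g) ?K \<phi> \<otimes>\<^bsub>dual (G \<restriction> H) A\<^esub> conj_fun G (inv g) ?K \<psi>) (conj_map G (inv g) x)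
        = (\<phi> \<otimes>\<^bsub>dual (G \<restriction> ?K) A\<^esub> \<psi>) x"
      using x assms(2) Ks by (simp add: dual_mult_apply)
  qed (use assms(2) Ks inv in \<open>auto simp: dual_def\<close>)
  have "conj_char G A g H \<Phi> \<in> characters (dual (G \<restriction> ?K) A)"
  proof -
    have "conj_char G A g H \<Phi> \<phi> \<noteq> 0" if "\<phi> \<in> carrier (dual (G \<restriction> ?K) A)" for \<phi>
      using character_nonzero[OF \<Phi> d[OF that]] that by (simp add: conj_char_def)
    moreover have "conj_char G A g H \<Phi> (\<phi> \<otimes>\<^bsub>dual (G \<restriction> ?K) A\<^esub> \<psi>)
        = conj_char G A g H \<Phi> \<phi> * conj_char G A g H \<Phi> \<psi>"
      if "\<phi> \<in> carrier (dual (G \<restriction> ?K) A)" "\<psi> \<in> carrier (dual (G \<restriction> ?K) A)" for \<phi> \<psi>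
      using character_mult[OF \<Phi> d[OF that(1)] d[OF that(2)]] m[OF that] that by (simp add: conj_char_def)
    moreover have "conj_char G A g H \<Phi> \<in> extensional (carrier (dual (G \<restriction> ?K) A))" by (simp add: conj_char_def)
    ultimately show ?thesis by (simp add: hom_def field_units_def Pi_iff)
  qed
  then show ?thesis using K by (simp add: XX_iff)
qed

lemma conj_char_conj_char:
  assumes H: "subgroup H G" and g: "g \<in> carrier G" and h: "h \<in> carrier G"
  shows "conj_char G A g (conj_set G h H) (conj_char G A h H \<Phi>) = conj_char G A (g \<otimes> h) H \<Phi>"
proof (rule conj_char_eqI)
  have Hs: "H \<subseteq> carrier G" using H by (rule subgroup.subset)
  show "subgroup (conj_set G h H) G" by (rule conj_set_subgroup) fact+
  show "conj_char G A (g \<otimes> h) H \<Phi> \<in> extensional (carrier (dual (G \<restriction> conj_set G g (conj_set G h H)) A))"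
    using Hs g h by (simp add: conj_char_def conj_set_conj_set)
  fix \<phi> assume \<phi>: "\<phi> \<in> carrier (dual (G \<restriction> conj_set G h H) A)"
  have ih: "conj_set G (inv h) (conj_set G h H) = H" using Hs h by (simp add: conj_set_conj_set)
  have d: "conj_fun G (inv h) (conj_set G h H) \<phi> \<in> carrier (dual (G \<restriction> H) A)"
    using conj_fun_dual[OF conj_set_subgroup[OF H h] inv_closed[OF h] \<phi>] ih by simp
  have "conj_fun G (g \<otimes> h) H (conj_fun G (inv h) (conj_set G h H) \<phi>)
      = conj_fun G (g \<otimes> h) (conj_set G (inv h) (conj_set G h H)) (conj_fun G (inv h) (conj_set G h H) \<phi>)"
    by (simp add: ih)
  also have "\<dots> = conj_fun G g (conj_set G h H) \<phi>"
    using g h conj_set_closed[OF h Hs] by (subst conj_fun_conj_fun) (auto simp: m_assoc)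
  finally show "conj_char G A (g \<otimes> h) H \<Phi> (conj_fun G g (conj_set G h H) \<phi>) = conj_char G A h H \<Phi> \<phi>"
    using conj_char_conj_fun[OF H m_closed[OF g h] d, of \<Phi>] \<phi> by (simp add: conj_char_def)
qed fact

lemma conj_char_one:
  assumes "(H, \<Phi>) \<in> XX G A" shows "conj_char G A \<one> H \<Phi> = \<Phi>"
proof (rule conj_char_eqI)
  have H: "H \<subseteq> carrier G" using assms subgroup.subset by (auto simp: XX_iff)
  show "\<Phi> \<in> extensional (carrier (dual (G \<restriction> conj_set G \<one> H) A))" using assms H by (simp add: XX_iff)
  show "\<Phi> (conj_fun G \<one> H \<phi>) = \<Phi> \<phi>" if "\<phi> \<in> carrier (dual (G \<restriction> H) A)" for \<phi>
    using that H by (simp add: conj_fun_one dual_def)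
qed (use assms in \<open>auto simp: XX_iff\<close>)

lemma conjugate_refl: "(H, \<Phi>) \<in> XX G A \<Longrightarrow> conjugate_pairs G A H \<Phi> H \<Phi>"
  unfolding conjugate_pairs_def
  by (intro bexI[of _ \<one>]) (auto simp: conj_char_one XX_iff dest: subgroup.subset)

lemma conjugate_sym:
  assumes "(H, \<Phi>) \<in> XX G A" "conjugate_pairs G A H \<Phi> K \<Psi>"
  shows "conjugate_pairs G A K \<Psi> H \<Phi>"
proof -
  obtain g where g: "g \<in> carrier G" "K = conj_set G g H" "\<Psi> = conj_char G A g H \<Phi>"
    using assms(2) by (auto simp: conjugate_pairs_def)
  have H: "subgroup H G" "H \<subseteq> carrier G" using assms(1) subgroup.subset by (auto simp: XX_iff)
  have "H = conj_set G (inv g) K" "\<Phi> = conj_char G A (inv g) K \<Psi>"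
    using g H by (simp_all add: conj_set_conj_set conj_char_conj_char conj_char_one[OF assms(1)])
  then show ?thesis using g(1) unfolding conjugate_pairs_def by blast
qed

lemma conjugate_trans:
  assumes "(H, \<Phi>) \<in> XX G A" "conjugate_pairs G A H \<Phi> K \<Psi>" "conjugate_pairs G A K \<Psi> L \<Theta>"
  shows "conjugate_pairs G A H \<Phi> L \<Theta>"
proof -
  obtain g where g: "g \<in> carrier G" "K = conj_set G g H" "\<Psi> = conj_char G A g H \<Phi>"
    using assms(2) by (auto simp: conjugate_pairs_def)
  obtain h where h: "h \<in> carrier G" "L = conj_set G h K" "\<Theta> = conj_char G A h K \<Psi>"
    using assms(3) by (auto simp: conjugate_pairs_def)
  have H: "subgroup H G" "H \<subseteq> carrier G" using assms(1) subgroup.subset by (auto simp: XX_iff)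
  have "L = conj_set G (h \<otimes> g) H" "\<Theta> = conj_char G A (h \<otimes> g) H \<Phi>"
    using g h H by (simp_all add: conj_set_conj_set conj_char_conj_char)
  then show ?thesis using g(1) h(1) unfolding conjugate_pairs_def by blast
qed

lemma point_mark_conj_char:
  assumes p: "(U, \<phi>) \<in> pairs G A" and H: "subgroup H G" and g: "g \<in> carrier G" and a: "a \<in> carrier G"
  shows "point_mark G (conj_set G g H) (conj_char G A g H \<Phi>) U \<phi> (g \<otimes> a) = point_mark G H \<Phi> U \<phi> a"
proof -
  note U = pairsD[OF p]
  have Hs: "H \<subseteq> carrier G" using H by (rule subgroup.subset)
  have aU: "conj_set G a U \<subseteq> carrier G" using conj_set_closed a U by blast
  have eq: "conj_set G (g \<otimes> a) U = conj_set G g (conj_set G a U)" using conj_set_conj_set[OF g a U(3)] by simp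
  have inc: "conj_set G g H \<subseteq> conj_set G (g \<otimes> a) U \<longleftrightarrow> H \<subseteq> conj_set G a U"
  proof
    assume "conj_set G g H \<subseteq> conj_set G (g \<otimes> a) U"
    then have "conj_set G (inv g) (conj_set G g H) \<subseteq> conj_set G (inv g) (conj_set G g (conj_set G a U))"
      unfolding eq conj_set_def[of G "inv g"] by (rule image_mono)
    then show "H \<subseteq> conj_set G a U" using g Hs aU by (simp add: conj_set_conj_set)
  qed (unfold eq conj_set_def[of G g], rule image_mono)
  show ?thesis
  proof (cases "H \<subseteq> conj_set G a U")
    case True
    let ?\<chi> = "restrict (conj_fun G a U \<phi>) H"
    have \<chi>: "?\<chi> \<in> carrier (dual (G \<restriction> H) A)" using restrict_conj_dual[OF p a H True] .
    have "conj_fun G g H ?\<chi> = restrict (conj_fun G (g \<otimes> a) U \<phi>) (conj_set G g H)"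
    proof (rule conj_fun_eqI[OF g Hs])
      fix x assume x: "x \<in> H"
      then have "conj_map G g x \<in> conj_set G g H" by (simp add: conj_set_def)
      moreover have "conj_fun G (g \<otimes> a) U \<phi> = conj_fun G g (conj_set G a U) (conj_fun G a U \<phi>)"
        by (rule conj_fun_conj_fun[OF g a U(3), symmetric])
      ultimately show "restrict (conj_fun G (g \<otimes> a) U \<phi>) (conj_set G g H) (conj_map G g x) = ?\<chi> x"
        using x g aU True by (simp add: subset_iff)
    qed simp
    then show ?thesis using True inc conj_char_conj_fun[OF H g \<chi>, of \<Phi>] by (simp add: point_mark_def)
  qed (simp add: point_mark_def inc)
qed

lemma sum_translate_left:
  "g \<in> carrier G \<Longrightarrow> (\<Sum>a\<in>carrier G. f (g \<otimes> a)) = (\<Sum>a\<in>carrier G. f a)"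
  by (rule sum_translate[OF is_group])

lemma mark_conjugate:
  fixes \<Phi> :: "('g \<Rightarrow> 'a) \<Rightarrow> 'k::field_char_0"
  assumes x: "x \<in> fburn_carrier G A" and H: "subgroup H G" and c: "conjugate_pairs G A H \<Phi> K \<Psi>"
  shows "fburn_mark G K \<Psi> x = fburn_mark G H \<Phi> x"
proof -
  obtain g where g: "g \<in> carrier G" and K: "K = conj_set G g H" and \<Psi>: "\<Psi> = conj_char G A g H \<Phi>"
    using c by (auto simp: conjugate_pairs_def)
  have Ks: "subgroup K G" unfolding K using H g by (rule conj_set_subgroup)
  show ?thesis
  proof (rule linform_eq_on_carrier[OF linear_mark linear_mark x])
    fix U \<phi> assume p: "(U, \<phi>) \<in> pairs G A"
    have "(\<Sum>a\<in>carrier G. point_mark G K \<Psi> U \<phi> a) = (\<Sum>a\<in>carrier G. point_mark G K \<Psi> U \<phi> (g \<otimes> a))"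
      by (rule sum_translate_left[OF g, symmetric])
    also have "\<dots> = (\<Sum>a\<in>carrier G. point_mark G H \<Phi> U \<phi> a)"
      unfolding K \<Psi> using point_mark_conj_char[OF p H g] by (intro sum.cong) auto
    finally show "fburn_mark G K \<Psi> (basis G U \<phi>) = fburn_mark G H \<Phi> (basis G U \<phi>)"
      by (simp add: mark_basis[OF p Ks] mark_basis[OF p H])
  qed
qed

text \<open>The component of the product at \<open>g\<close> is restricted from \<open>U\<close> and \<open>\<^sup>gV\<close>, and
  \<open>H \<le> \<^sup>a(U \<inter> \<^sup>gV)\<close> means \<open>H \<le> \<^sup>aU\<close> and \<open>H \<le> \<^bsup>ag\<^esup>V\<close>; the character \<open>\<Phi>\<close> then splits the product of
  the two restrictions.\<close>

lemma point_mark_product: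
  fixes \<Phi> :: "('g \<Rightarrow> 'a) \<Rightarrow> 'k::field_char_0"
  assumes p: "(U, \<phi>) \<in> pairs G A" and q: "(V, \<psi>) \<in> pairs G A" and H: "subgroup H G"
    and \<Phi>: "\<Phi> \<in> characters (dual (G \<restriction> H) A)" and a: "a \<in> carrier G" and g: "g \<in> carrier G"
    and W: "W = U \<inter> conj_set G g V"
  shows "point_mark G H \<Phi> W (restrict \<phi> W \<otimes>\<^bsub>dual (G \<restriction> W) A\<^esub> restrict (conj_fun G g V \<psi>) W) a
       = point_mark G H \<Phi> U \<phi> a * point_mark G H \<Phi> V \<psi> (a \<otimes> g)"
proof -
  note U = pairsD[OF p] and V = pairsD[OF q]
  let ?\<chi> = "restrict \<phi> W \<otimes>\<^bsub>dual (G \<restriction> W) A\<^esub> restrict (conj_fun G g V \<psi>) W"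
  have gV: "conj_set G g V \<subseteq> carrier G" using conj_set_closed g V by blast
  have Ws: "W \<subseteq> carrier G" using W U by blast
  have aW: "conj_set G a W = conj_set G a U \<inter> conj_set G (a \<otimes> g) V"
    unfolding W using conj_set_Int[OF a U(3) gV] conj_set_conj_set[OF a g V(3)] by simp
  show ?thesis
  proof (cases "H \<subseteq> conj_set G a W")
    case True
    then have HU: "H \<subseteq> conj_set G a U" and HV: "H \<subseteq> conj_set G (a \<otimes> g) V" by (auto simp: aW)
    have "restrict (conj_fun G a W ?\<chi>) H
       = restrict (conj_fun G a U \<phi>) H \<otimes>\<^bsub>dual (G \<restriction> H) A\<^esub> restrict (conj_fun G (a \<otimes> g) V \<psi>) H"
    proof (rule extensionalityI[of _ H])
      fix x assume x: "x \<in> H"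
      then obtain y where y: "y \<in> W" "x = conj_map G a y" using True by (auto simp: conj_set_def)
      have "conj_fun G (a \<otimes> g) V \<psi> = conj_fun G a (conj_set G g V) (conj_fun G g V \<psi>)"
        by (rule conj_fun_conj_fun[OF a g V(3), symmetric])
      then show "restrict (conj_fun G a W ?\<chi>) H x
         = (restrict (conj_fun G a U \<phi>) H \<otimes>\<^bsub>dual (G \<restriction> H) A\<^esub> restrict (conj_fun G (a \<otimes> g) V \<psi>) H) x"
        using x y a U(3) gV Ws W by (simp add: dual_mult_apply)
    qed (auto simp: dual_def)
    then show ?thesis
      using True HU HV character_mult[OF \<Phi> restrict_conj_dual[OF p a H HU]
          restrict_conj_dual[OF q m_closed[OF a g] H HV]]
      by (simp add: point_mark_def)
  next
    case False
    then show ?thesis by (auto simp: point_mark_def aW)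
  qed
qed

definition product_term where
  "product_term U \<phi> V \<psi> g = (let W = U \<inter> conj_set G g V in
     basis G W (restrict \<phi> W \<otimes>\<^bsub>dual (G \<restriction> W) A\<^esub> restrict (conj_fun G g V \<psi>) W))"

lemma product_pair:
  assumes p: "(U, \<phi>) \<in> pairs G A" and q: "(V, \<psi>) \<in> pairs G A" and g: "g \<in> carrier G"
    and W: "W = U \<inter> conj_set G g V"
  shows "(W, restrict \<phi> W \<otimes>\<^bsub>dual (G \<restriction> W) A\<^esub> restrict (conj_fun G g V \<psi>) W) \<in> pairs G A"
proof -
  note U = pairsD[OF p] and V = pairsD[OF q]
  have Ws: "subgroup W G"
    unfolding W using U(1) conj_set_subgroup[OF V(1) g] by (rule subgroups_Inter_pair)
  show ?thesis unfolding pairs_def using Ws W U V g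
    by (auto intro!: dual_mult_closed[OF A.comm_group_axioms is_group] restrict_dual[OF U(2)]
        restrict_dual[OF conj_fun_dual[OF V(1) g V(2)]])
qed

text \<open>After \<open>sum_dc_reps\<close> the factor \<open>1 / |U \<inter> \<^sup>gV|\<close> of the mark of the component at \<open>g\<close> cancels, and the
  double sum over \<open>a\<close> and \<open>g\<close> of \<open>P(a) Q(a g)\<close> separates into a product of two sums.\<close>

lemma mark_product_basis:
  fixes \<Phi> :: "('g \<Rightarrow> 'a) \<Rightarrow> 'k::field_char_0"
  assumes p: "(U, \<phi>) \<in> pairs G A" and q: "(V, \<psi>) \<in> pairs G A" and H: "subgroup H G"
    and \<Phi>: "\<Phi> \<in> characters (dual (G \<restriction> H) A)"
  shows "fburn_mark G H \<Phi> (\<Sum>g\<in>dc_reps G U V. product_term U \<phi> V \<psi> g)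
       = fburn_mark G H \<Phi> (basis G U \<phi>) * fburn_mark G H \<Phi> (basis G V \<psi>)"
proof -
  note U = pairsD[OF p] and V = pairsD[OF q]
  let ?P = "point_mark G H \<Phi> U \<phi>" and ?Q = "point_mark G H \<Phi> V \<psi>"
  let ?n = "\<lambda>g. of_nat (card (U \<inter> conj_set G g V)) :: 'k"
  define f where "f g = (\<Sum>a\<in>carrier G. ?P a * ?Q (a \<otimes> g)) / ?n g" for g
  have f: "fburn_mark G H \<Phi> (product_term U \<phi> V \<psi> g) = f g" if g: "g \<in> carrier G" for g
    using point_mark_product[OF p q H \<Phi> _ g refl]
    by (simp add: product_term_def Let_def mark_basis[OF product_pair[OF p q g refl] H] f_def)
  have n0: "?n g \<noteq> 0" if g: "g \<in> carrier G" for g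
    using card_subgroup pairsD(1)[OF product_pair[OF p q g refl]] by simp
  have finv: "f (u \<otimes> g \<otimes> v) = f g" if u: "u \<in> U" and g: "g \<in> carrier G" and v: "v \<in> V" for u g v
  proof -
    have uG: "u \<in> carrier G" and vG: "v \<in> carrier G" using u v U V by blast+
    have gV: "conj_set G g V \<subseteq> carrier G" using conj_set_closed g V by blast
    have "conj_set G (u \<otimes> g \<otimes> v) V = conj_set G u (conj_set G g (conj_set G v V))"
      using uG vG g V(3) by (simp add: conj_set_conj_set conj_set_closed m_assoc)
    also have "\<dots> = conj_set G u (conj_set G g V)" by (simp add: conj_set_self[OF V(1) v])
    finally have "U \<inter> conj_set G (u \<otimes> g \<otimes> v) V = conj_set G u (U \<inter> conj_set G g V)"
      using conj_set_Int[OF uG U(3) gV] conj_set_self[OF U(1) u] by simp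
    then have "?n (u \<otimes> g \<otimes> v) = ?n g" using card_conj_set[OF uG, of "U \<inter> conj_set G g V"] U(3) by auto
    moreover have "(\<Sum>a\<in>carrier G. ?P a * ?Q (a \<otimes> (u \<otimes> g \<otimes> v))) = (\<Sum>a\<in>carrier G. ?P (a \<otimes> u) * ?Q (a \<otimes> u \<otimes> g))"
    proof (rule sum.cong[OF refl])
      fix a assume a: "a \<in> carrier G"
      have "?Q (a \<otimes> (u \<otimes> g \<otimes> v)) = ?Q ((a \<otimes> u \<otimes> g) \<otimes> v)" using a uG g vG by (simp add: m_assoc)
      also have "\<dots> = ?Q (a \<otimes> u \<otimes> g)" using point_mark_right[OF q _ v, of "a \<otimes> u \<otimes> g"] a uG g by blast
      finally show "?P a * ?Q (a \<otimes> (u \<otimes> g \<otimes> v)) = ?P (a \<otimes> u) * ?Q (a \<otimes> u \<otimes> g)"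
        by (simp only: point_mark_right[OF p a u])
    qed
    moreover have "\<dots> = (\<Sum>a\<in>carrier G. ?P a * ?Q (a \<otimes> g))"
      by (rule sum_translate_right[OF uG, of "\<lambda>a. ?P a * ?Q (a \<otimes> g)"])
    ultimately show ?thesis by (simp add: f_def)
  qed
  have "fburn_mark G H \<Phi> (\<Sum>g\<in>dc_reps G U V. product_term U \<phi> V \<psi> g) = (\<Sum>g\<in>dc_reps G U V. f g)"
    using f dc_reps_carrier[OF U(1) V(1)] by (simp add: linform_sum[OF linear_mark])
  also have "\<dots> = (\<Sum>g\<in>carrier G. f g * ?n g) / (of_nat (card U) * of_nat (card V))"
    by (rule sum_dc_reps[OF U(1) V(1) finv])
  also have "(\<Sum>g\<in>carrier G. f g * ?n g) = (\<Sum>g\<in>carrier G. \<Sum>a\<in>carrier G. ?P a * ?Q (a \<otimes> g))"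
    using n0 by (simp add: f_def)
  also have "\<dots> = (\<Sum>a\<in>carrier G. ?P a * (\<Sum>g\<in>carrier G. ?Q (a \<otimes> g)))"
    by (subst sum.swap) (simp add: sum_distrib_left)
  also have "\<dots> = (\<Sum>a\<in>carrier G. ?P a) * (\<Sum>g\<in>carrier G. ?Q g)"
    by (simp add: sum_translate_left sum_distrib_right)
  finally show ?thesis by (simp add: mark_basis[OF p H] mark_basis[OF q H])
qed

lemma linear_fburn_mult_left: "linmap (\<lambda>x. fburn_mult G A x y)"
  unfolding fburn_mult_def by (rule linear_lin_ext)

lemma linear_fburn_mult_right: "linmap (\<lambda>y. fburn_mult G A x y)"
  unfolding fburn_mult_def by (rule linear_lin_ext_parameter) (rule linear_lin_ext)

lemma fburn_mult_basis:
  assumes p: "(U, \<phi>) \<in> pairs G A" and q: "(V, \<psi>) \<in> pairs G A"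
  obtains U' \<phi>' V' \<psi>' where "(U', \<phi>') \<in> pairs G A" "(V', \<psi>') \<in> pairs G A"
    "(basis G U' \<phi>' :: ('g, 'a, 'k::field) fburn) = basis G U \<phi>" "(basis G V' \<psi>' :: ('g, 'a, 'k::field) fburn) = basis G V \<psi>"
    "fburn_mult G A (basis G U \<phi>) (basis G V \<psi> :: ('g, 'a, 'k::field) fburn)
     = (\<Sum>g\<in>dc_reps G U' V'. product_term U' \<phi>' V' \<psi>' g)"
proof -
  obtain U' \<phi>' where U': "(U', \<phi>') \<in> pairs G A" "(basis G U' \<phi>' :: ('g, 'a, 'k) fburn) = basis G U \<phi>"
    and 1: "\<And>F :: _ \<Rightarrow> _ \<Rightarrow> ('g, 'a, 'k) fburn. lin_ext F (basis G U \<phi>) = F U' \<phi>'"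
    by (rule lin_ext_basis_rep[OF p]) blast
  obtain V' \<psi>' where V': "(V', \<psi>') \<in> pairs G A" "(basis G V' \<psi>' :: ('g, 'a, 'k) fburn) = basis G V \<psi>"
    and 2: "\<And>F :: _ \<Rightarrow> _ \<Rightarrow> ('g, 'a, 'k) fburn. lin_ext F (basis G V \<psi>) = F V' \<psi>'"
    by (rule lin_ext_basis_rep[OF q]) blast
  show ?thesis
    by (rule that[OF U'(1) V'(1) U'(2) V'(2)]) (simp add: fburn_mult_def 1 2 product_term_def)
qed

theorem mark_mult:
  fixes \<Phi> :: "('g \<Rightarrow> 'a) \<Rightarrow> 'k::field_char_0"
  assumes H: "(H, \<Phi>) \<in> XX G A" and x: "x \<in> fburn_carrier G A" and y: "y \<in> fburn_carrier G A"
  shows "fburn_mark G H \<Phi> (fburn_mult G A x y) = fburn_mark G H \<Phi> x * fburn_mark G H \<Phi> y"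
proof -
  have Hs: "subgroup H G" and \<Phi>: "\<Phi> \<in> characters (dual (G \<restriction> H) A)" using H by (auto simp: XX_iff)
  note lin = linmap_add[OF linear_fburn_mult_left] linmap_scal[OF linear_fburn_mult_left]
    linmap_add[OF linear_fburn_mult_right] linmap_scal[OF linear_fburn_mult_right]
    mark_linear
  show ?thesis
  proof (rule linform_eq_on_carrier[where T = "\<lambda>x. fburn_mark G H \<Phi> (fburn_mult G A x y)", OF _ _ x])
    fix U \<phi> assume p: "(U, \<phi>) \<in> pairs G A"
    show "fburn_mark G H \<Phi> (fburn_mult G A (basis G U \<phi>) y)
        = fburn_mark G H \<Phi> (basis G U \<phi>) * fburn_mark G H \<Phi> y"
    proof (rule linform_eq_on_carrier[where T = "\<lambda>y. fburn_mark G H \<Phi> (fburn_mult G A (basis G U \<phi>) y)", OF _ _ y])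
      fix V \<psi> assume q: "(V, \<psi>) \<in> pairs G A"
      obtain U' \<phi>' V' \<psi>' where "(U', \<phi>') \<in> pairs G A" "(V', \<psi>') \<in> pairs G A"
        "(basis G U' \<phi>' :: ('g, 'a, 'k) fburn) = basis G U \<phi>"
        "(basis G V' \<psi>' :: ('g, 'a, 'k) fburn) = basis G V \<psi>"
        "fburn_mult G A (basis G U \<phi>) (basis G V \<psi> :: ('g, 'a, 'k) fburn)
          = (\<Sum>g\<in>dc_reps G U' V'. product_term U' \<phi>' V' \<psi>' g)"
        by (rule fburn_mult_basis[OF p q])
      then show "fburn_mark G H \<Phi> (fburn_mult G A (basis G U \<phi>) (basis G V \<psi>))
        = fburn_mark G H \<Phi> (basis G U \<phi>) * fburn_mark G H \<Phi> (basis G V \<psi>)"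
        using mark_product_basis[OF _ _ Hs \<Phi>, of U' \<phi>' V' \<psi>'] by simp
    qed (rule linformI; simp add: lin algebra_simps)+
  qed (rule linformI; simp add: lin algebra_simps)+
qed

lemma fburn_mult_carrier:
  fixes x y :: "('g, 'a, 'k::field) fburn"
  assumes x: "x \<in> fburn_carrier G A" and y: "y \<in> fburn_carrier G A"
  shows "fburn_mult G A x y \<in> fburn_carrier G A"
proof (rule linmap_carrier[where T = "\<lambda>x. fburn_mult G A x y", OF linear_fburn_mult_left x])
  fix U \<phi> assume p: "(U, \<phi>) \<in> pairs G A"
  show "fburn_mult G A (basis G U \<phi>) y \<in> fburn_carrier G A"
  proof (rule linmap_carrier[OF linear_fburn_mult_right y])
    fix V \<psi> assume q: "(V, \<psi>) \<in> pairs G A"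
    obtain U' \<phi>' V' \<psi>' where r: "(U', \<phi>') \<in> pairs G A" "(V', \<psi>') \<in> pairs G A"
      and eq: "fburn_mult G A (basis G U \<phi>) (basis G V \<psi> :: ('g, 'a, 'k) fburn)
        = (\<Sum>g\<in>dc_reps G U' V'. product_term U' \<phi>' V' \<psi>' g)"
      by (rule fburn_mult_basis[OF p q]) blast
    show "fburn_mult G A (basis G U \<phi>) (basis G V \<psi> :: ('g, 'a, 'k) fburn) \<in> fburn_carrier G A"
      unfolding eq product_term_def Let_def
      using product_pair[OF r _ refl] dc_reps_carrier[OF pairsD(1)[OF r(1)] pairsD(1)[OF r(2)]]
      by (intro fburn_carrier_sum basis_carrier) blast
  qed
qed

end

section \<open>Marks determine elements; existence of the idempotents\<close>

abbreviation delta :: "'d \<Rightarrow> 'd \<Rightarrow> 'k::field" where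
  "delta \<psi> \<equiv> \<lambda>\<chi>. if \<chi> = \<psi> then 1 else 0"

text \<open>The parameter \<open>K\<close> fixes the coefficient field as a type.\<close>

locale split_fibered_group = fibered_group G A
  for G :: "'g monoid" (structure) and A :: "'a monoid" +
  fixes K :: "'k::field_char_0 itself"
  assumes finite_dual: "subgroup U G \<Longrightarrow> finite (carrier (dual (G \<restriction> U) A))"
    and splitting: "subgroup U G \<Longrightarrow> splitting_field K (dual (G \<restriction> U) A)"
begin

lemma splitting_dual: "subgroup U G \<Longrightarrow> splitting_field TYPE('k) (dual (G \<restriction> U) A)"
  using splitting unfolding splitting_field_def .

text \<open>Expansion of \<open>\<Phi>\<close> in delta functions; it exhibits the marks of \<open>x\<close> at a fixed \<open>H\<close> as the pairing of
  \<open>\<Phi>\<close> with one fixed function on the dual of \<open>H\<close>.\<close>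

lemma mark_expand:
  fixes \<Phi> :: "('g \<Rightarrow> 'a) \<Rightarrow> 'k"
  assumes x: "x \<in> fburn_carrier G A" and H: "subgroup H G"
  shows "fburn_mark G H \<Phi> x = (\<Sum>\<psi>\<in>carrier (dual (G \<restriction> H) A).
    fburn_mark G H (delta \<psi>) x * \<Phi> \<psi>)"
proof (rule linform_eq_on_carrier[OF linear_mark _ x])
  let ?D = "carrier (dual (G \<restriction> H) A)"
  fix U \<phi> assume p: "(U, \<phi>) \<in> pairs G A"
  have "point_mark G H \<Phi> U \<phi> a
      = (\<Sum>\<psi>\<in>?D. point_mark G H (delta \<psi>) U \<phi> a * \<Phi> \<psi>)"
    if a: "a \<in> carrier G" for a
  proof (cases "H \<subseteq> conj_set G a U")
    case True
    let ?\<chi> = "restrict (conj_fun G a U \<phi>) H"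
    have \<chi>: "?\<chi> \<in> ?D" using restrict_conj_dual[OF p a H True] .
    have "(\<Sum>\<psi>\<in>?D. point_mark G H (delta \<psi>) U \<phi> a * \<Phi> \<psi>)
        = (\<Sum>\<psi>\<in>?D. if ?\<chi> = \<psi> then \<Phi> \<psi> else 0)"
      using True by (intro sum.cong) (auto simp: point_mark_def)
    also have "\<dots> = \<Phi> ?\<chi>" using \<chi> finite_dual[OF H] by simp
    finally show ?thesis using True by (simp add: point_mark_def)
  qed (simp add: point_mark_def)
  then show "fburn_mark G H \<Phi> (basis G U \<phi>)
    = (\<Sum>\<psi>\<in>?D. fburn_mark G H (delta \<psi>) (basis G U \<phi>) * \<Phi> \<psi>)"
    by (simp add: mark_basis[OF p H] sum_divide_distrib sum_distrib_right sum.swap[of _ "carrier G"])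
qed (rule linformI, simp_all add: mark_linear sum.distrib sum_distrib_left algebra_simps)

text \<open>Triangularity: at a pair \<open>(U, \<phi>)\<close> only classes with a first component of larger order can have a nonzero
  contribution, apart from the class of \<open>(U, \<phi>)\<close> itself.\<close>

lemma basis_eq_of_point_mark:
  assumes p: "(U, \<phi>) \<in> pairs G A" and q: "(V, \<psi>) \<in> pairs G A" and card: "card V \<le> card U"
    and a: "a \<in> carrier G"
    and nz: "point_mark G U (delta \<phi>) V \<psi> a \<noteq> (0::'k)"
  shows "pair_class G V \<psi> = pair_class G U \<phi>"
proof -
  note U = pairsD[OF p] and V = pairsD[OF q]
  have sub: "U \<subseteq> conj_set G a V" and \<phi>: "restrict (conj_fun G a V \<psi>) U = \<phi>"
    using nz by (auto simp: point_mark_def split: if_splits)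
  have "card (conj_set G a V) = card V" by (rule card_conj_set[OF a V(3)])
  moreover have "finite (conj_set G a V)" using finite_subgroup conj_set_subgroup[OF V(1) a] by blast
  ultimately have "U = conj_set G a V" using sub card card_seteq by metis
  moreover have "conj_fun G a V \<psi> = \<phi>"
    using \<phi> unfolding \<open>U = conj_set G a V\<close> by (simp add: extensional_restrict)
  ultimately show ?thesis using pair_class_conj[OF q a] by simp
qed

text \<open>Take a class \<open>[U, \<phi>]\<close> in the support of \<open>x\<close> with \<open>|U|\<close> maximal. The marks at \<open>U\<close> vanish on all
  characters, hence on the delta function at \<open>\<phi>\<close>; by triangularity the latter mark is the coefficient
  of \<open>[U, \<phi>]\<close> times the mark of \<open>[U, \<phi>]\<close> itself, a nonzero number in characteristic \<open>0\<close>.\<close>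

theorem marks_injective:
  fixes x :: "('g, 'a, 'k) fburn"
  assumes x: "x \<in> fburn_carrier G A"
    and zero: "\<And>H \<Phi>. (H, \<Phi>) \<in> XX G A \<Longrightarrow> fburn_mark G H \<Phi> x = 0"
  shows "x = 0"
proof (rule ccontr)
  assume "x \<noteq> 0"
  then have ne: "Poly_Mapping.keys x \<noteq> {}" by simp
  define size where "size c = card (fst (SOME p. p \<in> c))" for c :: "('g, 'a) pair_class"
  have size: "size (pair_class G U \<phi>) = card U" if "U \<subseteq> carrier G" for U and \<phi> :: "'g \<Rightarrow> 'a"
    using pair_class_rep[of U \<phi>] card_conj_set that by (auto simp: size_def)
  obtain c where c: "c \<in> Poly_Mapping.keys x" and max: "\<And>d. d \<in> Poly_Mapping.keys x \<Longrightarrow> size d \<le> size c"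
  proof -
    have "Max (size ` Poly_Mapping.keys x) \<in> size ` Poly_Mapping.keys x" using ne by (intro Max_in) auto
    then obtain c where c: "c \<in> Poly_Mapping.keys x" "size c = Max (size ` Poly_Mapping.keys x)" by auto
    show ?thesis by (rule that[OF c(1)]) (simp add: c(2))
  qed
  obtain U \<phi> where p: "(U, \<phi>) \<in> pairs G A" and cU: "c = pair_class G U \<phi>"
    using fburn_key_basis[OF x c] by metis
  note U = pairsD[OF p]
  let ?\<delta> = "delta \<phi> :: _ \<Rightarrow> 'k"
  have "fburn_mark G U ?\<delta> x = 0"
  proof -
    let ?D = "dual (G \<restriction> U) A"
    have "(\<Sum>\<psi>\<in>carrier ?D. fburn_mark G U (delta \<psi>) x * \<Phi> \<psi>) = 0"
      if "\<Phi> \<in> characters ?D" for \<Phi>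
      using mark_expand[OF x U(1), of \<Phi>] zero[of U \<Phi>] that U(1) by (simp add: XX_iff)
    then show ?thesis
      by (rule characters_separate[OF dual_restr_group[OF U(1)] finite_dual[OF U(1)] splitting_dual[OF U(1)] _ U(2)])
  qed
  moreover have "fburn_mark G U ?\<delta> x = Poly_Mapping.lookup x c * fburn_mark G U ?\<delta> (basis G U \<phi>)"
  proof -
    have "fburn_mark G U ?\<delta> (Poly_Mapping.single d 1) = 0" if d: "d \<in> Poly_Mapping.keys x" "d \<noteq> c" for d
    proof -
      obtain V \<psi> where q: "(V, \<psi>) \<in> pairs G A" and dV: "d = pair_class G V \<psi>"
        and s: "Poly_Mapping.single d (1::'k) = basis G V \<psi>"
        using fburn_key_basis[OF x d(1)] by metis
      have "card V \<le> card U" using max[OF d(1)] size pairsD(3)[OF q] U(3) unfolding cU dV by simp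
      then have "point_mark G U ?\<delta> V \<psi> a = 0" if "a \<in> carrier G" for a
        using basis_eq_of_point_mark[OF p q _ that] d(2) unfolding cU dV by blast
      then show ?thesis by (simp add: s mark_basis[OF q U(1)])
    qed
    then have "fburn_mark G U ?\<delta> x = (\<Sum>d\<in>{c}. Poly_Mapping.lookup x d * fburn_mark G U ?\<delta> (Poly_Mapping.single d 1))"
      unfolding linform_expand[OF linear_mark, of G U ?\<delta> x] using c
      by (intro sum.mono_neutral_right) auto
    then show ?thesis by (simp add: cU basis_def)
  qed
  moreover have "fburn_mark G U ?\<delta> (basis G U \<phi>) \<noteq> 0"
  proof -
    let ?S = "{a \<in> carrier G. point_mark G U ?\<delta> U \<phi> a \<noteq> 0}"
    have "(\<Sum>a\<in>carrier G. point_mark G U ?\<delta> U \<phi> a) = (\<Sum>a\<in>?S. 1)"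
      using fin by (intro sum.mono_neutral_cong_right) (auto simp: point_mark_def split: if_splits)
    moreover have "\<one> \<in> ?S"
      using U by (simp add: point_mark_def conj_fun_one extensional_restrict)
    ultimately show ?thesis using fin card_subgroup[OF U(1)] by (auto simp: mark_basis[OF p U(1)])
  qed
  ultimately show False using c by (simp add: in_keys_iff)
qed

lemma marks_eqI:
  fixes x y :: "('g, 'a, 'k) fburn"
  assumes "x \<in> fburn_carrier G A" "y \<in> fburn_carrier G A"
    and "\<And>H \<Phi>. (H, \<Phi>) \<in> XX G A \<Longrightarrow> fburn_mark G H \<Phi> x = fburn_mark G H \<Phi> y"
  shows "x = y"
  using marks_injective[OF fburn_carrier_diff[OF assms(1,2)]] assms(3)
  by (simp add: linform_diff[OF linear_mark])

lemma finite_XX: "finite (XX G A :: ('g set \<times> (('g \<Rightarrow> 'a) \<Rightarrow> 'k)) set)"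
proof -
  have "XX G A \<subseteq> (SIGMA H:{H. subgroup H G}. (characters (dual (G \<restriction> H) A) :: (('g \<Rightarrow> 'a) \<Rightarrow> 'k) set))"
    by (auto simp: XX_iff)
  moreover have "finite {H. subgroup H G}"
    by (rule finite_subset[of _ "Pow (carrier G)"]) (auto simp: fin dest: subgroup.subset)
  moreover have "finite (characters (dual (G \<restriction> H) A) :: (('g \<Rightarrow> 'a) \<Rightarrow> 'k) set)" if "subgroup H G" for H
    using finite_characters[OF comm_group.axioms(2)[OF dual_restr_group[OF that]] finite_dual[OF that]] .
  ultimately show ?thesis by (intro finite_subset[OF _ finite_SigmaI]) auto
qed

text \<open>If \<open>|L| \<ge> |H|\<close>, then \<open>L \<le> \<^sup>aH\<close> forces \<open>L = \<^sup>aH\<close>, and the orthogonality relation between \<open>\<Phi>\<close>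
  and the conjugate of \<open>\<Psi>\<close> by \<open>a\<^sup>-\<^sup>1\<close> decides whether \<open>a\<close> contributes.\<close>

lemma mark_fourier_element:
  fixes \<Phi> \<Psi> :: "('g \<Rightarrow> 'a) \<Rightarrow> 'k"
  assumes H: "(H, \<Phi>) \<in> XX G A" and K: "(L, \<Psi>) \<in> XX G A" and card: "card H \<le> card L"
  shows "fburn_mark G L \<Psi> (\<Sum>\<phi>\<in>carrier (dual (G \<restriction> H) A). inverse (\<Phi> \<phi>) *\<^sub>K basis G H \<phi>)
     = of_nat (card (carrier (dual (G \<restriction> H) A)))
       * of_nat (card {a \<in> carrier G. L = conj_set G a H \<and> \<Psi> = conj_char G A a H \<Phi>}) / of_nat (card H)"
proof -
  have Hs: "subgroup H G" and \<Phi>: "\<Phi> \<in> characters (dual (G \<restriction> H) A)" using H by (auto simp: XX_iff)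
  have Ls: "subgroup L G" and \<Psi>: "\<Psi> \<in> characters (dual (G \<restriction> L) A)" using K by (auto simp: XX_iff)
  have Hc: "H \<subseteq> carrier G" using Hs by (rule subgroup.subset)
  let ?D = "dual (G \<restriction> H) A"
  interpret D: comm_group ?D by (rule dual_restr_group[OF Hs])
  \<comment> \<open>The contribution of a single \<open>a\<close>: transporting \<open>\<Psi>\<close> back to \<open>H\<close> turns the sum over \<open>\<phi>\<close> into an
    orthogonality relation.\<close>
  have inner: "(\<Sum>\<phi>\<in>carrier ?D. inverse (\<Phi> \<phi>) * point_mark G L \<Psi> H \<phi> a)
     = (if L = conj_set G a H \<and> \<Psi> = conj_char G A a H \<Phi> then of_nat (card (carrier ?D)) else 0)"
    if a: "a \<in> carrier G" for a
  proof (cases "L = conj_set G a H")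
    case False
    have "finite (conj_set G a H)" using finite_subgroup conj_set_subgroup[OF Hs a] by blast
    then have "\<not> L \<subseteq> conj_set G a H" using False card card_conj_set[OF a Hc] card_seteq by metis
    then show ?thesis using False by (simp add: point_mark_def)
  next
    case True
    define \<Psi>' where "\<Psi>' = conj_char G A (inv a) L \<Psi>"
    have inv: "conj_set G (inv a) L = H" using True a Hc by (simp add: conj_set_conj_set)
    have \<Psi>'c: "\<Psi>' \<in> characters ?D"
      using XX_conj[OF K inv_closed[OF a]] inv by (simp add: XX_iff \<Psi>'_def)
    have \<Psi>'a: "conj_char G A a H \<Psi>' = \<Psi>"
      using conj_char_conj_char[OF Ls a inv_closed[OF a], of \<Psi>] inv a conj_char_one[OF K] by (simp add: \<Psi>'_def)
    have "point_mark G L \<Psi> H \<phi> a = \<Psi>' \<phi>" if "\<phi> \<in> carrier ?D" for \<phi>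
      using True conj_char_conj_fun[OF Hs a that, of \<Psi>'] \<Psi>'a
      by (simp add: point_mark_def extensional_restrict)
    then have "(\<Sum>\<phi>\<in>carrier ?D. inverse (\<Phi> \<phi>) * point_mark G L \<Psi> H \<phi> a)
        = (if \<Phi> = \<Psi>' then of_nat (card (carrier ?D)) else 0)"
      using character_orthogonality[OF D.is_group \<Phi> \<Psi>'c] by simp
    moreover have "\<Phi> = \<Psi>' \<longleftrightarrow> \<Psi> = conj_char G A a H \<Phi>"
    proof
      assume "\<Psi> = conj_char G A a H \<Phi>"
      then have "\<Psi>' = conj_char G A (inv a \<otimes> a) H \<Phi>"
        using conj_char_conj_char[OF Hs inv_closed[OF a] a, of \<Phi>] True by (simp add: \<Psi>'_def)
      then show "\<Phi> = \<Psi>'" using a conj_char_one[OF H] by simp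
    qed (use \<Psi>'a in simp)
    ultimately show ?thesis using True by simp
  qed
  have p: "(H, \<phi>) \<in> pairs G A" if "\<phi> \<in> carrier ?D" for \<phi> using that Hs by (simp add: pairs_def)
  have mb: "fburn_mark G L \<Psi> (basis G H \<phi>) = (\<Sum>a\<in>carrier G. point_mark G L \<Psi> H \<phi> a) / of_nat (card H)"
    if "\<phi> \<in> carrier ?D" for \<phi> by (rule mark_basis[OF p[OF that] Ls])
  have "fburn_mark G L \<Psi> (\<Sum>\<phi>\<in>carrier ?D. inverse (\<Phi> \<phi>) *\<^sub>K basis G H \<phi>)
      = (\<Sum>\<phi>\<in>carrier ?D. inverse (\<Phi> \<phi>) * ((\<Sum>a\<in>carrier G. point_mark G L \<Psi> H \<phi> a) / of_nat (card H)))"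
    by (simp add: linform_sum[OF linear_mark] linform_scal[OF linear_mark] mb)
  also have "\<dots> = (\<Sum>a\<in>carrier G. \<Sum>\<phi>\<in>carrier ?D. inverse (\<Phi> \<phi>) * point_mark G L \<Psi> H \<phi> a) / of_nat (card H)"
    by (subst sum.swap) (simp add: sum_divide_distrib sum_distrib_left)
  also have "(\<Sum>a\<in>carrier G. \<Sum>\<phi>\<in>carrier ?D. inverse (\<Phi> \<phi>) * point_mark G L \<Psi> H \<phi> a)
      = (\<Sum>a\<in>{a \<in> carrier G. L = conj_set G a H \<and> \<Psi> = conj_char G A a H \<Phi>}. of_nat (card (carrier ?D)))"
    unfolding sum.inter_filter[OF fin] by (rule sum.cong[OF refl inner])
  finally show ?thesis by simp
qed

text \<open>Induction on \<open>|H|\<close>. The normalised Fourier element \<open>z\<close> has the required marks at subgroups of order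
  at least \<open>|H|\<close>. Its marks at smaller subgroups are removed with the elements given by the induction
  hypothesis; these are summed over all smaller pairs rather than over representatives of their
  conjugacy classes, which is compensated by dividing by the size \<open>N\<close> of the class.\<close>

theorem idem_exists:
  assumes "(H, \<Phi> :: ('g \<Rightarrow> 'a) \<Rightarrow> 'k) \<in> XX G A"
  shows "\<exists>e \<in> fburn_carrier G A. \<forall>(L, \<Psi>)\<in>XX G A.
    fburn_mark G L \<Psi> e = (if conjugate_pairs G A H \<Phi> L \<Psi> then 1 else 0)"
  using assms
proof (induction "card H" arbitrary: H \<Phi> rule: less_induct)
  case less
  note H = less.prems
  have Hs: "subgroup H G" and \<Phi>: "\<Phi> \<in> characters (dual (G \<restriction> H) A)" using H by (auto simp: XX_iff)
  let ?D = "dual (G \<restriction> H) A"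
  let ?X = "XX G A :: ('g set \<times> (('g \<Rightarrow> 'a) \<Rightarrow> 'k)) set"
  interpret D: comm_group ?D by (rule dual_restr_group[OF Hs])
  define y where "y = (\<Sum>\<phi>\<in>carrier ?D. inverse (\<Phi> \<phi>) *\<^sub>K basis G H \<phi>)"
  have y: "y \<in> fburn_carrier G A" unfolding y_def
    using Hs by (intro fburn_carrier_sum fburn_carrier_scal basis_carrier) (simp add: pairs_def)
  \<comment> \<open>The mark of \<open>y\<close> is constant on the conjugacy class of \<open>(H, \<Phi>)\<close>, so one scalar normalises them all.\<close>
  define c where "c = fburn_mark G H \<Phi> y"
  have c0: "c \<noteq> 0"
  proof -
    obtain a where "a \<in> {a \<in> carrier G. H = conj_set G a H \<and> \<Phi> = conj_char G A a H \<Phi>}"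
      using conjugate_refl[OF H] by (auto simp: conjugate_pairs_def)
    then have "card {a \<in> carrier G. H = conj_set G a H \<and> \<Phi> = conj_char G A a H \<Phi>} \<noteq> 0"
      using fin by auto
    moreover have "card (carrier ?D) \<noteq> 0" using finite_dual[OF Hs] D.one_closed by (metis card_0_eq empty_iff)
    ultimately show ?thesis unfolding c_def y_def
      using mark_fourier_element[OF H H] card_subgroup[OF Hs] by simp
  qed
  define z where "z = inverse c *\<^sub>K y"
  have z: "z \<in> fburn_carrier G A" unfolding z_def by (rule fburn_carrier_scal[OF y])
  have zmark: "fburn_mark G L \<Psi> z = (if conjugate_pairs G A H \<Phi> L \<Psi> then 1 else 0)"
    if L: "(L, \<Psi>) \<in> ?X" "card H \<le> card L" for L \<Psi>
  proof (cases "conjugate_pairs G A H \<Phi> L \<Psi>")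
    case True
    then show ?thesis using mark_conjugate[OF y Hs True] c0
      by (simp add: z_def linform_scal[OF linear_mark] c_def)
  next
    case False
    then have emp: "{a \<in> carrier G. L = conj_set G a H \<and> \<Psi> = conj_char G A a H \<Phi>} = {}"
      by (auto simp: conjugate_pairs_def)
    have "fburn_mark G L \<Psi> y = 0" unfolding y_def mark_fourier_element[OF H L] emp by simp
    then show ?thesis using False by (simp add: z_def linform_scal[OF linear_mark])
  qed
  define small where "small = {p \<in> ?X. card (fst p) < card H}"
  have finsmall: "finite small" using finite_XX by (simp add: small_def)
  have "\<forall>p\<in>small. \<exists>e. e \<in> fburn_carrier G A \<and> (\<forall>(L, \<Psi>)\<in>?X.
      fburn_mark G L \<Psi> e = (if conjugate_pairs G A (fst p) (snd p) L \<Psi> then 1 else 0))"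
    using less.hyps by (auto simp: small_def Bex_def)
  then obtain E where E: "\<And>p. p \<in> small \<Longrightarrow> E p \<in> fburn_carrier G A"
    and Em: "\<And>p L \<Psi>. p \<in> small \<Longrightarrow> (L, \<Psi>) \<in> ?X \<Longrightarrow>
      fburn_mark G L \<Psi> (E p) = (if conjugate_pairs G A (fst p) (snd p) L \<Psi> then 1 else 0)"
    unfolding bchoice_iff by fast
  define N where "N p = card {q \<in> ?X. conjugate_pairs G A (fst q) (snd q) (fst p) (snd p)}" for p
  define w where "w p = fburn_mark G (fst p) (snd p) z / of_nat (N p)" for p
  define e where "e = z - (\<Sum>p\<in>small. w p *\<^sub>K E p)"
  have "e \<in> fburn_carrier G A" unfolding e_def
    using z E by (intro fburn_carrier_diff fburn_carrier_sum fburn_carrier_scal) auto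
  moreover have "fburn_mark G L \<Psi> e = (if conjugate_pairs G A H \<Phi> L \<Psi> then 1 else 0)"
    if L: "(L, \<Psi>) \<in> ?X" for L \<Psi>
  proof -
    let ?O = "{q \<in> ?X. conjugate_pairs G A (fst q) (snd q) L \<Psi>}"
    have Ls: "subgroup L G" using L by (simp add: XX_iff)
    have cardO: "card (fst q) = card L" if "q \<in> ?O" for q
    proof -
      obtain M \<Theta> where qq: "q = (M, \<Theta>)" by (cases q)
      then have "M \<subseteq> carrier G" using that by (auto simp: XX_iff dest: subgroup.subset)
      then show ?thesis using that card_conj_set by (auto simp: conjugate_pairs_def qq)
    qed
    \<comment> \<open>Only pairs conjugate to \<open>(L, \<Psi>)\<close> contribute to the correction.\<close>
    have me: "fburn_mark G L \<Psi> e = fburn_mark G L \<Psi> z - (\<Sum>p\<in>small. w p * (if p \<in> ?O then 1 else 0))"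
      unfolding e_def
      by (auto simp: linform_diff[OF linear_mark] linform_sum[OF linear_mark]
        linform_scal[OF linear_mark] Em[OF _ L] small_def intro!: sum.cong)
    show ?thesis
    proof (cases "card L < card H")
      case False
      have "(\<Sum>p\<in>small. w p * (if p \<in> ?O then 1 else 0)) = 0"
        using cardO False by (intro sum.neutral) (auto simp: small_def)
      then show ?thesis using me zmark[OF L] False by simp
    next
      case True
      have sub: "?O \<subseteq> small" using cardO True by (auto simp: small_def)
      have wO: "w p = fburn_mark G L \<Psi> z / of_nat (card ?O)" if p: "p \<in> ?O" for p
      proof -
        have px: "(fst p, snd p) \<in> ?X" and pc: "conjugate_pairs G A (fst p) (snd p) L \<Psi>" using p by auto
        have ps: "subgroup (fst p) G" using px unfolding XX_iff by blast
        have "{q \<in> ?X. conjugate_pairs G A (fst q) (snd q) (fst p) (snd p)} = ?O"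
          using conjugate_trans conjugate_sym[OF px pc] pc by auto
        then show ?thesis using mark_conjugate[OF z ps pc] by (simp add: w_def N_def)
      qed
      have "(\<Sum>p\<in>small. w p * (if p \<in> ?O then 1 else 0)) = (\<Sum>p\<in>?O. w p)"
        using sub finsmall by (intro sum.mono_neutral_cong_right) auto
      also have "\<dots> = of_nat (card ?O) * (fburn_mark G L \<Psi> z / of_nat (card ?O))" using wO by simp
      also have "\<dots> = fburn_mark G L \<Psi> z"
      proof -
        have "(L, \<Psi>) \<in> ?O" using L conjugate_refl[OF L] by simp
        then have "card ?O \<noteq> 0" using finite_subset[OF sub finsmall] by auto
        then show ?thesis by simp
      qed
      finally have "fburn_mark G L \<Psi> e = 0" using me by simp
      moreover have "\<not> conjugate_pairs G A H \<Phi> L \<Psi>" using cardO[of "(H, \<Phi>)"] H True by auto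
      ultimately show ?thesis by simp
    qed
  qed
  ultimately show ?case by blast
qed

text \<open>The marks \<open>0\<close> and \<open>1\<close> are idempotent, so multiplicativity and injectivity make \<open>e\<close> an idempotent;
  injectivity also makes it the only candidate.\<close>

theorem fburn_idem_eqI:
  fixes e :: "('g, 'a, 'k) fburn"
  assumes H: "(H, \<Phi>) \<in> XX G A" and e: "e \<in> fburn_carrier G A"
    and m: "\<And>L \<Psi>. (L, \<Psi>) \<in> XX G A \<Longrightarrow>
      fburn_mark G L \<Psi> e = (if conjugate_pairs G A H \<Phi> L \<Psi> then 1 else 0)"
  shows "fburn_idem G A H \<Phi> = e"
  unfolding fburn_idem_def
proof (rule the_equality)
  have eq: "(\<exists>g\<in>carrier G. (L, \<Psi>) = (conj_set G g H, conj_char G A g H \<Phi>)) \<longleftrightarrow> conjugate_pairs G A H \<Phi> L \<Psi>"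
    for L \<Psi> by (auto simp: conjugate_pairs_def)
  have "fburn_mult G A e e = e"
    using m by (intro marks_eqI fburn_mult_carrier e) (auto simp: mark_mult[OF _ e e])
  then show "e \<in> fburn_carrier G A \<and> fburn_mult G A e e = e \<and>
     (\<forall>(K, \<Psi>)\<in>XX G A. fburn_mark G K \<Psi> e =
        (if \<exists>g\<in>carrier G. (K, \<Psi>) = (conj_set G g H, conj_char G A g H \<Phi>) then 1 else 0))"
    unfolding eq using e m by auto
  fix e' :: "('g, 'a, 'k) fburn"
  assume "e' \<in> fburn_carrier G A \<and> fburn_mult G A e' e' = e' \<and>
     (\<forall>(K, \<Psi>)\<in>XX G A. fburn_mark G K \<Psi> e' =
        (if \<exists>g\<in>carrier G. (K, \<Psi>) = (conj_set G g H, conj_char G A g H \<Phi>) then 1 else 0))"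
  then show "e' = e" unfolding eq using m e by (intro marks_eqI) auto
qed

lemma fburn_idem_props:
  assumes H: "(H, \<Phi> :: ('g \<Rightarrow> 'a) \<Rightarrow> 'k) \<in> XX G A"
  shows "fburn_idem G A H \<Phi> \<in> fburn_carrier G A"
    and "(L, \<Psi>) \<in> XX G A \<Longrightarrow> fburn_mark G L \<Psi> (fburn_idem G A H \<Phi>)
      = (if conjugate_pairs G A H \<Phi> L \<Psi> then 1 else 0)"
proof -
  obtain e where e: "e \<in> fburn_carrier G A" and m: "\<forall>(L, \<Psi>)\<in>XX G A.
    fburn_mark G L \<Psi> e = (if conjugate_pairs G A H \<Phi> L \<Psi> then 1 else 0)"
    using idem_exists[OF H] by blast
  have "fburn_idem G A H \<Phi> = e" using m by (intro fburn_idem_eqI[OF H e]) auto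
  then show "fburn_idem G A H \<Phi> \<in> fburn_carrier G A"
    "(L, \<Psi>) \<in> XX G A \<Longrightarrow> fburn_mark G L \<Psi> (fburn_idem G A H \<Phi>)
      = (if conjugate_pairs G A H \<Phi> L \<Psi> then 1 else 0)"
    using e m by auto
qed

end

section \<open>Transport along isomorphisms\<close>

lemma dual_map_iso:
  fixes f :: "'g \<Rightarrow> 'h"
  assumes D: "group D" and E: "group E" and f: "f \<in> iso D E"
  shows "dual_map D f \<in> iso (dual E A) (dual D A)"
proof -
  interpret D: group D by fact
  interpret E: group E by fact
  have hom: "f \<in> hom D E" and bij: "bij_betw f (carrier D) (carrier E)" using f by (auto simp: iso_def)
  have cl: "f x \<in> carrier E" if "x \<in> carrier D" for x using hom that by (auto simp: hom_def)
  define g where "g = inv_into (carrier D) f"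
  have g: "g \<in> hom E D" using D.iso_set_sym[OF f] by (simp add: g_def iso_def)
  have gcl: "g y \<in> carrier D" if "y \<in> carrier E" for y using g that by (auto simp: hom_def)
  have gf: "g (f x) = x" if "x \<in> carrier D" for x
    using bij that by (simp add: g_def bij_betw_def)
  have fg: "f (g y) = y" if "y \<in> carrier E" for y
    using bij that by (auto simp: g_def bij_betw_def f_inv_into_f)
  have c1: "dual_map D f \<mu> \<in> carrier (dual D A)" if "\<mu> \<in> carrier (dual E A)" for \<mu>
    using that hom by (auto simp: dual_map_def dual_def compose_def hom_def Pi_iff)
  have c2: "dual_map E g \<nu> \<in> carrier (dual E A)" if "\<nu> \<in> carrier (dual D A)" for \<nu>
    using that g by (auto simp: dual_map_def dual_def compose_def hom_def Pi_iff)
  show ?thesis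
  proof (rule isoI)
    show "dual_map D f \<in> hom (dual E A) (dual D A)"
    proof (rule homI)
      fix \<mu> \<nu>
      show "dual_map D f (\<mu> \<otimes>\<^bsub>dual E A\<^esub> \<nu>) = dual_map D f \<mu> \<otimes>\<^bsub>dual D A\<^esub> dual_map D f \<nu>"
        by (auto simp: dual_map_def dual_def compose_def cl intro!: restrict_ext)
    qed (rule c1)
    show "bij_betw (dual_map D f) (carrier (dual E A)) (carrier (dual D A))"
    proof (rule bij_betw_byWitness[where f' = "dual_map E g"])
      show "\<forall>\<mu>\<in>carrier (dual E A). dual_map E g (dual_map D f \<mu>) = \<mu>"
        by (auto simp: dual_map_def dual_def compose_def gcl fg intro!: extensionalityI[of _ "carrier E"])
      show "\<forall>\<nu>\<in>carrier (dual D A). dual_map D f (dual_map E g \<nu>) = \<nu>"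
        by (auto simp: dual_map_def dual_def compose_def cl gf intro!: extensionalityI[of _ "carrier D"])
    qed (use c1 c2 in auto)
  qed
qed

lemma dual_transfer:
  assumes A: "comm_group A" and D: "group D" and E: "group E" and f: "f \<in> iso D E"
    and fin: "finite (carrier (dual D A))" and split: "splitting_field TYPE('k::field) (dual D A)"
  shows "finite (carrier (dual E A))" "splitting_field TYPE('k) (dual E A)"
proof -
  have i: "dual_map D f \<in> iso (dual E A) (dual D A)" by (rule dual_map_iso[OF D E f])
  show "finite (carrier (dual E A))"
    using i fin by (auto simp: iso_def dest: bij_betw_finite)
  show "splitting_field TYPE('k) (dual E A)"
    using comm_group.axioms(2)[OF dual_group[OF A D]] comm_group.axioms(2)[OF dual_group[OF A E]]
    by (intro splitting_field_iso[OF i _ _ split])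
qed

text \<open>Subquotients by the trivial subgroup are the subgroups themselves, up to the canonical isomorphism.\<close>

lemma split_fibered_groupI:
  fixes A :: "'a monoid" and G :: "'g monoid"
  assumes "comm_group A" and "group G" and "finite (carrier G)"
    and hyp: "\<And>U N. subgroup U G \<Longrightarrow> N \<lhd> (G \<restriction> U) \<Longrightarrow>
           finite (carrier (dual ((G \<restriction> U) Mod N) A)) \<and>
           splitting_field TYPE('k::field_char_0) (dual ((G \<restriction> U) Mod N) A)"
  shows "split_fibered_group G A TYPE('k)"
proof -
  interpret A: comm_group A by fact
  interpret G: group G by fact
  have d: "finite (carrier (dual (G \<restriction> U) A)) \<and> splitting_field TYPE('k) (dual (G \<restriction> U) A)"
    if U: "subgroup U G" for U
  proof -
    interpret U: group "G \<restriction> U" by (rule subgroup.subgroup_is_group[OF U G.is_group])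
    have N: "{\<one>\<^bsub>G \<restriction> U\<^esub>} \<lhd> G \<restriction> U" by (rule U.one_is_normal)
    show ?thesis
      using hyp[OF U N] dual_transfer[OF A.comm_group_axioms normal.factorgroup_is_group[OF N] U.is_group U.trivial_factor_iso]
      by blast
  qed
  show ?thesis
    by unfold_locales (use assms(3) d in auto)
qed

locale fibered_iso = S: fibered_group G A + T: fibered_group G' A
  for G :: "'g monoid" and G' :: "'h monoid" and A :: "'a monoid" +
  fixes f :: "'g \<Rightarrow> 'h"
  assumes iso: "f \<in> iso G G'"
begin

definition transport :: "'g set \<Rightarrow> ('g \<Rightarrow> 'a) \<Rightarrow> ('h \<Rightarrow> 'a)" where
  "transport U \<phi> = (\<lambda>y\<in>f ` U. \<phi> (inv_into (carrier G) f y))"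

lemma f_closed [simp]: "x \<in> carrier G \<Longrightarrow> f x \<in> carrier G'"
  using iso by (auto simp: iso_def hom_def)

lemma f_image: "f ` carrier G = carrier G'"
  using iso by (auto simp: iso_def bij_betw_def)

lemma f_inj: "inj_on f (carrier G)"
  using iso by (auto simp: iso_def bij_betw_def)

lemma f_hom: "group_hom G G' f"
  using iso by (simp add: group_hom_def group_hom_axioms_def iso_def)

lemma transport_apply: "\<lbrakk>U \<subseteq> carrier G; x \<in> U\<rbrakk> \<Longrightarrow> transport U \<phi> (f x) = \<phi> x"
  using f_inj by (simp add: transport_def subset_iff)

lemma transport_extensional [simp]: "transport U \<phi> \<in> extensional (f ` U)"
  by (simp add: transport_def)

lemma transport_eqI:
  assumes "U \<subseteq> carrier G" "\<psi> \<in> extensional (f ` U)" "\<And>x. x \<in> U \<Longrightarrow> \<psi> (f x) = \<phi> x"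
  shows "transport U \<phi> = \<psi>"
  using assms by (intro extensionalityI[OF transport_extensional assms(2)]) (auto simp: transport_apply)

lemma image_subgroup: "subgroup U G \<Longrightarrow> subgroup (f ` U) G'"
  using group_hom.subgroup_img_is_subgroup[OF f_hom] .

lemma subgroup_image:
  assumes "subgroup V G'" obtains U where "subgroup U G" "V = f ` U"
proof
  have g: "inv_into (carrier G) f \<in> iso G' G" by (rule S.iso_set_sym[OF iso])
  then have "group_hom G' G (inv_into (carrier G) f)"
    by (simp add: group_hom_def group_hom_axioms_def iso_def)
  then show "subgroup (inv_into (carrier G) f ` V) G" using assms by (rule group_hom.subgroup_img_is_subgroup)
  show "V = f ` inv_into (carrier G) f ` V"
    using subgroup.subset[OF assms] f_image by (simp add: image_inv_into_cancel)
qed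

lemma iso_restr: "subgroup U G \<Longrightarrow> f \<in> iso (G \<restriction> U) (G' \<restriction> (f ` U))"
  using iso subgroup.subset[of U G]
  by (auto simp: iso_def hom_def bij_betw_def inj_on_subset subset_iff)

lemma transport_dual:
  assumes U: "subgroup U G" and \<phi>: "\<phi> \<in> carrier (dual (G \<restriction> U) A)"
  shows "transport U \<phi> \<in> carrier (dual (G' \<restriction> (f ` U)) A)"
proof -
  have Us: "U \<subseteq> carrier G" using U by (rule subgroup.subset)
  have m: "f x \<otimes>\<^bsub>G'\<^esub> f y = f (x \<otimes>\<^bsub>G\<^esub> y)" if "x \<in> U" "y \<in> U" for x y
    using that Us group_hom.hom_mult[OF f_hom] by (simp add: subset_iff)
  have "x \<otimes>\<^bsub>G\<^esub> y \<in> U" if "x \<in> U" "y \<in> U" for x y using subgroup.m_closed[OF U that] .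
  then show ?thesis using \<phi> Us by (auto simp: dual_def hom_def m transport_apply)
qed

lemma dual_map_iso_restr:
  assumes U: "subgroup U G"
  shows "dual_map (G \<restriction> U) f \<in> iso (dual (G' \<restriction> (f ` U)) A) (dual (G \<restriction> U) A)"
  by (rule dual_map_iso[OF subgroup.subgroup_is_group[OF U S.is_group]
        subgroup.subgroup_is_group[OF image_subgroup[OF U] T.is_group] iso_restr[OF U]])

lemma dual_map_dual:
  assumes U: "subgroup U G" and \<psi>: "\<psi> \<in> carrier (dual (G' \<restriction> (f ` U)) A)"
  shows "dual_map (G \<restriction> U) f \<psi> \<in> carrier (dual (G \<restriction> U) A)"
    and "transport U (dual_map (G \<restriction> U) f \<psi>) = \<psi>"
proof -
  have Us: "U \<subseteq> carrier G" using U by (rule subgroup.subset)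
  show "dual_map (G \<restriction> U) f \<psi> \<in> carrier (dual (G \<restriction> U) A)"
    using dual_map_iso_restr[OF U] \<psi> by (auto simp: iso_def hom_def)
  show "transport U (dual_map (G \<restriction> U) f \<psi>) = \<psi>"
    using Us \<psi> by (intro transport_eqI) (auto simp: dual_map_def compose_def dual_def)
qed

lemma dual_map_transport:
  assumes U: "subgroup U G" and \<phi>: "\<phi> \<in> carrier (dual (G \<restriction> U) A)"
  shows "dual_map (G \<restriction> U) f (transport U \<phi>) = \<phi>"
  using \<phi> subgroup.subset[OF U]
  by (auto simp: dual_map_def compose_def transport_apply dual_def intro!: extensionalityI[of _ U])

lemma transport_pairs: "(U, \<phi>) \<in> pairs G A \<Longrightarrow> (f ` U, transport U \<phi>) \<in> pairs G' A"
  using image_subgroup transport_dual by (auto simp: pairs_def)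

lemma f_conj_map:
  "\<lbrakk>a \<in> carrier G; x \<in> carrier G\<rbrakk> \<Longrightarrow> f (conj_map G a x) = conj_map G' (f a) (f x)"
  using group_hom.hom_mult[OF f_hom] group_hom.hom_inv[OF f_hom] by (simp add: conj_map_def)

lemma f_conj_set:
  "\<lbrakk>a \<in> carrier G; U \<subseteq> carrier G\<rbrakk> \<Longrightarrow> f ` conj_set G a U = conj_set G' (f a) (f ` U)"
  by (auto simp: conj_set_def image_image f_conj_map subset_iff intro!: image_cong)

lemma transport_conj_fun:
  assumes a: "a \<in> carrier G" and U: "U \<subseteq> carrier G"
  shows "conj_fun G' (f a) (f ` U) (transport U \<phi>) = transport (conj_set G a U) (conj_fun G a U \<phi>)"
proof (rule T.conj_fun_eqI)
  show "f ` U \<subseteq> carrier G'" using U by auto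
  show "transport (conj_set G a U) (conj_fun G a U \<phi>) \<in> extensional (conj_set G' (f a) (f ` U))"
    using f_conj_set[OF a U] by (metis transport_extensional)
  fix y assume "y \<in> f ` U"
  then obtain x where x: "x \<in> U" "y = f x" by blast
  then have "conj_map G' (f a) y = f (conj_map G a x)" using f_conj_map a U by auto
  moreover have "conj_map G a x \<in> conj_set G a U" using x by (simp add: conj_set_def)
  ultimately show "transport (conj_set G a U) (conj_fun G a U \<phi>) (conj_map G' (f a) y) = transport U \<phi> y"
    using x a U S.conj_set_closed[OF a U] by (simp add: transport_apply)
qed (use a in simp)

text \<open>Transported conjugates of a pair are conjugates of the transported pair, so the formula on
  representatives is constant on classes.\<close>

lemma iso_basis:
  assumes p: "(U, \<phi>) \<in> pairs G A"
  shows "fburn_iso G G' f (basis G U \<phi>) = basis G' (f ` U) (transport U \<phi>)"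
  unfolding fburn_iso_def transport_def[symmetric]
proof (rule S.lin_ext_basis)
  fix a assume a: "a \<in> carrier G"
  note U = pairsD[OF p]
  have "pair_class G' (f ` conj_set G a U) (transport (conj_set G a U) (conj_fun G a U \<phi>))
      = pair_class G' (f ` U) (transport U \<phi>)"
    using T.pair_class_conj[OF transport_pairs[OF p] f_closed[OF a]]
    by (simp add: f_conj_set[OF a U(3)] transport_conj_fun[OF a U(3)])
  then show "basis G' (f ` conj_set G a U) (transport (conj_set G a U) (conj_fun G a U \<phi>))
      = basis G' (f ` U) (transport U \<phi>)" by (simp add: basis_def)
qed

text \<open>\<open>pull_char\<close> and \<open>push_char\<close> are mutually inverse transports of functions on dual groups; the second is
  written as in the formula for the image of an idempotent.\<close>

definition pull_char :: "'g set \<Rightarrow> (('h \<Rightarrow> 'a) \<Rightarrow> 'k) \<Rightarrow> (('g \<Rightarrow> 'a) \<Rightarrow> 'k)" where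
  "pull_char M \<Psi> = (\<lambda>\<phi>\<in>carrier (dual (G \<restriction> M) A). \<Psi> (transport M \<phi>))"

lemma point_mark_iso:
  assumes p: "(U, \<phi>) \<in> pairs G A" and M: "subgroup M G" and a: "a \<in> carrier G"
  shows "point_mark G' (f ` M) \<Psi> (f ` U) (transport U \<phi>) (f a) = point_mark G M (pull_char M \<Psi>) U \<phi> a"
proof -
  note U = pairsD[OF p]
  have Ms: "M \<subseteq> carrier G" using M by (rule subgroup.subset)
  have aU: "conj_set G a U \<subseteq> carrier G" by (rule S.conj_set_closed[OF a U(3)])
  have inc: "f ` M \<subseteq> conj_set G' (f a) (f ` U) \<longleftrightarrow> M \<subseteq> conj_set G a U"
    unfolding f_conj_set[OF a U(3), symmetric] using f_inj Ms aU by (auto simp: inj_on_def) blast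
  show ?thesis
  proof (cases "M \<subseteq> conj_set G a U")
    case True
    have "restrict (conj_fun G' (f a) (f ` U) (transport U \<phi>)) (f ` M)
        = transport M (restrict (conj_fun G a U \<phi>) M)"
      unfolding transport_conj_fun[OF a U(3)]
      using Ms aU True by (intro transport_eqI[symmetric]) (auto simp: transport_apply subset_iff)
    then show ?thesis using True inc S.restrict_conj_dual[OF p a M True]
      by (simp add: point_mark_def pull_char_def)
  qed (simp add: point_mark_def inc)
qed

lemma linear_iso: "linmap (fburn_iso G G' f)"
  unfolding fburn_iso_def by (rule linear_lin_ext)

text \<open>The isomorphism is a bijection between the summation variables of \<open>mark_basis\<close> on both sides.\<close>

lemma mark_iso:
  fixes x :: "('g, 'a, 'k::field_char_0) fburn"
  assumes x: "x \<in> fburn_carrier G A" and M: "subgroup M G"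
  shows "fburn_mark G' (f ` M) \<Psi> (fburn_iso G G' f x) = fburn_mark G M (pull_char M \<Psi>) x"
proof (rule linform_eq_on_carrier[where T = "\<lambda>x. fburn_mark G' (f ` M) \<Psi> (fburn_iso G G' f x)", OF _ linear_mark x])
  show "linform (\<lambda>x. fburn_mark G' (f ` M) \<Psi> (fburn_iso G G' f x))"
    by (rule linformI) (simp_all add: linmap_add[OF linear_iso] linmap_scal[OF linear_iso]
        mark_linear)
  fix U \<phi> assume p: "(U, \<phi>) \<in> pairs G A"
  have "(\<Sum>b\<in>carrier G'. point_mark G' (f ` M) \<Psi> (f ` U) (transport U \<phi>) b)
      = (\<Sum>a\<in>carrier G. point_mark G M (pull_char M \<Psi>) U \<phi> a)"
    unfolding f_image[symmetric] sum.reindex[OF f_inj] comp_def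
    by (rule sum.cong[OF refl]) (rule point_mark_iso[OF p M])
  moreover have "card (f ` U) = card U"
    using card_image inj_on_subset[OF f_inj pairsD(3)[OF p]] by blast
  ultimately show "fburn_mark G' (f ` M) \<Psi> (fburn_iso G G' f (basis G U \<phi>))
      = fburn_mark G M (pull_char M \<Psi>) (basis G U \<phi>)"
    by (simp add: iso_basis[OF p] S.mark_basis[OF p M] T.mark_basis[OF transport_pairs[OF p] image_subgroup[OF M]])
qed

lemma transport_mult:
  assumes U: "U \<subseteq> carrier G"
  shows "transport U (\<phi> \<otimes>\<^bsub>dual (G \<restriction> U) A\<^esub> \<psi>) = transport U \<phi> \<otimes>\<^bsub>dual (G' \<restriction> (f ` U)) A\<^esub> transport U \<psi>"
  using U by (intro transport_eqI) (auto simp: dual_def transport_apply)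

lemma pull_char_XX:
  assumes "(f ` M, \<Psi>) \<in> XX G' A" and M: "subgroup M G"
  shows "(M, pull_char M \<Psi>) \<in> XX G A"
proof -
  have \<Psi>: "\<Psi> \<in> characters (dual (G' \<restriction> (f ` M)) A)" using assms by (simp add: XX_iff)
  note Ms = subgroup.subset[OF M]
  interpret DM: comm_group "dual (G \<restriction> M) A" by (rule S.dual_restr_group[OF M])
  have "pull_char M \<Psi> \<in> hom (dual (G \<restriction> M) A) field_units"
  proof (rule homI)
    fix \<phi> assume "\<phi> \<in> carrier (dual (G \<restriction> M) A)"
    then show "pull_char M \<Psi> \<phi> \<in> carrier field_units"
      using character_nonzero[OF \<Psi> transport_dual[OF M]] by (simp add: pull_char_def field_units_def)
  next
    fix \<phi> \<psi> assume "\<phi> \<in> carrier (dual (G \<restriction> M) A)" "\<psi> \<in> carrier (dual (G \<restriction> M) A)"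
    then show "pull_char M \<Psi> (\<phi> \<otimes>\<^bsub>dual (G \<restriction> M) A\<^esub> \<psi>)
        = pull_char M \<Psi> \<phi> \<otimes>\<^bsub>field_units\<^esub> pull_char M \<Psi> \<psi>"
      by (simp add: pull_char_def transport_mult[OF Ms] character_mult[OF \<Psi>] transport_dual[OF M] field_units_def)
  qed
  then show ?thesis using M by (simp add: XX_iff pull_char_def)
qed

definition push_char :: "'g set \<Rightarrow> (('g \<Rightarrow> 'a) \<Rightarrow> 'k) \<Rightarrow> (('h \<Rightarrow> 'a) \<Rightarrow> 'k)" where
  "push_char H \<Phi> = compose (carrier (dual (G' \<restriction> (f ` H)) A)) \<Phi> (dual_map (G \<restriction> H) f)"

lemma push_char_XX:
  assumes H: "(H, \<Phi>) \<in> XX G A"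
  shows "(f ` H, push_char H \<Phi>) \<in> XX G' A"
proof -
  have Hs: "subgroup H G" and \<Phi>: "\<Phi> \<in> characters (dual (G \<restriction> H) A)" using H by (auto simp: XX_iff)
  have i: "dual_map (G \<restriction> H) f \<in> hom (dual (G' \<restriction> (f ` H)) A) (dual (G \<restriction> H) A)"
    using dual_map_iso_restr[OF Hs] by (simp add: iso_def)
  interpret D: comm_group "dual (G' \<restriction> (f ` H)) A" by (rule T.dual_restr_group[OF image_subgroup[OF Hs]])
  have "push_char H \<Phi> \<in> hom (dual (G' \<restriction> (f ` H)) A) field_units"
    using i \<Phi> by (auto simp: hom_def push_char_def compose_def Pi_iff)
  then show ?thesis using image_subgroup[OF Hs] by (simp add: XX_iff push_char_def compose_def)
qed

lemma push_char_transport: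
  assumes "subgroup H G" "\<phi> \<in> carrier (dual (G \<restriction> H) A)"
  shows "push_char H \<Phi> (transport H \<phi>) = \<Phi> \<phi>"
  using transport_dual[OF assms] dual_map_transport[OF assms] by (simp add: push_char_def compose_def)

lemma conj_char_iso:
  assumes H: "subgroup H G" and a: "a \<in> carrier G"
    and \<Psi>: "\<Psi> \<in> extensional (carrier (dual (G' \<restriction> (f ` conj_set G a H)) A))"
  shows "\<Psi> = conj_char G' A (f a) (f ` H) (push_char H \<Phi>)
    \<longleftrightarrow> pull_char (conj_set G a H) \<Psi> = conj_char G A a H \<Phi>"
proof -
  note Hs = subgroup.subset[OF H]
  have aH: "subgroup (conj_set G a H) G" by (rule S.conj_set_subgroup[OF H a])
  have key: "pull_char (conj_set G a H) \<Psi> (conj_fun G a H \<phi>) = \<Psi> (conj_fun G' (f a) (f ` H) (transport H \<phi>))"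
    if "\<phi> \<in> carrier (dual (G \<restriction> H) A)" for \<phi>
    using S.conj_fun_dual[OF H a that] transport_conj_fun[OF a Hs] by (simp add: pull_char_def)
  show ?thesis
  proof
    assume eq: "\<Psi> = conj_char G' A (f a) (f ` H) (push_char H \<Phi>)"
    have "pull_char (conj_set G a H) \<Psi> (conj_fun G a H \<phi>) = \<Phi> \<phi>" if \<phi>: "\<phi> \<in> carrier (dual (G \<restriction> H) A)" for \<phi>
      unfolding key[OF \<phi>] unfolding eq
      by (simp only: T.conj_char_conj_fun[OF image_subgroup[OF H] f_closed[OF a] transport_dual[OF H \<phi>]]
          push_char_transport[OF H \<phi>])
    then show "pull_char (conj_set G a H) \<Psi> = conj_char G A a H \<Phi>"
      by (intro S.conj_char_eqI[OF H a, symmetric]) (simp_all add: pull_char_def)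
  next
    assume eq: "pull_char (conj_set G a H) \<Psi> = conj_char G A a H \<Phi>"
    have "\<Psi> (conj_fun G' (f a) (f ` H) \<psi>) = push_char H \<Phi> \<psi>"
      if \<psi>: "\<psi> \<in> carrier (dual (G' \<restriction> (f ` H)) A)" for \<psi>
    proof -
      define \<phi> where "\<phi> = dual_map (G \<restriction> H) f \<psi>"
      have \<phi>: "\<phi> \<in> carrier (dual (G \<restriction> H) A)" and \<psi>\<phi>: "\<psi> = transport H \<phi>"
        using dual_map_dual[OF H \<psi>] by (simp_all add: \<phi>_def)
      show ?thesis unfolding \<psi>\<phi> key[OF \<phi>, symmetric] push_char_transport[OF H \<phi>] eq
        by (rule S.conj_char_conj_fun[OF H a \<phi>])
    qed
    then show "\<Psi> = conj_char G' A (f a) (f ` H) (push_char H \<Phi>)"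
      using \<Psi> by (intro T.conj_char_eqI[OF image_subgroup[OF H] f_closed[OF a], symmetric])
        (simp_all add: f_conj_set[OF a Hs])
  qed
qed

lemma conjugate_iso:
  assumes H: "subgroup H G" and M: "subgroup M G" and \<Psi>: "(f ` M, \<Psi>) \<in> XX G' A"
  shows "conjugate_pairs G' A (f ` H) (push_char H \<Phi>) (f ` M) \<Psi>
    \<longleftrightarrow> conjugate_pairs G A H \<Phi> M (pull_char M \<Psi>)"
proof -
  note Hs = subgroup.subset[OF H] and Ms = subgroup.subset[OF M]
  have eq: "(f ` M = conj_set G' (f a) (f ` H) \<and> \<Psi> = conj_char G' A (f a) (f ` H) (push_char H \<Phi>))
     \<longleftrightarrow> (M = conj_set G a H \<and> pull_char M \<Psi> = conj_char G A a H \<Phi>)" if a: "a \<in> carrier G" for a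
  proof -
    have "f ` M = conj_set G' (f a) (f ` H) \<longleftrightarrow> M = conj_set G a H"
      unfolding f_conj_set[OF a Hs, symmetric]
      using inj_on_image_eq_iff[OF f_inj Ms S.conj_set_closed[OF a Hs]] .
    then show ?thesis using conj_char_iso[OF H a, of \<Psi> \<Phi>] \<Psi> by (auto simp: XX_iff)
  qed
  show ?thesis unfolding conjugate_pairs_def f_image[symmetric] bex_simps(7) using eq by blast
qed

lemma iso_carrier:
  assumes x: "x \<in> fburn_carrier G A"
  shows "fburn_iso G G' f x \<in> fburn_carrier G' A"
proof (rule linmap_carrier[OF linear_iso x])
  fix U \<phi> assume p: "(U, \<phi>) \<in> pairs G A"
  show "fburn_iso G G' f (basis G U \<phi>) \<in> fburn_carrier G' A"
    unfolding iso_basis[OF p] by (rule basis_carrier[OF transport_pairs[OF p]])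
qed

end

text \<open>The hypotheses on dual groups pass to \<open>G'\<close> along the isomorphism, so the idempotents of \<open>G'\<close> are
  determined by marks too, and \<open>mark_iso\<close> and \<open>conjugate_iso\<close> compute the marks of the image.\<close>

theorem iso_idem:
  fixes A :: "'a monoid" and G :: "'g monoid" and G' :: "'h monoid"
  assumes "split_fibered_group G A TYPE('k::field_char_0)" and G': "group G'" and f: "f \<in> iso G G'"
    and H: "(H, \<Phi> :: ('g \<Rightarrow> 'a) \<Rightarrow> 'k) \<in> XX G A"
  shows "fburn_iso G G' f (fburn_idem G A H \<Phi>) =
    fburn_idem G' A (f ` H) (compose (carrier (dual (G' \<restriction> (f ` H)) A)) \<Phi> (dual_map (G \<restriction> H) f))"
proof -
  interpret S: split_fibered_group G A "TYPE('k)" by fact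
  interpret G': group G' by fact
  have "finite (carrier G')" using f S.fin by (auto simp: iso_def dest: bij_betw_finite)
  then interpret T: fibered_group G' A by unfold_locales
  interpret fibered_iso G G' A f by unfold_locales fact
  interpret T: split_fibered_group G' A "TYPE('k)"
  proof (unfold_locales)
    fix V assume "subgroup V G'"
    then obtain U where U: "subgroup U G" "V = f ` U" by (rule subgroup_image)
    note t = dual_transfer[OF S.A.comm_group_axioms subgroup.subgroup_is_group[OF U(1) S.is_group]
        subgroup.subgroup_is_group[OF image_subgroup[OF U(1)] G'] iso_restr[OF U(1)]
        S.finite_dual[OF U(1)] S.splitting_dual[OF U(1)]]
    show "finite (carrier (dual (G' \<restriction> V) A))" "splitting_field TYPE('k) (dual (G' \<restriction> V) A)"
      unfolding U(2) by (rule t)+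
  qed
  have Hs: "subgroup H G" using H by (simp add: XX_iff)
  show ?thesis unfolding push_char_def[symmetric]
  proof (rule T.fburn_idem_eqI[OF push_char_XX[OF H] iso_carrier[OF S.fburn_idem_props(1)[OF H]], symmetric])
    fix L and \<Psi> :: "('h \<Rightarrow> 'a) \<Rightarrow> 'k" assume L: "(L, \<Psi>) \<in> XX G' A"
    then obtain M where M: "subgroup M G" "L = f ` M" using subgroup_image[of L] by (auto simp: XX_iff)
    have M': "(M, pull_char M \<Psi>) \<in> XX G A" using pull_char_XX L M by blast
    show "fburn_mark G' L \<Psi> (fburn_iso G G' f (fburn_idem G A H \<Phi>))
      = (if conjugate_pairs G' A (f ` H) (push_char H \<Phi>) L \<Psi> then 1 else 0)"
      unfolding M(2) mark_iso[OF S.fburn_idem_props(1)[OF H] M(1)] S.fburn_idem_props(2)[OF H M']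
      using conjugate_iso[OF Hs M(1)] L unfolding M(2) by metis
  qed
qed

section \<open>Conjugation and twists\<close>

context split_fibered_group
begin

lemma subgroup_split_fibered:
  assumes H: "subgroup H G" shows "split_fibered_group (G \<restriction> H) A TYPE('k)"
proof -
  interpret H: fibered_group "G \<restriction> H" A by (rule subgroup_fibered[OF H])
  show ?thesis using subgroup_restr_iff[OF H] finite_dual splitting_dual by unfold_locales auto
qed

text \<open>Conjugation by \<open>g\<close> is an isomorphism from \<open>H\<close> to \<open>\<^sup>gH\<close>, and precomposition with it on dual groups
  is conjugation by \<open>g\<^sup>-\<^sup>1\<close>.\<close>

theorem conj_idem:
  assumes g: "g \<in> carrier G" and H: "subgroup H G"
    and L: "(L, \<Psi> :: ('g \<Rightarrow> 'a) \<Rightarrow> 'k) \<in> XX (G \<restriction> H) A"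
  shows "fburn_conj G g H (fburn_idem (G \<restriction> H) A L \<Psi>)
    = fburn_idem (G \<restriction> conj_set G g H) A (conj_set G g L) (conj_char G A g L \<Psi>)"
proof -
  have Hs: "H \<subseteq> carrier G" using H by (rule subgroup.subset)
  have sub: "subgroup L (G \<restriction> H)" using L by (simp add: XX_iff)
  then have Ls: "L \<subseteq> H" "subgroup L G" using subgroup_restr_iff[OF H] by auto
  then have Lc: "L \<subseteq> carrier G" using Hs by blast
  have gr: "group (G \<restriction> conj_set G g H)"
    using subgroup.subgroup_is_group[OF conj_set_subgroup[OF H g] is_group] .
  have iso: "conj_map G g \<in> iso (G \<restriction> H) (G \<restriction> conj_set G g H)"
    using conj_map_mult[OF g] Hs inj_on_subset[OF inj_on_conj_map[OF g] Hs]
    by (auto simp: iso_def hom_def bij_betw_def conj_set_def subset_iff)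
  have "compose (carrier (dual (G \<restriction> conj_set G g H \<restriction> (conj_map G g ` L)) A)) \<Psi>
          (dual_map (G \<restriction> H \<restriction> L) (conj_map G g)) = conj_char G A g L \<Psi>" (is "?C = _")
  proof -
    have "\<Psi> (dual_map (G \<restriction> L) (conj_map G g) \<phi>) = \<Psi> (conj_fun G (inv g) (conj_set G g L) \<phi>)"
      if \<phi>: "\<phi> \<in> carrier (dual (G \<restriction> conj_set G g L) A)" for \<phi>
    proof -
      have "conj_fun G (inv g) (conj_set G g L) \<phi> = dual_map (G \<restriction> L) (conj_map G g) \<phi>"
      proof (rule conj_fun_eqI)
        show "dual_map (G \<restriction> L) (conj_map G g) \<phi> \<in> extensional (conj_set G (inv g) (conj_set G g L))"
          using Lc g by (simp add: dual_map_def compose_def conj_set_conj_set)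
        fix x assume "x \<in> conj_set G g L"
        then obtain y where "y \<in> L" "x = conj_map G g y" by (auto simp: conj_set_def)
        then show "dual_map (G \<restriction> L) (conj_map G g) \<phi> (conj_map G (inv g) x) = \<phi> x"
          using Lc g by (simp add: dual_map_def compose_def subset_iff)
      qed (use g conj_set_closed[OF g Lc] in auto)
      then show ?thesis by simp
    qed
    then show ?thesis by (auto simp: compose_def conj_char_def conj_set_def[symmetric] intro!: restrict_ext)
  qed
  then show ?thesis
    using iso_idem[OF subgroup_split_fibered[OF H] gr iso L] unfolding fburn_conj_def
    by (simp add: conj_set_def[of G g L])
qed

end

context fibered_group
begin

abbreviation twist :: "('g \<Rightarrow> 'a) \<Rightarrow> 'g set \<Rightarrow> ('g \<Rightarrow> 'a) \<Rightarrow> ('g \<Rightarrow> 'a)" where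
  "twist \<alpha> U \<phi> \<equiv> restrict \<alpha> U \<otimes>\<^bsub>dual (G \<restriction> U) A\<^esub> \<phi>"

lemma twist_conj:
  assumes \<alpha>: "\<alpha> \<in> carrier (dual G A)" and g: "g \<in> carrier G" and x: "x \<in> carrier G"
  shows "\<alpha> (conj_map G g x) = \<alpha> x"
proof -
  have "\<alpha> \<in> carrier (dual (G \<restriction> carrier G) A)" using \<alpha> by simp
  then have "conj_fun G g (carrier G) \<alpha> = \<alpha>"
    by (rule conj_fun_self[OF subgroup_self g _ A.comm_group_axioms])
  then show ?thesis using conj_fun_conj_map[OF g subset_refl x, of \<alpha>] by simp
qed

lemma restrict_twist_dual:
  assumes "\<alpha> \<in> carrier (dual G A)" "subgroup U G"
  shows "restrict \<alpha> U \<in> carrier (dual (G \<restriction> U) A)"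
  by (rule restrict_dual[where U = "carrier G", OF _ subgroup.subset[OF assms(2)] assms(2)])
    (use assms(1) in simp)

lemma twist_pairs:
  assumes "\<alpha> \<in> carrier (dual G A)" "(U, \<phi>) \<in> pairs G A"
  shows "(U, twist \<alpha> U \<phi>) \<in> pairs G A"
  using assms dual_mult_closed[OF A.comm_group_axioms is_group] restrict_twist_dual by (auto simp: pairs_def)

text \<open>\<open>\<alpha>\<close> is invariant under conjugation because it is defined on the whole group.\<close>

lemma conj_fun_twist:
  assumes \<alpha>: "\<alpha> \<in> carrier (dual G A)" and U: "U \<subseteq> carrier G" and g: "g \<in> carrier G"
  shows "conj_fun G g U (twist \<alpha> U \<phi>)
    = twist \<alpha> (conj_set G g U) (conj_fun G g U \<phi>)"
proof (rule conj_fun_eqI[OF g U])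
  fix x assume x: "x \<in> U"
  then have "conj_map G g x \<in> conj_set G g U" by (simp add: conj_set_def)
  then show "(twist \<alpha> (conj_set G g U) (conj_fun G g U \<phi>)) (conj_map G g x)
      = (twist \<alpha> U \<phi>) x"
    using x U g twist_conj[OF \<alpha> g] by (simp add: dual_mult_apply subset_iff)
qed (simp add: dual_def)

lemma tw_basis:
  assumes \<alpha>: "\<alpha> \<in> carrier (dual G A)" and p: "(U, \<phi>) \<in> pairs G A"
  shows "fburn_tw G A \<alpha> (basis G U \<phi>) = basis G U (twist \<alpha> U \<phi>)"
  unfolding fburn_tw_def
proof (rule lin_ext_basis)
  fix g assume g: "g \<in> carrier G"
  show "basis G (conj_set G g U) (twist \<alpha> (conj_set G g U) (conj_fun G g U \<phi>))
      = basis G U (twist \<alpha> U \<phi>)"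
    unfolding conj_fun_twist[OF \<alpha> pairsD(3)[OF p] g, symmetric] basis_def
    by (simp add: pair_class_conj[OF twist_pairs[OF \<alpha> p] g])
qed

lemma linear_tw: "linmap (fburn_tw G A \<alpha>)"
  unfolding fburn_tw_def by (rule linear_lin_ext)

lemma tw_carrier:
  assumes \<alpha>: "\<alpha> \<in> carrier (dual G A)" and x: "x \<in> fburn_carrier G A"
  shows "fburn_tw G A \<alpha> x \<in> fburn_carrier G A"
proof (rule linmap_carrier[OF linear_tw x])
  fix U \<phi> assume p: "(U, \<phi>) \<in> pairs G A"
  show "fburn_tw G A \<alpha> (basis G U \<phi>) \<in> fburn_carrier G A"
    unfolding tw_basis[OF \<alpha> p] by (rule basis_carrier[OF twist_pairs[OF \<alpha> p]])
qed

text \<open>For every \<open>a\<close> the restriction to \<open>H\<close> of the conjugated product is \<open>\<alpha>|\<^sub>H\<close> times that of \<open>\<^sup>a\<phi>\<close>, so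
  \<open>\<Phi>\<close> splits off the factor \<open>\<Phi>(\<alpha>|\<^sub>H)\<close>, which does not depend on \<open>a\<close>.\<close>

theorem mark_tw:
  fixes \<Phi> :: "('g \<Rightarrow> 'a) \<Rightarrow> 'k::field_char_0"
  assumes \<alpha>: "\<alpha> \<in> carrier (dual G A)" and x: "x \<in> fburn_carrier G A" and H: "(H, \<Phi>) \<in> XX G A"
  shows "fburn_mark G H \<Phi> (fburn_tw G A \<alpha> x) = \<Phi> (restrict \<alpha> H) * fburn_mark G H \<Phi> x"
proof (rule linform_eq_on_carrier[where T = "\<lambda>x. fburn_mark G H \<Phi> (fburn_tw G A \<alpha> x)", OF _ _ x])
  have Hs: "subgroup H G" and \<Phi>: "\<Phi> \<in> characters (dual (G \<restriction> H) A)" using H by (auto simp: XX_iff)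
  fix U \<phi> assume p: "(U, \<phi>) \<in> pairs G A"
  let ?\<psi> = "twist \<alpha> U \<phi>"
  note q = twist_pairs[OF \<alpha> p]
  have "point_mark G H \<Phi> U ?\<psi> a = \<Phi> (restrict \<alpha> H) * point_mark G H \<Phi> U \<phi> a" if a: "a \<in> carrier G" for a
  proof (cases "H \<subseteq> conj_set G a U")
    case True
    have "restrict (conj_fun G a U ?\<psi>) H
        = restrict \<alpha> H \<otimes>\<^bsub>dual (G \<restriction> H) A\<^esub> restrict (conj_fun G a U \<phi>) H"
      unfolding conj_fun_twist[OF \<alpha> pairsD(3)[OF p] a]
      using True by (auto simp: dual_def subset_iff intro!: restrict_ext)
    then show ?thesis
      using True character_mult[OF \<Phi> restrict_twist_dual[OF \<alpha> Hs] restrict_conj_dual[OF p a Hs True]]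
      by (simp add: point_mark_def)
  qed (simp add: point_mark_def)
  then show "fburn_mark G H \<Phi> (fburn_tw G A \<alpha> (basis G U \<phi>)) = \<Phi> (restrict \<alpha> H) * fburn_mark G H \<Phi> (basis G U \<phi>)"
    unfolding tw_basis[OF \<alpha> p] mark_basis[OF p Hs] mark_basis[OF q Hs] by (simp add: sum_distrib_left)
qed (rule linformI; simp add: linmap_add[OF linear_tw] linmap_scal[OF linear_tw]
    mark_linear algebra_simps)+

end

text \<open>The factors by which twisting scales the marks agree with \<open>\<Phi>(\<alpha>|\<^sub>H)\<close> at every pair conjugate to
  \<open>(H, \<Phi>)\<close>, and at all other pairs both sides have mark \<open>0\<close>.\<close>

theorem (in split_fibered_group) tw_idem:
  assumes \<alpha>: "\<alpha> \<in> carrier (dual G A)" and H: "(H, \<Phi> :: ('g \<Rightarrow> 'a) \<Rightarrow> 'k) \<in> XX G A"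
  shows "fburn_tw G A \<alpha> (fburn_idem G A H \<Phi>) = \<Phi> (restrict \<alpha> H) *\<^sub>K fburn_idem G A H \<Phi>"
proof (rule marks_eqI)
  note e = fburn_idem_props[OF H]
  show "fburn_tw G A \<alpha> (fburn_idem G A H \<Phi>) \<in> fburn_carrier G A" by (rule tw_carrier[OF \<alpha> e(1)])
  show "\<Phi> (restrict \<alpha> H) *\<^sub>K fburn_idem G A H \<Phi> \<in> fburn_carrier G A" by (rule fburn_carrier_scal[OF e(1)])
  fix L and \<Psi> :: "('g \<Rightarrow> 'a) \<Rightarrow> 'k" assume L: "(L, \<Psi>) \<in> XX G A"
  have "\<Psi> (restrict \<alpha> L) = \<Phi> (restrict \<alpha> H)" if c: "conjugate_pairs G A H \<Phi> L \<Psi>"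
  proof -
    obtain g where g: "g \<in> carrier G" and Lg: "L = conj_set G g H" and \<Psi>: "\<Psi> = conj_char G A g H \<Phi>"
      using c by (auto simp: conjugate_pairs_def)
    have Hs: "subgroup H G" using H by (simp add: XX_iff)
    have "conj_fun G g H (restrict \<alpha> H) = restrict \<alpha> L"
      using subgroup.subset[OF Hs] twist_conj[OF \<alpha> g]
      by (intro conj_fun_eqI[OF g]) (auto simp: Lg conj_set_def)
    then show ?thesis
      using conj_char_conj_fun[OF Hs g restrict_twist_dual[OF \<alpha> Hs], of \<Phi>] by (simp add: \<Psi>)
  qed
  then show "fburn_mark G L \<Psi> (fburn_tw G A \<alpha> (fburn_idem G A H \<Phi>))
      = fburn_mark G L \<Psi> (\<Phi> (restrict \<alpha> H) *\<^sub>K fburn_idem G A H \<Phi>)"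
    unfolding mark_tw[OF \<alpha> e(1) L] linform_scal[OF linear_mark] e(2)[OF L] by simp
qed

section \<open>Twisted diagonals in the square of the group\<close>

context fibered_group
begin

abbreviation G2 :: "('g \<times> 'g) monoid" where
  "G2 \<equiv> G \<times>\<times> G"

definition diag_fun :: "'g set \<Rightarrow> ('g \<Rightarrow> 'a) \<Rightarrow> ('g \<times> 'g \<Rightarrow> 'a)" where
  "diag_fun U \<phi> = (\<lambda>(u, v)\<in>Id_on U. \<phi> u)"

lemma square_fibered: "fibered_group G2 A"
proof -
  interpret GG: group G2 by (rule DirProd_group[OF is_group is_group])
  show ?thesis using fin by unfold_locales simp
qed

lemma conj_map_square:
  "\<lbrakk>g \<in> carrier G; h \<in> carrier G\<rbrakk> \<Longrightarrow> conj_map G2 (g, h) (x, y) = (conj_map G g x, conj_map G h y)"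
  by (simp add: conj_map_def inv_DirProd[OF is_group is_group])

lemma diag_pairs:
  assumes p: "(U, \<phi>) \<in> pairs G A"
  shows "(Id_on U, diag_fun U \<phi>) \<in> pairs G2 A"
proof -
  note U = pairsD[OF p]
  interpret U: subgroup U G by (rule U(1))
  have "subgroup (Id_on U) G2"
  proof (rule group.subgroupI[OF DirProd_group[OF is_group is_group]])
    show "Id_on U \<subseteq> carrier G2" using U(3) by auto
    show "Id_on U \<noteq> {}" using U.one_closed by blast
    fix p assume "p \<in> Id_on U"
    then obtain u where u: "u \<in> U" "p = (u, u)" by blast
    then show "inv\<^bsub>G \<times>\<times> G\<^esub> p \<in> Id_on U"
      using U(3) inv_DirProd[OF is_group is_group, of u u] by (simp add: subset_iff Id_on_iff)
    fix q assume "q \<in> Id_on U"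
    then obtain v where "v \<in> U" "q = (v, v)" by blast
    then show "p \<otimes>\<^bsub>G \<times>\<times> G\<^esub> q \<in> Id_on U" using u by (simp add: Id_on_iff)
  qed
  then show ?thesis using U(2) by (auto simp: pairs_def dual_def hom_def Pi_iff diag_fun_def)
qed

lemma conj_set_diag:
  assumes "g \<in> carrier G" "h \<in> carrier G"
  shows "conj_set G2 (g, h) (Id_on U) = {(conj_map G g u, conj_map G h u) | u. u \<in> U}"
proof -
  have "Id_on U = (\<lambda>u. (u, u)) ` U" by auto
  then show ?thesis using assms by (auto simp: conj_set_def image_image conj_map_square)
qed

lemma conj_fun_diag:
  assumes "U \<subseteq> carrier G" "g \<in> carrier G" "h \<in> carrier G" "u \<in> U"
  shows "conj_fun G2 (g, h) (Id_on U) (diag_fun U \<phi>) (conj_map G g u, conj_map G h u) = \<phi> u"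
proof -
  interpret GG: fibered_group G2 A by (rule square_fibered)
  have "Id_on U \<subseteq> carrier G2" using assms(1) by auto
  then show ?thesis
    using GG.conj_fun_conj_map[of "(g, h)" "Id_on U" "(u, u)" "diag_fun U \<phi>"] assms
    by (auto simp: conj_map_square diag_fun_def)
qed

lemma Delta_basis:
  assumes p: "(U, \<phi>) \<in> pairs G A"
  shows "fburn_Delta G (basis G U \<phi>) = basis G2 (Id_on U) (diag_fun U \<phi>)"
  unfolding fburn_Delta_def diag_fun_def[symmetric]
proof (rule lin_ext_basis)
  interpret GG: fibered_group G2 A by (rule square_fibered)
  note U = pairsD[OF p]
  fix g assume g: "g \<in> carrier G"
  have IdU: "Id_on U \<subseteq> carrier G2" using U(3) by auto
  have set: "conj_set G2 (g, g) (Id_on U) = Id_on (conj_set G g U)"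
    unfolding conj_set_diag[OF g g] by (auto simp: conj_set_def[of G])
  have "conj_fun G2 (g, g) (Id_on U) (diag_fun U \<phi>) = diag_fun (conj_set G g U) (conj_fun G g U \<phi>)"
  proof (rule GG.conj_fun_eqI[OF _ IdU])
    show "diag_fun (conj_set G g U) (conj_fun G g U \<phi>) \<in> extensional (conj_set G2 (g, g) (Id_on U))"
      unfolding set by (simp add: diag_fun_def)
    fix p assume "p \<in> Id_on U"
    then obtain u where u: "u \<in> U" "p = (u, u)" by auto
    then have "conj_map G g u \<in> conj_set G g U" by (simp add: conj_set_def)
    then show "diag_fun (conj_set G g U) (conj_fun G g U \<phi>) (conj_map G2 (g, g) p) = diag_fun U \<phi> p"
      using u g U(3) by (auto simp: conj_map_square diag_fun_def)
  qed (use g in simp)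
  then have "pair_class G2 (Id_on (conj_set G g U)) (diag_fun (conj_set G g U) (conj_fun G g U \<phi>))
      = pair_class G2 (Id_on U) (diag_fun U \<phi>)"
    using GG.pair_class_conj[OF diag_pairs[OF p], of "(g, g)"] g set by simp
  then show "basis G2 (Id_on (conj_set G g U)) (diag_fun (conj_set G g U) (conj_fun G g U \<phi>))
      = basis G2 (Id_on U) (diag_fun U \<phi>)" by (simp add: basis_def)
qed

lemma pair_one:
  assumes "(U, \<phi>) \<in> pairs G A" shows "\<phi> \<one> = \<one>\<^bsub>A\<^esub>"
proof -
  note U = pairsD[OF assms]
  have "group_hom (G \<restriction> U) A \<phi>"
    using U subgroup.subgroup_is_group[OF U(1) is_group]
    by (simp add: group_hom_def group_hom_axioms_def dual_def)
  from group_hom.hom_one[OF this] show ?thesis by simp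
qed

lemma dc_reps_full:
  assumes "subgroup U G" obtains t where "t \<in> carrier G" "dc_reps G U (carrier G) = {t}"
proof -
  have "(U #> g) <#> carrier G = carrier G" if g: "g \<in> carrier G" for g
  proof (intro equalityI subsetI)
    fix x assume "x \<in> (U #> g) <#> carrier G"
    then show "x \<in> carrier G" using g subgroup.subset[OF assms] by (auto simp: double_coset_mem)
  next
    fix x assume x: "x \<in> carrier G"
    have "x = \<one> \<otimes> g \<otimes> (inv g \<otimes> x)" using x g by simp
    then show "x \<in> (U #> g) <#> carrier G"
      unfolding double_coset_mem using x g subgroup.one_closed[OF assms] by blast
  qed
  then have "double_cosets G U (carrier G) = {carrier G}" unfolding double_cosets_def using one_closed by blast
  then have "dc_reps G U (carrier G) = {SOME g. g \<in> carrier G}" by (simp add: dc_reps_def)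
  moreover have "(SOME g. g \<in> carrier G) \<in> carrier G" using one_closed by (rule someI)
  ultimately show ?thesis using that by blast
qed

lemma linear_bimult_left: "linmap (\<lambda>x. bimult G A x y)"
  unfolding bimult_def by (rule linear_lin_ext)

text \<open>An element of the composition is \<open>(gug\<^sup>-\<^sup>1, kuk\<^sup>-\<^sup>1)\<close> through the unique middle term \<open>huh\<^sup>-\<^sup>1\<close>: the second
  twisted diagonal is the graph of conjugation by \<open>r s\<^sup>-\<^sup>1\<close>, whence \<open>k = r s\<^sup>-\<^sup>1 h\<close>. The values multiply
  to \<open>\<phi>(u) \<alpha>(u)\<close> by conjugation invariance of \<open>\<alpha>\<close>.\<close>

lemma star_twisted_diagonals:
  assumes p: "(U, \<phi>) \<in> pairs G A" and \<alpha>: "\<alpha> \<in> carrier (dual G A)"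
    and g: "g \<in> carrier G" and h: "h \<in> carrier G" and s: "s \<in> carrier G" and r: "r \<in> carrier G"
  defines "U' \<equiv> conj_set G2 (g, h) (Id_on U)"
    and "\<phi>' \<equiv> conj_fun G2 (g, h) (Id_on U) (diag_fun U \<phi>)"
    and "V' \<equiv> conj_set G2 (s, r) (Id_on (carrier G))"
    and "\<psi>' \<equiv> conj_fun G2 (s, r) (Id_on (carrier G)) (diag_fun (carrier G) \<alpha>)"
    and "k \<equiv> r \<otimes> inv s \<otimes> h"
  shows "U' O V' = conj_set G2 (g, k) (Id_on U)"
    and "star_fun A U' V' \<phi>' \<psi>' =
      conj_fun G2 (g, k) (Id_on U) (diag_fun U (twist \<alpha> U \<phi>))"
proof -
  interpret GG: fibered_group G2 A by (rule square_fibered)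
  note U = pairsD[OF p]
  have k: "k \<in> carrier G" using h s r by (simp add: k_def)
  have U'm: "(x, y) \<in> U' \<longleftrightarrow> (\<exists>u\<in>U. x = conj_map G g u \<and> y = conj_map G h u)" for x y
    using conj_set_diag[OF g h] by (auto simp: U'_def)
  have V'm: "(x, y) \<in> V' \<longleftrightarrow> x \<in> carrier G \<and> y = conj_map G (r \<otimes> inv s) x" for x y
  proof
    assume "(x, y) \<in> V'"
    then obtain v where "v \<in> carrier G" "x = conj_map G s v" "y = conj_map G r v"
      using conj_set_diag[OF s r] by (auto simp: V'_def)
    then show "x \<in> carrier G \<and> y = conj_map G (r \<otimes> inv s) x"
      using s r by (simp add: conj_map_conj_map m_assoc)
  next
    assume xy: "x \<in> carrier G \<and> y = conj_map G (r \<otimes> inv s) x"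
    let ?v = "conj_map G (inv s) x"
    have "?v \<in> carrier G" "x = conj_map G s ?v" "y = conj_map G r ?v"
      using xy s r by (simp_all add: conj_map_conj_map)
    then show "(x, y) \<in> V'" unfolding V'_def conj_set_diag[OF s r] by blast
  qed
  have kh: "conj_map G (r \<otimes> inv s) (conj_map G h u) = conj_map G k u" if "u \<in> U" for u
    using that U(3) h s r by (auto simp: conj_map_conj_map k_def)
  show UV: "U' O V' = conj_set G2 (g, k) (Id_on U)"
  proof (intro equalityI subsetI)
    fix p assume "p \<in> U' O V'"
    then obtain x y z where p: "p = (x, z)" and "(x, y) \<in> U'" "(y, z) \<in> V'" by blast
    then obtain u where u: "u \<in> U" "x = conj_map G g u" "y = conj_map G h u" "z = conj_map G (r \<otimes> inv s) y"
      unfolding U'm V'm by blast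
    then show "p \<in> conj_set G2 (g, k) (Id_on U)"
      unfolding conj_set_diag[OF g k] p using kh[OF u(1)] by blast
  next
    fix p assume "p \<in> conj_set G2 (g, k) (Id_on U)"
    then obtain u where u: "u \<in> U" "p = (conj_map G g u, conj_map G k u)"
      unfolding conj_set_diag[OF g k] by blast
    have "(conj_map G g u, conj_map G h u) \<in> U'" using u(1) U'm by blast
    moreover have "(conj_map G h u, conj_map G k u) \<in> V'" using u(1) U(3) h kh[OF u(1)] by (auto simp: V'm)
    ultimately show "p \<in> U' O V'" unfolding u(2) by blast
  qed
  have IdU: "Id_on U \<subseteq> carrier G2" using U(3) by auto
  show "star_fun A U' V' \<phi>' \<psi>' =
      conj_fun G2 (g, k) (Id_on U) (diag_fun U (twist \<alpha> U \<phi>))"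
  proof (rule GG.conj_fun_eqI[OF _ IdU, symmetric])
    show "star_fun A U' V' \<phi>' \<psi>' \<in> extensional (conj_set G2 (g, k) (Id_on U))"
      unfolding star_fun_def UV by simp
    fix p assume "p \<in> Id_on U"
    then obtain u where u: "u \<in> U" "p = (u, u)" by auto
    have uG: "u \<in> carrier G" using u(1) U(3) by blast
    let ?x = "conj_map G g u" and ?y = "conj_map G h u" and ?z = "conj_map G k u"
    have mem: "(?x, ?y) \<in> U' \<and> (?y, ?z) \<in> V'"
      using u(1) uG h kh[OF u(1)] by (auto simp: U'm V'm)
    \<comment> \<open>The middle term selected by choice in \<open>star_fun\<close> is unique, since conjugation by \<open>g\<close> is injective.\<close>
    have uniq: "y = ?y" if "(?x, y) \<in> U' \<and> (y, ?z) \<in> V'" for y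
    proof -
      from that obtain v where v: "v \<in> U" "?x = conj_map G g v" "y = conj_map G h v" unfolding U'm by blast
      then have "u = v" using inj_onD[OF inj_on_conj_map[OF g] v(2)] uG U(3) by blast
      then show ?thesis using v by simp
    qed
    have some: "(SOME y. (?x, y) \<in> U' \<and> (y, ?z) \<in> V') = ?y" using mem uniq by (rule some_equality)
    have "(?x, ?z) \<in> U' O V'" using mem by blast
    then have "star_fun A U' V' \<phi>' \<psi>' (?x, ?z) = \<phi>' (?x, ?y) \<otimes>\<^bsub>A\<^esub> \<psi>' (?y, ?z)"
      by (simp add: star_fun_def some Let_def)
    also have "\<phi>' (?x, ?y) = \<phi> u" unfolding \<phi>'_def by (rule conj_fun_diag[OF U(3) g h u(1)])
    also have "\<psi>' (?y, ?z) = \<alpha> u"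
    proof -
      let ?v = "conj_map G (inv s \<otimes> h) u"
      have v: "?v \<in> carrier G" using s h uG by simp
      have "?y = conj_map G s ?v" "?z = conj_map G r ?v"
        using s r h uG by (simp_all add: conj_map_conj_map k_def m_assoc)
      then have "\<psi>' (?y, ?z) = \<alpha> ?v" unfolding \<psi>'_def using conj_fun_diag[OF subset_refl s r v] by simp
      then show ?thesis using twist_conj[OF \<alpha> _ uG, of "inv s \<otimes> h"] s h by simp
    qed
    also have "\<phi> u \<otimes>\<^bsub>A\<^esub> \<alpha> u = \<alpha> u \<otimes>\<^bsub>A\<^esub> \<phi> u"
      using U(2) \<alpha> u(1) uG by (intro A.m_comm) (auto simp: dual_def hom_def)
    finally have "star_fun A U' V' \<phi>' \<psi>' (?x, ?z) = \<alpha> u \<otimes>\<^bsub>A\<^esub> \<phi> u" .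
    then show "star_fun A U' V' \<phi>' \<psi>' (conj_map G2 (g, k) p)
        = diag_fun U (twist \<alpha> U \<phi>) p"
      using u g k by (auto simp: conj_map_square diag_fun_def dual_mult_apply)
  qed (use g k in simp)
qed

text \<open>The representatives chosen for the two classes are twisted diagonals. The second one projects onto
  \<open>G\<close>, so there is a single double coset, and twisted diagonals have trivial kernels \<open>k1\<close>, \<open>k2\<close>, so the
  compatibility condition holds.\<close>

lemma bimult_Delta_basis:
  assumes p: "(U, \<phi>) \<in> pairs G A" and \<alpha>: "\<alpha> \<in> carrier (dual G A)"
  shows "bimult G A (fburn_Delta G (basis G U \<phi>)) (tw_elem G \<alpha>)
    = fburn_Delta G (basis G U (twist \<alpha> U \<phi>))"
proof -
  interpret GG: fibered_group G2 A by (rule square_fibered)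
  note U = pairsD[OF p]
  have q: "(carrier G, \<alpha>) \<in> pairs G A" using \<alpha> subgroup_self by (simp add: pairs_def)
  have tw: "tw_elem G \<alpha> = basis G2 (Id_on (carrier G)) (diag_fun (carrier G) \<alpha>)"
    unfolding tw_elem_def by (rule Delta_basis[OF q])
  obtain c where c: "c \<in> carrier G2"
    and cs: "(SOME p. p \<in> pair_class G2 (Id_on U) (diag_fun U \<phi>))
      = (conj_set G2 c (Id_on U), conj_fun G2 c (Id_on U) (diag_fun U \<phi>))"
    using GG.pair_class_rep by blast
  obtain g h where gh: "c = (g, h)" "g \<in> carrier G" "h \<in> carrier G" using c by auto
  obtain d where d: "d \<in> carrier G2"
    and ds: "(SOME p. p \<in> pair_class G2 (Id_on (carrier G)) (diag_fun (carrier G) \<alpha>))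
      = (conj_set G2 d (Id_on (carrier G)), conj_fun G2 d (Id_on (carrier G)) (diag_fun (carrier G) \<alpha>))"
    using GG.pair_class_rep by blast
  obtain m n where mn: "d = (m, n)" "m \<in> carrier G" "n \<in> carrier G" using d by auto
  define U' where "U' = conj_set G2 (g, h) (Id_on U)"
  define \<phi>' where "\<phi>' = conj_fun G2 (g, h) (Id_on U) (diag_fun U \<phi>)"
  define V' where "V' = conj_set G2 (m, n) (Id_on (carrier G))"
  define \<psi>' where "\<psi>' = conj_fun G2 (m, n) (Id_on (carrier G)) (diag_fun (carrier G) \<alpha>)"
  have pU: "(U', \<phi>') \<in> pairs G2 A" and pV: "(V', \<psi>') \<in> pairs G2 A"
    unfolding U'_def \<phi>'_def V'_def \<psi>'_def using GG.pairs_conj diag_pairs p q c d gh(1) mn(1) by blast+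
  have sndU: "snd ` U' = conj_set G h U"
    unfolding U'_def conj_set_diag[OF gh(2,3)] by (auto simp: conj_set_def image_def)
  have fstV: "fst ` V' = carrier G"
  proof -
    have "fst ` V' = conj_set G m (carrier G)"
      unfolding V'_def conj_set_diag[OF mn(2,3)] by (auto simp: conj_set_def image_def)
    then show ?thesis using conj_set_self[OF subgroup_self mn(2)] by simp
  qed
  obtain t where t: "t \<in> carrier G" and dc: "dc_reps G (snd ` U') (fst ` V') = {t}"
    unfolding sndU fstV using dc_reps_full[OF conj_set_subgroup[OF U(1) gh(3)]] by blast
  have k1: "k1 G V' = {\<one>}"
  proof (intro equalityI subsetI)
    fix x assume "x \<in> k1 G V'"
    then obtain v where v: "v \<in> carrier G" "x = conj_map G m v" "\<one> = conj_map G n v"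
      unfolding k1_def V'_def conj_set_diag[OF mn(2,3)] by blast
    have "conj_map G n \<one> = \<one>" using mn(3) by (simp add: conj_map_def)
    then have "conj_map G n v = conj_map G n \<one>" using v(3) by simp
    then have "v = \<one>" using inj_onD[OF inj_on_conj_map[OF mn(3)]] v(1) by blast
    then show "x \<in> {\<one>}" using v(2) mn by (simp add: conj_map_def)
  qed (use subgroup.one_closed[OF pairsD(1)[OF pV]] in \<open>simp add: k1_def\<close>)
  have k2: "k2 G U' = {\<one>}"
  proof (intro equalityI subsetI)
    fix x assume "x \<in> k2 G U'"
    then obtain v where v: "v \<in> U" "x = conj_map G h v" "\<one> = conj_map G g v"
      unfolding k2_def U'_def conj_set_diag[OF gh(2,3)] by blast
    have "conj_map G g \<one> = \<one>" using gh(2) by (simp add: conj_map_def)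
    then have "conj_map G g v = conj_map G g \<one>" using v(3) by simp
    then have "v = \<one>" using inj_onD[OF inj_on_conj_map[OF gh(2)]] v(1) U(3) by blast
    then show "x \<in> {\<one>}" using v(2) gh by (simp add: conj_map_def)
  qed (use subgroup.one_closed[OF pairsD(1)[OF pU]] in \<open>simp add: k2_def\<close>)
  have "conj_set G t {\<one>} = {\<one>}" using t by (simp add: conj_set_def conj_map_def)
  then have cond: "restrict (fun2 G A U' \<phi>') (k2 G U' \<inter> conj_set G t (k1 G V'))
      = restrict (conj_fun G t (k1 G V') (fun1 G V' \<psi>')) (k2 G U' \<inter> conj_set G t (k1 G V'))"
    using GG.pair_one[OF pU] GG.pair_one[OF pV] t
    by (auto simp: k1 k2 fun1_def fun2_def conj_fun_def)
  let ?V'' = "conj_set G2 (t, \<one>) V'" and ?\<psi>'' = "conj_fun G2 (t, \<one>) V' \<psi>'"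
  have IdG: "Id_on (carrier G) \<subseteq> carrier G2" by auto
  have V'': "?V'' = conj_set G2 (t \<otimes> m, n) (Id_on (carrier G))"
    and \<psi>'': "?\<psi>'' = conj_fun G2 (t \<otimes> m, n) (Id_on (carrier G)) (diag_fun (carrier G) \<alpha>)"
    unfolding V'_def \<psi>'_def using t mn IdG
    by (simp_all add: GG.conj_set_conj_set GG.conj_fun_conj_fun)
  define k where "k = n \<otimes> inv (t \<otimes> m) \<otimes> h"
  have k: "k \<in> carrier G" using mn t gh by (simp add: k_def)
  have tm: "t \<otimes> m \<in> carrier G" using t mn by simp
  note star = star_twisted_diagonals[OF p \<alpha> gh(2,3) tm mn(3), folded U'_def \<phi>'_def V'' \<psi>'' k_def]
  \<comment> \<open>The index set of the defining sum, in the shape in which it appears there.\<close>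
  have ts: "{t \<in> dc_reps G (snd ` U') (fst ` V'). let Gt = k2 G U' \<inter> conj_set G t (k1 G V') in
      restrict (fun2 G A U' \<phi>') Gt = restrict (conj_fun G t (k1 G V') (fun1 G V' \<psi>')) Gt} = {t}"
    using dc cond by (auto simp: Let_def)
  have "bimult G A (fburn_Delta G (basis G U \<phi>)) (tw_elem G \<alpha>)
      = basis G2 (U' O ?V'') (star_fun A U' ?V'' \<phi>' ?\<psi>'')"
    unfolding bimult_def Delta_basis[OF p] tw basis_def[of G2 "Id_on U"]
      basis_def[of G2 "Id_on (carrier G)"] lin_ext_single cs ds gh(1) mn(1) prod.case
      U'_def[symmetric] \<phi>'_def[symmetric] V'_def[symmetric] \<psi>'_def[symmetric] ts
    by (simp add: Let_def)
  also have "\<dots> = basis G2 (Id_on U) (diag_fun U (twist \<alpha> U \<phi>))"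
    unfolding star basis_def
    using GG.pair_class_conj[OF diag_pairs[OF twist_pairs[OF \<alpha> p]], of "(g, k)"] gh k by simp
  also have "\<dots> = fburn_Delta G (basis G U (twist \<alpha> U \<phi>))"
    by (rule Delta_basis[OF twist_pairs[OF \<alpha> p], symmetric])
  finally show ?thesis .
qed

theorem bimult_Delta_tw:
  assumes x: "x \<in> fburn_carrier G A" and \<alpha>: "\<alpha> \<in> carrier (dual G A)"
  shows "bimult G A (fburn_Delta G x) (tw_elem G \<alpha>) = fburn_Delta G (fburn_tw G A \<alpha> x)"
proof (rule linmap_eq_on_carrier[where T = "\<lambda>x. bimult G A (fburn_Delta G x) (tw_elem G \<alpha>)"
      and T' = "\<lambda>x. fburn_Delta G (fburn_tw G A \<alpha> x)", OF _ _ x])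
  have D: "linmap (fburn_Delta G)" unfolding fburn_Delta_def by (rule linear_lin_ext)
  show "linmap (\<lambda>x. bimult G A (fburn_Delta G x) (tw_elem G \<alpha>))"
    by (rule linmapI) (simp_all add: linmap_add[OF D] linmap_scal[OF D]
        linmap_add[OF linear_bimult_left] linmap_scal[OF linear_bimult_left])
  show "linmap (\<lambda>x. fburn_Delta G (fburn_tw G A \<alpha> x))"
    by (rule linmapI) (simp_all add: linmap_add[OF D] linmap_scal[OF D]
        linmap_add[OF linear_tw] linmap_scal[OF linear_tw])
  fix U \<phi> assume p: "(U, \<phi>) \<in> pairs G A"
  show "bimult G A (fburn_Delta G (basis G U \<phi>)) (tw_elem G \<alpha>) = fburn_Delta G (fburn_tw G A \<alpha> (basis G U \<phi>))"
    unfolding tw_basis[OF \<alpha> p] by (rule bimult_Delta_basis[OF p \<alpha>])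
qed

end

lemma (in split_fibered_group) bimult_Delta_idem:
  assumes \<alpha>: "\<alpha> \<in> carrier (dual G A)" and H: "(H, \<Phi> :: ('g \<Rightarrow> 'a) \<Rightarrow> 'k) \<in> XX G A"
  shows "bimult G A (fburn_Delta G (fburn_idem G A H \<Phi>)) (tw_elem G \<alpha>)
    = \<Phi> (restrict \<alpha> H) *\<^sub>K fburn_Delta G (fburn_idem G A H \<Phi>)"
proof -
  have "linmap (fburn_Delta G :: ('g, 'a, 'k) fburn \<Rightarrow> _)" unfolding fburn_Delta_def by (rule linear_lin_ext)
  then show ?thesis
    by (simp only: bimult_Delta_tw[OF fburn_idem_props(1)[OF H] \<alpha>] tw_idem[OF \<alpha> H] linmap_scal)
qed

theorem proposition4p5:
  fixes A :: "'a monoid" and G :: "'g monoid"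
  assumes "comm_group A"
    and "group G" and "finite (carrier G)"
    and "\<And>U N. subgroup U G \<Longrightarrow> N \<lhd> (G \<restriction> U) \<Longrightarrow>
           finite (carrier (dual ((G \<restriction> U) Mod N) A)) \<and>
           splitting_field TYPE('k::field_char_0) (dual ((G \<restriction> U) Mod N) A)"
  shows
    "(\<forall>(G' :: 'h monoid) f. group G' \<longrightarrow> f \<in> iso G G' \<longrightarrow>
        (\<forall>(H, \<Phi> :: ('g \<Rightarrow> 'a) \<Rightarrow> 'k)\<in>XX G A.
           fburn_iso G G' f (fburn_idem G A H \<Phi>) =
           fburn_idem G' A (f ` H)
             (compose (carrier (dual (G' \<restriction> (f ` H)) A)) \<Phi> (dual_map (G \<restriction> H) f))))
     \<and> (\<forall>g\<in>carrier G. \<forall>H. subgroup H G \<longrightarrow>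
        (\<forall>(K, \<Psi> :: ('g \<Rightarrow> 'a) \<Rightarrow> 'k)\<in>XX (G \<restriction> H) A.
           fburn_conj G g H (fburn_idem (G \<restriction> H) A K \<Psi>) =
           fburn_idem (G \<restriction> conj_set G g H) A (conj_set G g K) (conj_char G A g K \<Psi>)))
     \<and> (\<forall>(H, \<Phi> :: ('g \<Rightarrow> 'a) \<Rightarrow> 'k)\<in>XX G A. \<forall>\<alpha>\<in>carrier (dual G A).
           fburn_tw G A \<alpha> (fburn_idem G A H \<Phi>) = \<Phi> (restrict \<alpha> H) *\<^sub>K fburn_idem G A H \<Phi>
         \<and> bimult G A (fburn_Delta G (fburn_idem G A H \<Phi>)) (tw_elem G \<alpha>) =
           \<Phi> (restrict \<alpha> H) *\<^sub>K fburn_Delta G (fburn_idem G A H \<Phi>))"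
proof -
  interpret split_fibered_group G A "TYPE('k)"
    using assms by (rule split_fibered_groupI)
  show ?thesis
    by (intro conjI) (use iso_idem[OF split_fibered_group_axioms] conj_idem tw_idem bimult_Delta_idem in blast)+
qed

end
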